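(* Let $\Gamma$ be an equilateral non-bipartite metric graph with $n$ vertices, $N$ edges and transition matrix $\mathcal{Z}$, and let $\mu_1\geq\mu_2\geq\cdots\geq\mu_n$ be the eigenvalues of $\mathcal{Z}$ counted with multiplicity. Then $$\lambda_{k+1}(L^{st}(\Gamma))\geq\lambda_{k+N-n}(L^{a/st}(\Gamma))\quad\text{for all } k\in\mathbb{N}$$ holds if and only if both of the following families of inequalities hold: $$\mu_j\leq-\mu_{n+2-j}\quad\text{for all } j \text{ with } 2\leq j\leq n,$$ (that is, $\mu_2\leq-\mu_n,\ \mu_3\leq-\mu_{n-1},\ \dots,\ \mu_{n-1}\leq-\mu_3,\ \mu_n\leq-\mu_2$), and $$\mu_j\geq-\mu_{n-j}\quad\text{for all } j \text{ with } 2\leq j\leq n-2,$$ (that is, $\mu_2\geq-\mu_{n-2},\ \mu_3\geq-\mu_{n-3},\ \dots,\ \mu_{n-3}\geq-\mu_3,\ \mu_{n-2}\geq-\mu_2$).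
   Context: A metric graph $\Gamma$ consists of a finite vertex set $\mathcal{V}=\{v_1,\dots,v_n\}$ and a finite nonempty edge set $\mathcal{E}=\{e_1,\dots,e_N\}$; it is connected and simple (no loops, at most one edge between two vertices), and each edge $e_i$ has a length $l_{e_i}\in(0,\infty)$ and is identified with the interval $[0,l_{e_i}]$ (the endpoints $0$ and $l_{e_i}$ corresponding to the two vertices of $e_i$). $\Gamma$ is equilateral if all edges have the same length (an arbitrary positive number). $\Gamma$ is bipartite if $\mathcal{V}$ is the disjoint union of two sets such that every edge has one endpoint in each; otherwise it is non-bipartite. The adjacency matrix $\mathcal{A}=(a_{ij})_{n\times n}$ has $a_{ij}=1$ if $v_i,v_j$ are joined by an edge and $a_{ij}=0$ otherwise. The transition matrix is $\mathcal{Z}=\mathrm{Diag}(\mathcal{A}e)^{-1}\mathcal{A}$, where $e=(1,\dots,1)^{\top}\in\mathbb{R}^n$; its eigenvalues are real. $L^2(\Gamma)=\bigoplus_i L^2[0,l_{e_i}]$, and $f_i$ denotes the restriction of $f$ to $e_i$. The maximal domain consists of all $f\in L^2(\Gamma)$ with $f_i,f_i'$ absolutely continuous on $[0,l_{e_i}]$ for every $i$ and $-f''\in L^2(\Gamma)$. Both operators below act by $f\mapsto -f''$ on each edge. The standard Laplace operator $L^{st}(\Gamma)$ has as domain the functions $f$ in the maximal domain such that at every vertex $v$ the values at $v$ of $f$ along all incident edges coincide, and the sum over incident edges of the derivatives of $f$ at $v$, taken in the direction outgoing from $v$, is $0$. The anti-standard Laplace operator $L^{a/st}(\Gamma)$ has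 as domain the functions $f$ in the maximal domain such that at every vertex $v$ the derivatives at $v$ along all incident edges, taken in the outgoing direction, coincide, and the sum over incident edges of the values of $f$ at $v$ is $0$. The spectra consist of isolated nonnegative eigenvalues of finite multiplicity; $\lambda_1(\cdot)\leq\lambda_2(\cdot)\leq\cdots$ denotes the eigenvalues in nondecreasing order counted with multiplicity, and $\mathbb{N}=\{1,2,3,\dots\}$. *)

theory Defs
  imports
    "HOL-Analysis.Analysis"
    "HOL-Library.Function_Algebras"
    "Graph_Theory.Digraph_Component"
    "Jordan_Normal_Form.Char_Poly"
begin

section \<open>Metric graphs\<close>

text \<open>
  A metric graph is a finite directed graph together with edge lengths. The direction of an arc
  only records the identification of the edge with the interval \<open>{0..len e}\<close>: the
  coordinate \<open>0\<close> corresponds to \<open>tail G e\<close> and \<open>len e\<close> to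
  \<open>head G e\<close>. Connectedness, simplicity, adjacency and bipartiteness all refer to the
  underlying undirected graph; in particular \<open>simple\<close> also excludes a pair of opposite arcs.
\<close>

locale metric_graph = fin_digraph G for G :: "('v, 'e) pre_digraph" +
  fixes len :: "'e \<Rightarrow> real"
  assumes arcs_nonempty: "arcs G \<noteq> {}"
    and connected_graph: "Digraph_Component.connected G"
    and loopfree: "e \<in> arcs G \<Longrightarrow> tail G e \<noteq> head G e"
    and simple: "\<lbrakk>e \<in> arcs G; e' \<in> arcs G;
      {tail G e, head G e} = {tail G e', head G e'}\<rbrakk> \<Longrightarrow> e = e'"
    and len_pos: "e \<in> arcs G \<Longrightarrow> 0 < len e"

definition equilateral :: "('v, 'e) pre_digraph \<Rightarrow> ('e \<Rightarrow> real) \<Rightarrow> bool" where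
  "equilateral G len \<longleftrightarrow> (\<exists>l. \<forall>e\<in>arcs G. len e = l)"

definition bipartite :: "('v, 'e) pre_digraph \<Rightarrow> bool" where
  "bipartite G \<longleftrightarrow> (\<exists>X Y. X \<union> Y = verts G \<and> X \<inter> Y = {} \<and>
     (\<forall>e\<in>arcs G. (tail G e \<in> X \<and> head G e \<in> Y) \<or> (tail G e \<in> Y \<and> head G e \<in> X)))"

definition incident :: "('v, 'e) pre_digraph \<Rightarrow> 'v \<Rightarrow> 'e set" where
  "incident G v = {e \<in> arcs G. tail G e = v \<or> head G e = v}"


section \<open>Adjacency and transition matrix\<close>

text \<open>The list \<open>vs\<close> is an enumeration of the vertices.\<close>

definition adjacency_matrix :: "('v, 'e) pre_digraph \<Rightarrow> 'v list \<Rightarrow> real mat" where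
  "adjacency_matrix G vs = Matrix.mat (length vs) (length vs)
     (\<lambda>(i, j). if \<exists>e\<in>arcs G. {tail G e, head G e} = {vs ! i, vs ! j} then 1 else 0)"

text \<open>
  The row sums are the vertex degrees, which are positive in a metric graph, so the diagonal
  matrix of the reciprocal row sums is the inverse of the diagonal matrix of the row sums.
\<close>

definition transition_matrix :: "('v, 'e) pre_digraph \<Rightarrow> 'v list \<Rightarrow> real mat" where
  "transition_matrix G vs =
     (let A = adjacency_matrix G vs; d = A *\<^sub>v Matrix.vec (length vs) (\<lambda>_. 1)
      in mat_diag (length vs) (\<lambda>i. inverse (vec_index d i)) * A)"


section \<open>Maximal domain\<close>

definition abs_continuous :: "real \<Rightarrow> real \<Rightarrow> (real \<Rightarrow> complex) \<Rightarrow> bool" where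
  "abs_continuous a b g \<longleftrightarrow>
     (\<forall>\<epsilon>>0. \<exists>\<delta>>0. \<forall>D T. D division_of T \<and> T \<subseteq> {a..b} \<and> (\<Sum>K\<in>D. Sup K - Inf K) < \<delta> \<longrightarrow>
        (\<Sum>K\<in>D. norm (g (Sup K) - g (Inf K))) < \<epsilon>)"

definition square_integrable :: "real \<Rightarrow> (real \<Rightarrow> complex) \<Rightarrow> bool" where
  "square_integrable l g \<longleftrightarrow>
     g \<in> borel_measurable (lebesgue_on {0..l}) \<and>
     integrable (lebesgue_on {0..l}) (\<lambda>x. (norm (g x))\<^sup>2)"

text \<open>The derivative on \<open>{0..l}\<close>, one-sided at the two endpoints.\<close>

definition edge_deriv :: "real \<Rightarrow> (real \<Rightarrow> complex) \<Rightarrow> real \<Rightarrow> complex" where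
  "edge_deriv l g x = vector_derivative g (at x within {0..l})"

text \<open>
  \<open>h\<close> represents the second derivative of \<open>g\<close>, which for absolutely
  continuous \<open>g'\<close> is defined up to a null set.
\<close>

definition has_second_deriv :: "real \<Rightarrow> (real \<Rightarrow> complex) \<Rightarrow> (real \<Rightarrow> complex) \<Rightarrow> bool" where
  "has_second_deriv l g h \<longleftrightarrow>
     (AE x in lebesgue_on {0..l}. (edge_deriv l g has_vector_derivative h x) (at x within {0..l}))"

text \<open>
  A function on the graph is a family of functions on the edges. Elements of the maximal domain,
  which are classes modulo null sets, are represented by their unique continuous representative
  on the intervals \<open>{0..len e}\<close>, extended by zero elsewhere; without this normalisation
  the dimensions of subspaces would be wrong. Since \<open>f e\<close> and its derivative are
  absolutely continuous, the continuous representative is differentiable everywhere.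
\<close>

definition max_domain ::
    "('v, 'e) pre_digraph \<Rightarrow> ('e \<Rightarrow> real) \<Rightarrow> ('e \<Rightarrow> real \<Rightarrow> complex) set" where
  "max_domain G len = {f.
     (\<forall>e x. e \<notin> arcs G \<or> x \<notin> {0..len e} \<longrightarrow> f e x = 0) \<and>
     (\<forall>e\<in>arcs G.
        square_integrable (len e) (f e) \<and>
        abs_continuous 0 (len e) (f e) \<and>
        (\<forall>x\<in>{0..len e}. f e differentiable (at x within {0..len e})) \<and>
        abs_continuous 0 (len e) (edge_deriv (len e) (f e)) \<and>
        (\<exists>h. has_second_deriv (len e) (f e) h \<and> square_integrable (len e) h))}"


section \<open>Standard and anti-standard Laplace operators\<close>

definition vertex_value ::
    "('v, 'e) pre_digraph \<Rightarrow> ('e \<Rightarrow> real) \<Rightarrow> ('e \<Rightarrow> real \<Rightarrow> complex) \<Rightarrow> 'v \<Rightarrow> 'e \<Rightarrow> complex" where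
  "vertex_value G len f v e = (if v = tail G e then f e 0 else f e (len e))"

text \<open>The derivative along \<open>e\<close> at \<open>v\<close>, in the direction pointing away from \<open>v\<close>.\<close>

definition outgoing_deriv ::
    "('v, 'e) pre_digraph \<Rightarrow> ('e \<Rightarrow> real) \<Rightarrow> ('e \<Rightarrow> real \<Rightarrow> complex) \<Rightarrow> 'v \<Rightarrow> 'e \<Rightarrow> complex" where
  "outgoing_deriv G len f v e =
     (if v = tail G e then edge_deriv (len e) (f e) 0
      else - edge_deriv (len e) (f e) (len e))"

definition standard_domain ::
    "('v, 'e) pre_digraph \<Rightarrow> ('e \<Rightarrow> real) \<Rightarrow> ('e \<Rightarrow> real \<Rightarrow> complex) set" where
  "standard_domain G len = {f \<in> max_domain G len. \<forall>v\<in>verts G.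
     (\<forall>e\<in>incident G v. \<forall>e'\<in>incident G v. vertex_value G len f v e = vertex_value G len f v e') \<and>
     (\<Sum>e\<in>incident G v. outgoing_deriv G len f v e) = 0}"

definition anti_standard_domain ::
    "('v, 'e) pre_digraph \<Rightarrow> ('e \<Rightarrow> real) \<Rightarrow> ('e \<Rightarrow> real \<Rightarrow> complex) set" where
  "anti_standard_domain G len = {f \<in> max_domain G len. \<forall>v\<in>verts G.
     (\<forall>e\<in>incident G v. \<forall>e'\<in>incident G v.
        outgoing_deriv G len f v e = outgoing_deriv G len f v e') \<and>
     (\<Sum>e\<in>incident G v. vertex_value G len f v e) = 0}"

text \<open>
  An operator on the graph is given by its graph, a set of pairs \<open>(f, g)\<close>, where
  \<open>g\<close> ranges over all representatives modulo null sets of the image of \<open>f\<close>.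
\<close>

type_synonym 'e graph_operator = "(('e \<Rightarrow> real \<Rightarrow> complex) \<times> ('e \<Rightarrow> real \<Rightarrow> complex)) set"

definition laplace_on ::
    "('v, 'e) pre_digraph \<Rightarrow> ('e \<Rightarrow> real) \<Rightarrow> ('e \<Rightarrow> real \<Rightarrow> complex) set \<Rightarrow> 'e graph_operator" where
  "laplace_on G len \<D> =
     {(f, g). f \<in> \<D> \<and> (\<forall>e\<in>arcs G. has_second_deriv (len e) (f e) (\<lambda>x. - g e x))}"

definition standard_laplace ::
    "('v, 'e) pre_digraph \<Rightarrow> ('e \<Rightarrow> real) \<Rightarrow> 'e graph_operator" where
  "standard_laplace G len = laplace_on G len (standard_domain G len)"

definition anti_standard_laplace ::
    "('v, 'e) pre_digraph \<Rightarrow> ('e \<Rightarrow> real) \<Rightarrow> 'e graph_operator" where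
  "anti_standard_laplace G len = laplace_on G len (anti_standard_domain G len)"


section \<open>Eigenvalues counted with multiplicity\<close>

definition scale_fun :: "complex \<Rightarrow> ('e \<Rightarrow> real \<Rightarrow> complex) \<Rightarrow> ('e \<Rightarrow> real \<Rightarrow> complex)" where
  "scale_fun c f = (\<lambda>e x. c * f e x)"

lemma vector_space_scale_fun: "vector_space scale_fun"
  by unfold_locales (simp_all add: scale_fun_def fun_eq_iff algebra_simps)

definition eigenspace :: "'e graph_operator \<Rightarrow> real \<Rightarrow> ('e \<Rightarrow> real \<Rightarrow> complex) set" where
  "eigenspace L x = {f. (f, scale_fun (complex_of_real x) f) \<in> L}"

definition eigenvalue_multiplicity :: "'e graph_operator \<Rightarrow> real \<Rightarrow> nat" where
  "eigenvalue_multiplicity L x = vector_space.dim scale_fun (eigenspace L x)"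

text \<open>
  \<open>lam 1 \<le> lam 2 \<le> \<dots>\<close> lists every eigenvalue of \<open>L\<close> as often as its multiplicity
  says; the value \<open>lam 0\<close> is irrelevant. Numbers that are not eigenvalues have
  multiplicity \<open>0\<close> and so do not occur. (An infinite-dimensional eigenspace would also get
  \<open>dim = 0\<close>, but both operators have only finite-dimensional eigenspaces.)
\<close>

definition eigenvalue_sequence :: "'e graph_operator \<Rightarrow> (nat \<Rightarrow> real) \<Rightarrow> bool" where
  "eigenvalue_sequence L lam \<longleftrightarrow>
     (\<forall>i j. 1 \<le> i \<and> i \<le> j \<longrightarrow> lam i \<le> lam j) \<and>
     (\<forall>x. finite {k. 1 \<le> k \<and> lam k = x} \<and>
          card {k. 1 \<le> k \<and> lam k = x} = eigenvalue_multiplicity L x)"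

definition kth_eigenvalue :: "'e graph_operator \<Rightarrow> nat \<Rightarrow> real" where
  "kth_eigenvalue L k = (THE x. \<exists>lam. eigenvalue_sequence L lam \<and> lam k = x)"

end

theory Submission
  imports Defs
    "Jordan_Normal_Form.Jordan_Normal_Form_Uniqueness"
    "Jordan_Normal_Form.Jordan_Normal_Form_Existence"
begin

text \<open>
  Let \<open>l\<close> be the edge length and write an eigenvalue as \<open>\<lambda> = (\<alpha> / l)\<^sup>2\<close>. If \<open>\<alpha>\<close> is not a
  multiple of \<open>pi\<close>, an eigenfunction is determined by its values (standard) or outgoing
  derivatives (anti-standard) at the vertices, and these are the eigenvectors of the transition
  matrix for \<open>cos \<alpha>\<close>, respectively \<open>- cos \<alpha>\<close>. At the multiples of \<open>pi\<close> the eigenfunctions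
  reduce to signed or unsigned circulations, and rank-nullity for the incidence matrices gives the
  multiplicities \<open>N - n + 2\<close> and \<open>N - n\<close>, exchanged between the two operators. So after removal of
  the eigenvalue \<open>0\<close> both sequences of angles have period \<open>2 pi\<close> with \<open>2 N\<close> terms per period, and
  comparing them term by term gives the two families of inequalities.
\<close>

section \<open>Dimensions of spaces of functions\<close>

text \<open>The list \<open>\<mu>\<close> is given only by the characteristic polynomial, while
  eigenvalues of the operators are counted by dimensions of eigenspaces. Self-adjointness of the
  transition matrix for the degree weights bridges the two, since it excludes nontrivial Jordan
  blocks. Non-bipartiteness enters twice: -1 is not an eigenvalue, so every \<open>\<mu> j\<close>
  with j \<ge> 2 gives an angle strictly between 0 and pi; and the unsigned incidence matrix has
  full rank n. The index shifts 1 and N - n in the inequality are the multiplicities of the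
  eigenvalue 0, so both sides refer to the k-th positive eigenvalue. The anti-standard block of
  angles equal to pi is longer by two than the standard one. This offset of two is why the first
  family pairs indices of sum n + 2 and the second pairs indices of sum n. The analytic obstacle is
  that the domain provides the second derivative only almost everywhere. The differential equation
  holds everywhere because an absolutely continuous function whose derivative vanishes almost
  everywhere is constant.\<close>

context vector_space_pair
begin

lemma dim_image_inj_on:
  assumes T: "Vector_Spaces.linear s1 s2 T" and U: "vs1.subspace U" and inj: "inj_on T U"
  shows "vs2.dim (T ` U) = vs1.dim U"
proof -
  interpret T: Vector_Spaces.linear s1 s2 T by fact
  obtain B where B: "B \<subseteq> U" "vs1.independent B" "U \<subseteq> vs1.span B" "card B = vs1.dim U"
    using vs1.basis_exists by blast
  have span: "vs1.span B = U"
    using B U by (metis vs1.span_subspace)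
  have "vs2.independent (T ` B)"
    using T.independent_injective_image[OF B(2)] inj span by simp
  moreover have "T ` U = vs2.span (T ` B)"
    by (simp add: T.span_image span)
  moreover have "card (T ` B) = card B"
    using inj B(1) by (meson card_image inj_on_subset)
  ultimately show ?thesis
    using B(4) vs2.dim_span_eq_card_independent by simp
qed

text \<open>A basis \<open>B0\<close> of the kernel is extended to a basis \<open>B\<close> of
  \<open>U\<close>; \<open>T\<close> kills \<open>B0\<close> and is injective on the span of the
  added vectors \<open>C\<close>. The ambient spaces are full function spaces, possibly of infinite
  dimension, so finiteness is demanded only of a spanning set around \<open>U\<close>.\<close>

lemma dim_kernel_plus_dim_image:
  assumes T: "Vector_Spaces.linear s1 s2 T" and U: "vs1.subspace U" and fin: "finite S" "U \<subseteq> vs1.span S"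
  shows "vs1.dim U = vs1.dim {x \<in> U. T x = 0} + vs2.dim (T ` U)"
proof -
  interpret T: Vector_Spaces.linear s1 s2 T by fact
  define K where "K = {x \<in> U. T x = 0}"
  have K: "vs1.subspace K"
    using U by (auto simp: K_def vs1.subspace_def T.add T.scale)
  obtain B0 where B0: "B0 \<subseteq> K" "vs1.independent B0" "K \<subseteq> vs1.span B0" "card B0 = vs1.dim K"
    using vs1.basis_exists by blast
  have "B0 \<subseteq> U"
    using B0(1) by (auto simp: K_def)
  then obtain B where B: "B0 \<subseteq> B" "B \<subseteq> U" "vs1.independent B" "U \<subseteq> vs1.span B"
    using vs1.maximal_independent_subset_extend[OF _ B0(2)] by metis
  have finB: "finite B"
    using vs1.independent_span_bound[OF fin(1) B(3)] B(2) fin(2) by auto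
  define C where "C = B - B0"
  have indC: "vs1.independent C"
    using B(3) vs1.independent_mono C_def by blast
  have spanB: "vs1.span B = U"
    using B U by (metis vs1.span_subspace)
  \<comment> \<open>Such an \<open>x\<close> lies in the spans of both \<open>B0\<close> and
    \<open>C\<close>. Its coordinates with respect to \<open>B\<close> then vanish outside
    \<open>B0\<close> and outside \<open>C\<close>, hence everywhere.\<close>
  have zero: "x = 0" if x: "x \<in> vs1.span C" "T x = 0" for x
  proof -
    have "x \<in> U"
      using x(1) spanB vs1.span_mono[of C B] by (auto simp: C_def)
    then have xB0: "x \<in> vs1.span B0"
      using x(2) B0(3) by (auto simp: K_def)
    have "vs1.representation B x = vs1.representation B0 x"
      by (rule vs1.representation_extend[OF B(3) xB0 B(1)])
    moreover have "vs1.representation B x = vs1.representation C x"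
      by (rule vs1.representation_extend[OF B(3) x(1)]) (auto simp: C_def)
    ultimately have "vs1.representation B0 x b = 0" for b
      using vs1.representation_ne_zero[of B0 x b] vs1.representation_ne_zero[of C x b]
      by (auto simp: C_def)
    then show "x = 0"
      using vs1.sum_nonzero_representation_eq[OF B0(2) xB0] by simp
  qed
  have inj: "inj_on T (vs1.span C)"
    unfolding T.inj_on_iff_eq_0[OF vs1.subspace_span] using zero by blast
  have "T ` U = vs2.span (T ` B)"
    by (simp add: T.span_image spanB)
  also have "\<dots> = vs2.span (T ` C)"
  proof (rule vs2.span_eq[THEN iffD2], intro conjI)
    show "T ` B \<subseteq> vs2.span (T ` C)"
    proof
      fix y assume "y \<in> T ` B"
      then obtain b where b: "b \<in> B" "y = T b" by auto
      show "y \<in> vs2.span (T ` C)"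
      proof (cases "b \<in> B0")
        case True
        then have "y = 0" using b B0(1) by (auto simp: K_def)
        then show ?thesis by (simp add: vs2.span_zero)
      next
        case False
        then show ?thesis using b by (auto simp: C_def intro: vs2.span_base)
      qed
    qed
    show "T ` C \<subseteq> vs2.span (T ` B)"
      by (auto simp: C_def intro: vs2.span_base)
  qed
  finally have "vs2.dim (T ` U) = vs2.dim (T ` C)" by simp
  also have "\<dots> = card (T ` C)"
    by (rule vs2.dim_eq_card_independent[OF T.independent_injective_image[OF indC inj]])
  also have "\<dots> = card C"
    by (rule card_image) (rule inj_on_subset[OF inj vs1.span_superset])
  finally have "vs2.dim (T ` U) = card C" .
  moreover have "vs1.dim U = card B"
    using vs1.basis_card_eq_dim[OF B(2) B(4) B(3)] by simp
  moreover have "card B = card B0 + card C"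
    using finB B(1) by (simp add: C_def card_Diff_subset finite_subset card_mono)
  ultimately show ?thesis using B0(4) by (simp add: K_def)
qed

end

section \<open>Functions supported on a finite set, as complex vector spaces\<close>

definition fscale :: "complex \<Rightarrow> ('a \<Rightarrow> complex) \<Rightarrow> 'a \<Rightarrow> complex" where
  "fscale c f = (\<lambda>x. c * f x)"

lemma fscale_apply: "fscale c f x = c * f x"
  by (simp add: fscale_def)

interpretation fs: vector_space fscale
  by unfold_locales (simp_all add: fscale_apply fun_eq_iff algebra_simps)

interpretation gs: vector_space scale_fun
  by (rule vector_space_scale_fun)

interpretation fs_fs: vector_space_pair fscale fscale ..
interpretation fs_gs: vector_space_pair fscale scale_fun ..

lemma linear_fs_fsI:
  assumes "\<And>f g. T (f + g) = T f + T g" "\<And>c f. T (fscale c f) = fscale c (T f)"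
  shows "Vector_Spaces.linear fscale fscale T"
  using assms by unfold_locales auto

lemma linear_fs_gsI:
  assumes "\<And>f g. T (f + g) = T f + T g" "\<And>c f. T (fscale c f) = scale_fun c (T f)"
  shows "Vector_Spaces.linear fscale scale_fun T"
  using assms by unfold_locales auto

text \<open>Extension by zero realizes the vectors indexed by \<open>S\<close> as a subspace of one
  fixed function space, so that vertex and edge data need no types of their own.\<close>

definition funs_on :: "'a set \<Rightarrow> ('a \<Rightarrow> complex) set" where
  "funs_on S = {f. \<forall>x. x \<notin> S \<longrightarrow> f x = 0}"

definition delta :: "'a \<Rightarrow> 'a \<Rightarrow> complex" where
  "delta a = (\<lambda>x. if x = a then 1 else 0)"

lemma delta_inject: "delta a = delta b \<longleftrightarrow> a = b"
  by (auto simp: delta_def fun_eq_iff split: if_splits)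

lemma sum_fun_apply: "(\<Sum>i\<in>I. f i) x = (\<Sum>i\<in>I. f i x)"
  by (induction I rule: infinite_finite_induct) auto

lemma subspace_funs_on: "fs.subspace (funs_on S)"
  by (auto simp: fs.subspace_def funs_on_def fscale_apply)

lemma funs_on_expand:
  assumes "finite S" "f \<in> funs_on S"
  shows "f = (\<Sum>a\<in>S. fscale (f a) (delta a))"
proof
  fix x
  have "(\<Sum>a\<in>S. fscale (f a) (delta a)) x = (\<Sum>a\<in>S. if x = a then f a else 0)"
    by (auto simp: sum_fun_apply fscale_apply delta_def intro!: sum.cong)
  also have "\<dots> = f x"
    using assms by (auto simp: funs_on_def)
  finally show "f x = (\<Sum>a\<in>S. fscale (f a) (delta a)) x" by simp
qed

lemma funs_on_subset_span: "finite S \<Longrightarrow> funs_on S \<subseteq> fs.span (delta ` S)"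
  by (metis (no_types, lifting) funs_on_expand fs.span_base fs.span_scale fs.span_sum imageI subsetI)

lemma dim_funs_on:
  assumes "finite S"
  shows "fs.dim (funs_on S) = card S"
proof (rule fs.dim_unique)
  show "delta ` S \<subseteq> funs_on S"
    by (auto simp: delta_def funs_on_def)
  show "funs_on S \<subseteq> fs.span (delta ` S)"
    by (rule funs_on_subset_span[OF assms])
  have inj: "inj_on delta S"
    by (simp add: inj_on_def delta_inject)
  show "card (delta ` S) = card S"
    by (rule card_image[OF inj])
  show "fs.independent (delta ` S)"
  proof (rule fs.independent_if_scalars_zero)
    show "finite (delta ` S)" using assms by simp
    fix c x assume sum: "(\<Sum>d\<in>delta ` S. fscale (c d) d) = 0" and "x \<in> delta ` S"
    then obtain a where a: "a \<in> S" "x = delta a" by auto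
    have "0 = (\<Sum>b\<in>S. fscale (c (delta b)) (delta b)) a"
      using sum by (simp add: sum.reindex[OF inj])
    also have "\<dots> = (\<Sum>b\<in>S. if a = b then c (delta b) else 0)"
      by (auto simp: sum_fun_apply fscale_apply delta_def intro!: sum.cong)
    also have "\<dots> = c x"
      using a assms by simp
    finally show "c x = 0" by simp
  qed
qed

lemma dim_funs_on_sum_zero:
  assumes "finite S" "S \<noteq> {}"
  shows "fs.dim {f \<in> funs_on S. sum f S = 0} = card S - 1"
proof -
  obtain a where a: "a \<in> S" using assms by auto
  \<comment> \<open>The values away from \<open>a\<close> are free, and the value at
    \<open>a\<close> is forced by the vanishing sum.\<close>
  define T where "T h = (\<lambda>x. if x = a then - sum h (S - {a}) else h x)" for h :: "'a \<Rightarrow> complex"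
  have "Vector_Spaces.linear fscale fscale T"
    by (rule linear_fs_fsI) (auto simp: T_def fun_eq_iff fscale_apply sum.distrib sum_distrib_left)
  moreover have "inj_on T (funs_on (S - {a}))"
    by (auto simp: inj_on_def T_def funs_on_def fun_eq_iff split: if_splits)
  ultimately have "fs.dim (T ` funs_on (S - {a})) = fs.dim (funs_on (S - {a}))"
    by (rule fs_fs.dim_image_inj_on[OF _ subspace_funs_on])
  also have "T ` funs_on (S - {a}) = {f \<in> funs_on S. sum f S = 0}"
  proof (intro equalityI subsetI)
    fix f assume "f \<in> T ` funs_on (S - {a})"
    then obtain h where h: "h \<in> funs_on (S - {a})" "f = T h" by auto
    have "sum f S = f a + sum f (S - {a})"
      using a assms by (simp add: sum.remove)
    also have "sum f (S - {a}) = sum h (S - {a})"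
      by (rule sum.cong) (auto simp: h T_def)
    finally have "sum f S = 0" by (simp add: h T_def)
    then show "f \<in> {f \<in> funs_on S. sum f S = 0}"
      using h a by (auto simp: funs_on_def T_def)
  next
    fix f assume f: "f \<in> {f \<in> funs_on S. sum f S = 0}"
    define h where "h = f(a := 0)"
    have "sum f S = f a + sum f (S - {a})"
      using a assms by (simp add: sum.remove)
    moreover have "sum f (S - {a}) = sum h (S - {a})"
      by (rule sum.cong) (auto simp: h_def)
    ultimately have "f a = - sum h (S - {a})"
      using f by (simp add: eq_neg_iff_add_eq_0)
    then have "f = T h"
      unfolding T_def by (auto simp: fun_eq_iff h_def)
    moreover have "h \<in> funs_on (S - {a})"
      using f by (auto simp: h_def funs_on_def)
    ultimately show "f \<in> T ` funs_on (S - {a})" by blast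
  qed
  finally show ?thesis
    using a assms by (simp add: dim_funs_on)
qed

section \<open>Incidence matrices\<close>

definition outs :: "('v, 'e) pre_digraph \<Rightarrow> 'v \<Rightarrow> 'e set" where
  "outs G v = {e \<in> arcs G. tail G e = v}"

definition ins :: "('v, 'e) pre_digraph \<Rightarrow> 'v \<Rightarrow> 'e set" where
  "ins G v = {e \<in> arcs G. head G e = v}"

text \<open>This is an incidence matrix applied to an edge function: the oriented one for \<sigma> =
  -1, with the circulations as kernel, and the unoriented one for \<sigma> = 1.\<close>

definition divergence ::
    "('v, 'e) pre_digraph \<Rightarrow> complex \<Rightarrow> ('e \<Rightarrow> complex) \<Rightarrow> 'v \<Rightarrow> complex" where
  "divergence G \<sigma> q = (\<lambda>v. if v \<in> verts G then sum q (outs G v) + \<sigma> * sum q (ins G v) else 0)"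

lemma linear_divergence: "Vector_Spaces.linear fscale fscale (divergence G \<sigma>)"
  by (rule linear_fs_fsI)
    (auto simp: divergence_def fscale_apply fun_eq_iff sum.distrib algebra_simps sum_distrib_left)

context metric_graph
begin

lemma finite_outs [simp]: "finite (outs G v)"
  by (simp add: outs_def)

lemma finite_ins [simp]: "finite (ins G v)"
  by (simp add: ins_def)

lemma incident_eq: "incident G v = outs G v \<union> ins G v"
  by (auto simp: incident_def outs_def ins_def)

lemma outs_ins_disjoint: "outs G v \<inter> ins G v = {}"
  using loopfree by (fastforce simp: outs_def ins_def)

lemma sum_incident:
  "(\<Sum>e\<in>incident G v. f e) = (\<Sum>e\<in>outs G v. f e) + (\<Sum>e\<in>ins G v. f e)"
  unfolding incident_eq by (rule sum.union_disjoint) (auto simp: outs_ins_disjoint)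

text \<open>Connectedness in the form of an induction rule. Paths live in the symmetric closure, so
  the step has to be an equivalence along each arc.\<close>

lemma connected_propagate [consumes 2, case_names edge]:
  assumes "u \<in> verts G" "P u" and step: "\<And>e. e \<in> arcs G \<Longrightarrow> P (tail G e) \<longleftrightarrow> P (head G e)"
    and "v \<in> verts G"
  shows "P v"
proof -
  have "u \<rightarrow>\<^sup>*\<^bsub>with_proj (mk_symmetric G)\<^esub> v"
    using connected_graph assms(1,4) unfolding connected_def strongly_connected_def by simp
  then have "(u, v) \<in> (parcs (mk_symmetric G))\<^sup>*"
    unfolding reachable_def by (auto dest: rtrancl_on_rtranclI)
  then show ?thesis
  proof (induction rule: rtrancl_induct)
    case base
    show ?case by fact
  next
    case (step x y)
    then show ?case using assms(3) by (auto simp: parcs_mk_symmetric)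
  qed
qed

text \<open>Both ends of an arc have the property trivially, so it propagates from the tail of any
  arc to every vertex.\<close>

lemma incident_nonempty:
  assumes "v \<in> verts G"
  shows "\<exists>e\<in>arcs G. tail G e = v \<or> head G e = v"
proof -
  obtain e0 where "e0 \<in> arcs G" using arcs_nonempty by auto
  then show ?thesis
    by (intro connected_propagate[of "tail G e0" "\<lambda>v. \<exists>e\<in>arcs G. tail G e = v \<or> head G e = v" v])
      (use assms in auto)
qed

lemma sum_outs: "(\<Sum>v\<in>verts G. \<Sum>e\<in>outs G v. f e) = (\<Sum>e\<in>arcs G. f e)"
  unfolding outs_def by (rule sum.group) auto

lemma sum_ins: "(\<Sum>v\<in>verts G. \<Sum>e\<in>ins G v. f e) = (\<Sum>e\<in>arcs G. f e)"
  unfolding ins_def by (rule sum.group) auto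

lemma divergence_delta:
  assumes "e \<in> arcs G"
  shows "divergence G \<sigma> (delta e) = delta (tail G e) + fscale \<sigma> (delta (head G e))"
proof
  fix v
  have "sum (delta e) (outs G v) = (if tail G e = v then 1 else 0)"
    and "sum (delta e) (ins G v) = (if head G e = v then 1 else 0)"
    using assms by (auto simp: delta_def outs_def ins_def)
  then show "divergence G \<sigma> (delta e) v = (delta (tail G e) + fscale \<sigma> (delta (head G e))) v"
    using assms by (auto simp: divergence_def delta_def fscale_apply)
qed

lemma divergence_mem_funs_on: "divergence G \<sigma> q \<in> funs_on (verts G)"
  by (simp add: divergence_def funs_on_def)

lemma dim_divergence_kernel:
  "card (arcs G) = fs.dim {q \<in> funs_on (arcs G). divergence G \<sigma> q = 0}
     + fs.dim (divergence G \<sigma> ` funs_on (arcs G))"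
  using fs_fs.dim_kernel_plus_dim_image[OF linear_divergence subspace_funs_on _
      funs_on_subset_span[OF finite_arcs], of G \<sigma>]
  by (simp add: dim_funs_on[OF finite_arcs])

lemma subspace_divergence_image: "fs.subspace (divergence G \<sigma> ` funs_on (arcs G))"
proof -
  interpret Vector_Spaces.linear fscale fscale "divergence G \<sigma>" by (rule linear_divergence)
  show ?thesis by (rule subspace_image[OF subspace_funs_on])
qed

lemma edge_in_divergence_image:
  assumes "e \<in> arcs G"
  shows "delta (tail G e) + fscale \<sigma> (delta (head G e)) \<in> divergence G \<sigma> ` funs_on (arcs G)"
  using assms
  by (intro image_eqI[where x = "delta e"]) (auto simp: divergence_delta, auto simp: funs_on_def delta_def)

text \<open>Every arc leaves one vertex and enters one, so a divergence sums to zero. Conversely the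
  image contains the differences of indicators along arcs, hence by connectedness all
  \<open>delta v - delta v0\<close>, and these span the functions of sum zero.\<close>

lemma divergence_image_signed:
  "divergence G (-1) ` funs_on (arcs G) = {f \<in> funs_on (verts G). sum f (verts G) = 0}"
    (is "?W = _")
proof (intro equalityI subsetI)
  fix f assume "f \<in> ?W"
  then obtain q where "f = divergence G (-1) q" by auto
  moreover have "sum (divergence G (-1) q) (verts G) = 0"
    using sum_outs[of q] sum_ins[of q] by (simp add: divergence_def sum_subtractf)
  ultimately show "f \<in> {f \<in> funs_on (verts G). sum f (verts G) = 0}"
    using divergence_mem_funs_on by auto
next
  fix f assume f: "f \<in> {f \<in> funs_on (verts G). sum f (verts G) = 0}"
  note W = subspace_divergence_image[of "-1"]
  obtain v0 where v0: "v0 \<in> verts G"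
    using arcs_nonempty tail_in_verts by blast
  have step: "delta (tail G e) - delta v0 \<in> ?W \<longleftrightarrow> delta (head G e) - delta v0 \<in> ?W"
    if e: "e \<in> arcs G" for e
  proof -
    have "delta (tail G e) + fscale (-1) (delta (head G e)) \<in> ?W"
      by (rule edge_in_divergence_image[OF e])
    then have d: "delta (tail G e) - delta (head G e) \<in> ?W"
      by (simp add: fscale_def fun_eq_iff fun_diff_def plus_fun_def)
    show ?thesis
      using fs.subspace_add[OF W d, of "delta (head G e) - delta v0"]
        fs.subspace_diff[OF W _ d, of "delta (tail G e) - delta v0"]
      by auto
  qed
  have mem: "delta v - delta v0 \<in> ?W" if "v \<in> verts G" for v
    using v0 _ step that
  proof (rule connected_propagate)
    show "delta v0 - delta v0 \<in> ?W" using fs.subspace_0[OF W] by simp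
  qed
  have "f = (\<Sum>v\<in>verts G. fscale (f v) (delta v))"
    using f by (intro funs_on_expand) auto
  \<comment> \<open>Subtracting \<open>delta v0\<close> from each indicator changes the combination
    by a multiple of the sum of \<open>f\<close>, which is zero.\<close>
  also have "\<dots> = (\<Sum>v\<in>verts G. fscale (f v) (delta v - delta v0))"
  proof -
    have "(\<Sum>v\<in>verts G. fscale (f v) (delta v0)) = fscale (sum f (verts G)) (delta v0)"
      by (simp add: fs.scale_sum_left)
    then show ?thesis
      using f by (simp add: fs.scale_right_diff_distrib sum_subtractf)
  qed
  also have "\<dots> \<in> ?W"
    by (intro fs.subspace_sum[OF W] fs.subspace_scale[OF W] mem)
  finally show "f \<in> ?W" .
qed

text \<open>
  Modulo the image, every indicator \<open>delta v\<close> equals \<open>delta v0\<close> or its negative; if the two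
  cases never overlapped, they would give a bipartition.
\<close>

lemma divergence_image_unsigned:
  assumes "\<not> bipartite G"
  shows "divergence G 1 ` funs_on (arcs G) = funs_on (verts G)" (is "?W = _")
proof (intro equalityI subsetI)
  fix f assume "f \<in> ?W"
  then show "f \<in> funs_on (verts G)" using divergence_mem_funs_on by auto
next
  fix f assume f: "f \<in> funs_on (verts G)"
  note W = subspace_divergence_image[of 1]
  obtain v0 where v0: "v0 \<in> verts G"
    using arcs_nonempty tail_in_verts by blast
  define X where "X = {v \<in> verts G. delta v - delta v0 \<in> ?W}"
  define Y where "Y = {v \<in> verts G. delta v + delta v0 \<in> ?W}"
  have d: "delta (tail G e) + delta (head G e) \<in> ?W" if "e \<in> arcs G" for e
    using edge_in_divergence_image[OF that, of 1] by simp
  have XY: "(tail G e \<in> X \<longleftrightarrow> head G e \<in> Y) \<and> (tail G e \<in> Y \<longleftrightarrow> head G e \<in> X)"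
    if e: "e \<in> arcs G" for e
  proof -
    let ?t = "delta (tail G e)" and ?h = "delta (head G e)"
    have swap: "?t + b \<in> ?W \<longleftrightarrow> ?h - b \<in> ?W" for b
      using fs.subspace_diff[OF W d[OF e], of "?t + b"] fs.subspace_diff[OF W d[OF e], of "?h - b"]
      by (auto simp: algebra_simps)
    show ?thesis
      using e swap[of "delta v0"] swap[of "- delta v0"] by (auto simp: X_def Y_def)
  qed
  have "v \<in> X \<union> Y" if "v \<in> verts G" for v
    using v0 _ _ that
  proof (rule connected_propagate)
    show "v0 \<in> X \<union> Y" using v0 fs.subspace_0[OF W] by (simp add: X_def)
  qed (use XY in auto)
  then have "X \<union> Y = verts G" by (auto simp: X_def Y_def)
  then have "X \<inter> Y \<noteq> {}"
    using assms XY unfolding bipartite_def by (metis UnE head_in_verts tail_in_verts)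
  then obtain w where w: "delta w - delta v0 \<in> ?W" "delta w + delta v0 \<in> ?W"
    by (auto simp: X_def Y_def)
  \<comment> \<open>A vertex lying in both classes puts \<open>delta v0\<close> itself into the
    image, as half of a difference; all other indicators follow along the arcs.\<close>
  have "fscale (1/2) ((delta w + delta v0) - (delta w - delta v0)) \<in> ?W"
    by (intro fs.subspace_scale[OF W] fs.subspace_diff[OF W] w)
  then have "delta v0 \<in> ?W"
    by (simp add: fscale_def fun_eq_iff fun_diff_def plus_fun_def)
  then have "delta v \<in> ?W" if "v \<in> verts G" for v
    using v0 that d fs.subspace_diff[OF W]
    by (elim connected_propagate[where P = "\<lambda>v. delta v \<in> ?W", rotated 1]) (metis add_diff_cancel_left' add_diff_cancel_right')+
  moreover have "f = (\<Sum>v\<in>verts G. fscale (f v) (delta v))"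
    using f by (intro funs_on_expand) auto
  ultimately show "f \<in> ?W"
    by (metis (no_types, lifting) fs.subspace_scale[OF W] fs.subspace_sum[OF W])
qed

lemma card_verts_pos: "card (verts G) \<ge> 1"
  using arcs_nonempty by (metis One_nat_def Suc_leI card_gt_0_iff empty_iff equals0I finite_verts
      tail_in_verts)

lemma dim_unsigned_circulations:
  assumes "\<not> bipartite G"
  shows "fs.dim {q \<in> funs_on (arcs G). divergence G 1 q = 0} + card (verts G) = card (arcs G)"
  using dim_divergence_kernel[of 1]
  by (simp add: divergence_image_unsigned[OF assms] dim_funs_on)

end

section \<open>Diagonalization of the transition matrix\<close>

text \<open>Two factorizations of one characteristic polynomial are compared through the order of
  each root, which turns an equality of products into an equality of counts.\<close>

lemma order_prod_linear_factors:
  fixes f :: "'a \<Rightarrow> 'b :: idom"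
  assumes "finite S"
  shows "Polynomial.order c (\<Prod>j\<in>S. [:- f j, 1:]) = card {j \<in> S. f j = c}"
  using assms
proof (induction S)
  case (insert i S)
  have "Polynomial.order c [:- f i, 1:] = (if f i = c then 1 else 0)"
  proof (cases "f i = c")
    case True
    then show ?thesis using order_power_n_n[of c 1] by simp
  next
    case False
    then show ?thesis by (auto intro!: order_0I)
  qed
  moreover have "{j \<in> insert i S. f j = c} = (if f i = c then insert i {j \<in> S. f j = c} else {j \<in> S. f j = c})"
    by auto
  moreover have "[:- f i, 1:] * (\<Prod>j\<in>S. [:- f j, 1:]) \<noteq> 0"
    unfolding mult_eq_0_iff using insert.hyps by simp
  then have "Polynomial.order c (\<Prod>j\<in>insert i S. [:- f j, 1:])
      = Polynomial.order c [:- f i, 1:] + Polynomial.order c (\<Prod>j\<in>S. [:- f j, 1:])"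
    unfolding prod.insert[OF insert.hyps] by (rule order_mult)
  ultimately show ?case
    using insert.hyps insert.IH by simp
qed simp

text \<open>In the weighted scalar product, \<open>M\<close> is self-adjoint and \<open>\<langle>M v, M v\<rangle> = \<langle>M (M v), v\<rangle>\<close>.\<close>

lemma mat_kernel_square_of_weighted_symmetric:
  fixes M :: "real mat"
  assumes M: "M \<in> carrier_mat n n"
    and w: "\<And>i. i < n \<Longrightarrow> 0 < w i"
    and sym: "\<And>i j. i < n \<Longrightarrow> j < n \<Longrightarrow> w i * M $$ (i, j) = w j * M $$ (j, i)"
  shows "mat_kernel (M * M) = mat_kernel M"
proof (intro equalityI subsetI)
  fix v assume "v \<in> mat_kernel M"
  then show "v \<in> mat_kernel (M * M)"
    using mat_kernel_mult_subset[OF M M] by auto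
next
  fix v assume v: "v \<in> mat_kernel (M * M)"
  have MM: "M * M \<in> carrier_mat n n" using M by simp
  note vc = mat_kernelD[OF MM v]
  define u where "u = M *\<^sub>v v"
  have u: "u \<in> carrier_vec n" using mult_mat_vec_carrier[OF M vc(1)] by (simp add: u_def)
  have "M *\<^sub>v u = 0\<^sub>v n"
    using vc M by (simp add: u_def)
  then have Mu: "(\<Sum>j<n. M $$ (i, j) * u $ j) = 0" if "i < n" for i
    using that M u by (auto simp: scalar_prod_def lessThan_atLeast0 dest!: arg_cong[where f = "\<lambda>x. x $ i"])
  have ui: "u $ i = (\<Sum>j<n. M $$ (i, j) * v $ j)" if "i < n" for i
    using that M vc(1) by (auto simp: u_def scalar_prod_def lessThan_atLeast0)
  have "(\<Sum>i<n. w i * u $ i * u $ i) = (\<Sum>i<n. \<Sum>j<n. w i * M $$ (i, j) * v $ j * u $ i)"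
    by (rule sum.cong) (auto simp: ui sum_distrib_left sum_distrib_right mult_ac)
  also have "\<dots> = (\<Sum>i<n. \<Sum>j<n. w j * M $$ (j, i) * v $ j * u $ i)"
    by (intro sum.cong) (auto simp: sym)
  also have "\<dots> = (\<Sum>j<n. \<Sum>i<n. w j * M $$ (j, i) * v $ j * u $ i)"
    by (rule sum.swap)
  also have "\<dots> = (\<Sum>j<n. w j * v $ j * (\<Sum>i<n. M $$ (j, i) * u $ i))"
    by (intro sum.cong) (auto simp: sum_distrib_left mult_ac)
  also have "\<dots> = 0"
    using Mu by simp
  finally have "(\<Sum>i<n. w i * u $ i * u $ i) = 0" .
  moreover have nn: "0 \<le> w i * u $ i * u $ i" if "i < n" for i
    using w[OF that] by (simp add: mult.assoc)
  ultimately have "w i * u $ i * u $ i = 0" if "i < n" for i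
    using that by (subst (asm) sum_nonneg_eq_0_iff) auto
  then have "u $ i = 0" if "i < n" for i
    using w[OF that] that by force
  then have "u = 0\<^sub>v n"
    using u by auto
  then show "v \<in> mat_kernel M"
    using vc(1) M by (intro mat_kernelI[OF M]) (auto simp: u_def)
qed

lemma jordan_matrix_of_trivial_blocks:
  "(\<And>b. b \<in> set n_as \<Longrightarrow> fst b = 1) \<Longrightarrow>
     jordan_matrix n_as = mat_diag (length n_as) (\<lambda>i. snd (n_as ! i))"
proof (induction n_as)
  case Nil
  then show ?case by (auto simp: jordan_matrix_def mat_diag_def)
next
  case (Cons b n_as)
  obtain a where b: "b = (1, a)" using Cons.prems[of b] by (cases b) auto
  have len: "sum_list (map fst n_as) = length n_as"
    using Cons.prems by (induction n_as) auto
  have IH: "jordan_matrix n_as = mat_diag (length n_as) (\<lambda>i. snd (n_as ! i))"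
    using Cons by auto
  show ?case
    unfolding b jordan_matrix_Cons len IH
    by (rule eq_matI) (auto simp: mat_diag_def less_Suc_eq_0_disj nth_Cons' split: if_splits)
qed

lemma kernel_dim_cong:
  assumes "A \<in> carrier_mat n n" "B \<in> carrier_mat n n" "mat_kernel A = mat_kernel B"
  shows "kernel_dim A = kernel_dim B"
proof -
  have "dim_col A = dim_col B" using assms by auto
  then show ?thesis using assms(3) by (simp add: kernel_dim_def)
qed

text \<open>The characteristic polynomial splits over the reals, so a real Jordan form exists.
  \<open>char_matrix M e\<close> differs from \<open>M\<close> by a multiple of the identity and
  inherits the weighted symmetry, so its square has the same kernel. Generalized eigenvectors of
  order 2 are therefore eigenvectors, and all blocks have size 1.\<close>

lemma weighted_symmetric_diagonalizable:
  fixes M :: "real mat"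
  assumes M: "M \<in> carrier_mat n n"
    and w: "\<And>i. i < n \<Longrightarrow> 0 < w i"
    and sym: "\<And>i j. i < n \<Longrightarrow> j < n \<Longrightarrow> w i * M $$ (i, j) = w j * M $$ (j, i)"
    and cp: "char_poly M = (\<Prod>j=1..n. [:- \<mu> j, 1:])"
  obtains d P Q where "similar_mat_wit M (mat_diag n d) P Q"
    "\<And>c. card {i. i < n \<and> d i = c} = card {j \<in> {1..n}. \<mu> j = c}"
proof -
  have "char_poly M = (\<Prod>a\<leftarrow>map \<mu> [1..<Suc n]. [:- a, 1:])"
  proof -
    have "(\<Prod>a\<leftarrow>map \<mu> [1..<Suc n]. [:- a, 1:]) = (\<Prod>j\<in>set [1..<Suc n]. [:- \<mu> j, 1:])"
      by (subst prod.distinct_set_conv_list) (simp_all only: distinct_upt map_map o_def)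
    then show ?thesis
      unfolding cp by (simp only: set_upt atLeastLessThanSuc_atLeastAtMost)
  qed
  then obtain n_as where jnf: "jordan_nf M n_as"
    using jordan_nf_exists[OF M] by blast
  have one: "fst b = 1" if b: "b \<in> set n_as" for b
  proof -
    define e where "e = snd b"
    define L where "L = map fst [(m, e') \<leftarrow> n_as. e' = e]"
    have bL: "fst b \<in> set L"
      using b by (auto simp: L_def e_def image_iff)
    define X where "X = char_matrix M e"
    have X: "X \<in> carrier_mat n n" using M by (simp add: X_def)
    have Xsym: "w i * X $$ (i, j) = w j * X $$ (j, i)" if "i < n" "j < n" for i j
      using sym[OF that] that M by (auto simp: X_def char_matrix_def algebra_simps)
    have "mat_kernel (X ^\<^sub>m 2) = mat_kernel (X ^\<^sub>m 1)"
      using mat_kernel_square_of_weighted_symmetric[OF X w Xsym] X by (simp add: numeral_2_eq_2)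
    then have "dim_gen_eigenspace M e 2 = dim_gen_eigenspace M e 1"
      unfolding dim_gen_eigenspace_def X_def[symmetric]
      using X by (intro kernel_dim_cong[of _ n]) auto
    \<comment> \<open>For order k the generalized eigenspace has dimension the sum of
      \<open>min k m\<close> over the sizes \<open>m\<close> of the blocks for \<open>e\<close>.
      Equality for k = 1 and k = 2 rules out every size above 1.\<close>
    then have "(\<Sum>m\<leftarrow>L. min 2 m) = (\<Sum>m\<leftarrow>L. min 1 m)"
      unfolding dim_gen_eigenspace[OF jnf] L_def .
    moreover have "(\<Sum>m\<leftarrow>xs. min 1 m) < (\<Sum>m\<leftarrow>xs. min 2 m)" if "m \<in> set xs" "1 < m" for m :: nat and xs
      using that
    proof (induction xs)
      case (Cons x xs)
      have "(\<Sum>m\<leftarrow>xs. min 1 m) \<le> (\<Sum>m\<leftarrow>xs. min 2 m)" by (rule sum_list_mono) simp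
      then show ?case using Cons by (cases "x = m") auto
    qed simp
    ultimately have "\<not> 1 < fst b" using bL by force
    moreover have "fst b \<noteq> 0"
      using jnf b by (auto simp: jordan_nf_def image_iff)
    ultimately show ?thesis by simp
  qed
  have sim: "similar_mat M (jordan_matrix n_as)"
    using jnf by (simp add: jordan_nf_def)
  then obtain P Q where PQ: "similar_mat_wit M (jordan_matrix n_as) P Q"
    by (auto simp: similar_mat_def)
  define d where "d i = snd (n_as ! i)" for i
  have J: "jordan_matrix n_as = mat_diag (length n_as) d"
    using jordan_matrix_of_trivial_blocks[OF one] by (simp add: d_def[abs_def])
  have len: "length n_as = n"
    using similar_mat_witD2(5)[OF M PQ] unfolding J by (auto simp: mat_diag_def)
  have "char_poly M = char_poly (mat_diag n d)"
    using char_poly_similar[OF sim] by (simp add: J len)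
  also have "\<dots> = (\<Prod>a\<leftarrow>diag_mat (mat_diag n d). [:- a, 1:])"
    by (rule char_poly_upper_triangular[of _ n]) (auto simp: mat_diag_def)
  also have "diag_mat (mat_diag n d) = map d [0..<n]"
    by (auto simp: diag_mat_def mat_diag_def)
  also have "(\<Prod>a\<leftarrow>map d [0..<n]. [:- a, 1:]) = (\<Prod>i<n. [:- d i, 1:])"
    by (subst atLeast_upt, subst prod.distinct_set_conv_list) (simp_all only: distinct_upt map_map o_def)
  finally have "(\<Prod>i<n. [:- d i, 1:]) = (\<Prod>j=1..n. [:- \<mu> j, 1:])"
    using cp by simp
  then have "card {i \<in> {..<n}. d i = c} = card {j \<in> {1..n}. \<mu> j = c}" for c
    using order_prod_linear_factors[of "{..<n}" c d] order_prod_linear_factors[of "{1..n}" c \<mu>]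
    by simp
  then show ?thesis
    using that[of d P Q] PQ by (simp add: J len)
qed

text \<open>Scalar identities can be mapped into the complex numbers entry by entry, so the real
  eigenbasis becomes applicable to complex vertex functions.\<close>

lemma weighted_symmetric_diagonalization_entries:
  fixes M :: "real mat"
  assumes M: "M \<in> carrier_mat n n"
    and w: "\<And>i. i < n \<Longrightarrow> 0 < w i"
    and sym: "\<And>i j. i < n \<Longrightarrow> j < n \<Longrightarrow> w i * M $$ (i, j) = w j * M $$ (j, i)"
    and cp: "char_poly M = (\<Prod>j=1..n. [:- \<mu> j, 1:])"
  obtains d p q where
    "\<And>i j. i < n \<Longrightarrow> j < n \<Longrightarrow> (\<Sum>k<n. p i k * q k j) = (if i = j then 1 else (0::real))"
    "\<And>i j. i < n \<Longrightarrow> j < n \<Longrightarrow> (\<Sum>k<n. q i k * p k j) = (if i = j then 1 else 0)"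
    "\<And>i j. i < n \<Longrightarrow> j < n \<Longrightarrow> (\<Sum>k<n. M $$ (i, k) * p k j) = p i j * d j"
    "\<And>i j. i < n \<Longrightarrow> j < n \<Longrightarrow> (\<Sum>k<n. q i k * M $$ (k, j)) = d i * q i j"
    "\<And>c. card {i. i < n \<and> d i = c} = card {j \<in> {1..n}. \<mu> j = c}"
proof -
  obtain d P Q where PQ: "similar_mat_wit M (mat_diag n d) P Q"
    and card: "\<And>c. card {i. i < n \<and> d i = c} = card {j \<in> {1..n}. \<mu> j = c}"
    using weighted_symmetric_diagonalizable[OF M w sym cp] by blast
  note * = similar_mat_witD2[OF M PQ]
  have MP: "M * P = P * mat_diag n d"
  proof -
    have "M * P = (P * mat_diag n d * Q) * P" using *(3) by simp
    also have "\<dots> = P * mat_diag n d * (Q * P)"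
      using * by (intro assoc_mult_mat[of _ n n _ n _ n]) auto
    finally show ?thesis using * by (simp add: right_mult_one_mat[of _ n n])
  qed
  have QM: "Q * M = mat_diag n d * Q"
  proof -
    have "Q * M = Q * (P * (mat_diag n d * Q))"
      using * by (subst *(3), subst assoc_mult_mat[of P n n _ n Q n]) auto
    also have "\<dots> = (Q * P) * (mat_diag n d * Q)"
      by (rule assoc_mult_mat[OF *(7) *(6) mult_carrier_mat[OF mat_diag_dim *(7)], symmetric])
    finally show ?thesis using * by (simp add: left_mult_one_mat[of _ n n])
  qed
  have entry: "(A * B) $$ (i, j) = (\<Sum>k<n. A $$ (i, k) * B $$ (k, j))"
    if "A \<in> carrier_mat n n" "B \<in> carrier_mat n n" "i < n" "j < n" for A B :: "real mat" and i j
    using that by (auto simp: scalar_prod_def lessThan_atLeast0)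
  show ?thesis
  proof (rule that[of "\<lambda>i j. P $$ (i, j)" "\<lambda>i j. Q $$ (i, j)" d])
    fix i j assume ij: "i < n" "j < n"
    show "(\<Sum>k<n. P $$ (i, k) * Q $$ (k, j)) = (if i = j then 1 else 0)"
      using entry[of P Q i j] *(1) *(4-7) ij by simp
    show "(\<Sum>k<n. Q $$ (i, k) * P $$ (k, j)) = (if i = j then 1 else 0)"
      using entry[of Q P i j] *(2) *(4-7) ij by simp
    show "(\<Sum>k<n. M $$ (i, k) * P $$ (k, j)) = P $$ (i, j) * d j"
      using entry[of M P i j] *(4-7) ij M by (simp add: MP mat_diag_mult_right[of _ n])
    show "(\<Sum>k<n. Q $$ (i, k) * M $$ (k, j)) = d i * Q $$ (i, j)"
      using entry[of Q M i j] *(4-7) ij M by (simp add: QM mat_diag_mult_left[of _ n n])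
  qed (fact card)
qed

section \<open>The adjacency operator on vertex functions and the eigenspaces of the transition
  matrix\<close>

definition nbr_sum :: "('v, 'e) pre_digraph \<Rightarrow> ('v \<Rightarrow> 'b :: comm_monoid_add) \<Rightarrow> 'v \<Rightarrow> 'b" where
  "nbr_sum G \<phi> v = (\<Sum>e\<in>outs G v. \<phi> (head G e)) + (\<Sum>e\<in>ins G v. \<phi> (tail G e))"

definition vdegree :: "('v, 'e) pre_digraph \<Rightarrow> 'v \<Rightarrow> nat" where
  "vdegree G v = card (incident G v)"

definition adjacent :: "('v, 'e) pre_digraph \<Rightarrow> 'v \<Rightarrow> 'v \<Rightarrow> bool" where
  "adjacent G u v \<longleftrightarrow> (\<exists>e\<in>arcs G. {tail G e, head G e} = {u, v})"

lemma adjacent_commute: "adjacent G u v \<longleftrightarrow> adjacent G v u"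
  by (simp add: adjacent_def insert_commute)

text \<open>The equation for the transition matrix is multiplied by the degrees and stated without
  an enumeration of the vertices. This is the form in which the vertex conditions of the operators
  produce it.\<close>

definition vertex_eigenspace :: "('v, 'e) pre_digraph \<Rightarrow> real \<Rightarrow> ('v \<Rightarrow> complex) set" where
  "vertex_eigenspace G c = {\<phi> \<in> funs_on (verts G). \<forall>v\<in>verts G.
     nbr_sum G \<phi> v = complex_of_real c * of_nat (vdegree G v) * \<phi> v}"

context metric_graph
begin

text \<open>There are no loops and no multiple edges, so sending an incident edge to its opposite
  end is injective and each neighbour is counted once.\<close>

lemma sum_adjacent:
  assumes "v \<in> verts G"
  shows "(\<Sum>u\<in>verts G. if adjacent G v u then \<phi> u else 0) = nbr_sum G \<phi> v"
proof -
  define other where "other e = (if tail G e = v then head G e else tail G e)" for e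
  have "(\<Sum>u\<in>verts G. if adjacent G v u then \<phi> u else 0) = sum \<phi> {u \<in> verts G. adjacent G v u}"
    by (simp add: sum.inter_filter)
  also have "{u \<in> verts G. adjacent G v u} = other ` incident G v"
  proof (intro equalityI subsetI)
    fix u assume "u \<in> {u \<in> verts G. adjacent G v u}"
    then obtain e where e: "e \<in> arcs G" "{tail G e, head G e} = {v, u}"
      by (auto simp: adjacent_def)
    then have "u = other e" "e \<in> incident G v"
      by (auto simp: other_def incident_def doubleton_eq_iff)
    then show "u \<in> other ` incident G v" by blast
  next
    fix u assume "u \<in> other ` incident G v"
    then obtain e where e: "e \<in> incident G v" "u = other e" by auto
    then have "e \<in> arcs G" "{tail G e, head G e} = {v, u}"
      by (auto simp: other_def incident_def)
    then have "adjacent G v u" "u \<in> verts G"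
      using e(2) unfolding adjacent_def by (blast, simp add: other_def)
    then show "u \<in> {u \<in> verts G. adjacent G v u}" by simp
  qed
  also have "sum \<phi> (other ` incident G v) = (\<Sum>e\<in>incident G v. \<phi> (other e))"
  proof -
    have "inj_on other (incident G v)"
    proof (rule inj_onI)
      fix e e' assume *: "e \<in> incident G v" "e' \<in> incident G v" "other e = other e'"
      then have "{tail G e, head G e} = {tail G e', head G e'}"
        by (auto simp: other_def incident_def split: if_splits)
      then show "e = e'"
        using * simple[of e e'] by (simp add: incident_def)
    qed
    then show ?thesis by (simp add: sum.reindex)
  qed
  also have "\<dots> = nbr_sum G \<phi> v"
    unfolding sum_incident nbr_sum_def
    by (intro arg_cong2[where f = "(+)"] sum.cong)
      (use loopfree in \<open>auto simp: other_def outs_def ins_def\<close>)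
  finally show ?thesis .
qed

lemma degree_eq: "vdegree G v = card (outs G v) + card (ins G v)"
  unfolding vdegree_def incident_eq
  by (rule card_Un_disjoint) (auto simp: outs_ins_disjoint)

lemma degree_pos: "v \<in> verts G \<Longrightarrow> 0 < vdegree G v"
  using incident_nonempty[of v] unfolding vdegree_def
  by (auto simp: card_gt_0_iff incident_eq) (auto simp: outs_def ins_def)

text \<open>The handshake identity with weights: an arc is counted once at each of its two
  ends.\<close>

lemma sum_degree:
  "(\<Sum>v\<in>verts G. of_nat (vdegree G v) * f v) = (\<Sum>e\<in>arcs G. f (tail G e) + f (head G e))"
  for f :: "'v \<Rightarrow> 'b :: comm_semiring_1"
proof -
  have "(\<Sum>v\<in>verts G. of_nat (vdegree G v) * f v)
      = (\<Sum>v\<in>verts G. \<Sum>e\<in>outs G v. f (tail G e)) + (\<Sum>v\<in>verts G. \<Sum>e\<in>ins G v. f (head G e))"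
    unfolding sum.distrib[symmetric]
    by (rule sum.cong) (auto simp: degree_eq outs_def ins_def algebra_simps)
  then show ?thesis by (simp add: sum_outs sum_ins sum.distrib)
qed

context
  fixes vs n
  assumes vs: "distinct vs" "set vs = verts G" and n: "n = card (verts G)"
begin

lemma length_vs: "length vs = n"
  using distinct_card[OF vs(1)] by (simp add: vs(2) n)

lemma sum_vs: "(\<Sum>k<n. f (vs ! k)) = (\<Sum>v\<in>verts G. f v)"
  using sum.reindex_bij_betw[OF bij_betw_nth[OF vs(1), of "{..<n}" "verts G"], of f]
  by (simp add: length_vs vs)

lemma vs_in_verts: "i < n \<Longrightarrow> vs ! i \<in> verts G"
  using nth_mem[of i vs] by (simp add: length_vs vs(2))

lemma transition_matrix_carrier: "transition_matrix G vs \<in> carrier_mat n n"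
  unfolding transition_matrix_def Let_def length_vs
  by (rule mult_carrier_mat[of _ n n]) (auto simp: adjacency_matrix_def length_vs)

lemma transition_matrix_entry:
  assumes "i < n" "j < n"
  shows "transition_matrix G vs $$ (i, j) =
    (if adjacent G (vs ! i) (vs ! j) then 1 / vdegree G (vs ! i) else 0)"
proof -
  define A where "A = adjacency_matrix G vs"
  have A: "A \<in> carrier_mat n n"
    by (simp add: A_def adjacency_matrix_def length_vs)
  have entry: "A $$ (k, l) = (if adjacent G (vs ! k) (vs ! l) then 1 else 0)" if "k < n" "l < n" for k l
    using that by (simp add: A_def adjacency_matrix_def adjacent_def length_vs)
  have "vec_index (A *\<^sub>v Matrix.vec n (\<lambda>_. 1)) i = (\<Sum>k<n. A $$ (i, k))"
    using assms A by (auto simp: scalar_prod_def lessThan_atLeast0)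
  also have "\<dots> = (\<Sum>k<n. if adjacent G (vs ! i) (vs ! k) then 1 else 0)"
    using assms by (intro sum.cong) (auto simp: entry)
  also have "\<dots> = nbr_sum G (\<lambda>_. 1) (vs ! i)"
    unfolding sum_adjacent[OF vs_in_verts[OF assms(1)], symmetric]
    by (rule sum_vs)
  also have "\<dots> = vdegree G (vs ! i)"
    by (simp add: nbr_sum_def degree_eq)
  finally have d: "vec_index (A *\<^sub>v Matrix.vec n (\<lambda>_. 1)) i = vdegree G (vs ! i)" .
  have "transition_matrix G vs $$ (i, j) = inverse (vec_index (A *\<^sub>v Matrix.vec n (\<lambda>_. 1)) i) * A $$ (i, j)"
    unfolding transition_matrix_def Let_def A_def[symmetric] length_vs
    using assms by (subst mat_diag_mult_left[OF A]) simp
  then show ?thesis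
    using assms by (simp add: d entry inverse_eq_divide)
qed

lemma sum_transition_matrix:
  fixes \<phi> :: "'v \<Rightarrow> complex"
  assumes "i < n"
  shows "(\<Sum>k<n. complex_of_real (transition_matrix G vs $$ (i, k)) * \<phi> (vs ! k))
    = nbr_sum G \<phi> (vs ! i) / of_nat (vdegree G (vs ! i))"
proof -
  have "(\<Sum>k<n. complex_of_real (transition_matrix G vs $$ (i, k)) * \<phi> (vs ! k))
      = (\<Sum>k<n. (if adjacent G (vs ! i) (vs ! k) then \<phi> (vs ! k) else 0)) / of_nat (vdegree G (vs ! i))"
    using assms unfolding sum_divide_distrib
    by (intro sum.cong) (auto simp: transition_matrix_entry)
  then show ?thesis
    unfolding sum_adjacent[OF vs_in_verts[OF assms(1)], symmetric]
      sum_vs[of "\<lambda>u. if adjacent G (vs ! i) u then \<phi> u else 0", symmetric] by simp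
qed

text \<open>The columns of \<open>p\<close> form an eigenbasis, and \<open>T\<close> sends
  coordinates to the corresponding vertex function; \<open>q\<close> recovers the coordinates, so
  \<open>T\<close> is injective. The eigenspace for \<open>c\<close> consists of the combinations
  supported on the set \<open>I\<close> of basis vectors with eigenvalue \<open>c\<close>.\<close>

lemma dim_vertex_eigenspace:
  assumes cp: "char_poly (transition_matrix G vs) = (\<Prod>j=1..n. [:- \<mu> j, 1:])"
  shows "fs.dim (vertex_eigenspace G c) = card {j \<in> {1..n}. \<mu> j = c}"
proof -
  let ?Z = "transition_matrix G vs"
  have w: "0 < real (vdegree G (vs ! i))" if "i < n" for i
    using degree_pos[OF vs_in_verts[OF that]] by simp
  have sym: "real (vdegree G (vs ! i)) * ?Z $$ (i, j) = real (vdegree G (vs ! j)) * ?Z $$ (j, i)"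
    if "i < n" "j < n" for i j
    using w[OF that(1)] w[OF that(2)]
    unfolding transition_matrix_entry[OF that] transition_matrix_entry[OF that(2) that(1)]
      adjacent_commute[of G "vs ! j" "vs ! i"] by simp
  obtain d p q where
    pq: "\<And>i j. i < n \<Longrightarrow> j < n \<Longrightarrow> (\<Sum>k<n. p i k * q k j) = (if i = j then 1 else (0::real))" and
    qp: "\<And>i j. i < n \<Longrightarrow> j < n \<Longrightarrow> (\<Sum>k<n. q i k * p k j) = (if i = j then 1 else 0)" and
    Zp: "\<And>i j. i < n \<Longrightarrow> j < n \<Longrightarrow> (\<Sum>k<n. ?Z $$ (i, k) * p k j) = p i j * d j" and
    qZ: "\<And>i j. i < n \<Longrightarrow> j < n \<Longrightarrow> (\<Sum>k<n. q i k * ?Z $$ (k, j)) = d i * q i j" and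
    card: "\<And>c. card {i. i < n \<and> d i = c} = card {j \<in> {1..n}. \<mu> j = c}"
    by (rule weighted_symmetric_diagonalization_entries[OF transition_matrix_carrier w sym cp]) (assumption | rule that)+
  define idx where "idx = the_inv_into {..<n} ((!) vs)"
  have inj: "inj_on ((!) vs) {..<n}"
    using vs(1) by (simp add: inj_on_def nth_eq_iff_index_eq length_vs)
  have img: "(!) vs ` {..<n} = verts G"
    using vs(2) length_vs by (auto simp: set_conv_nth)
  have idx: "idx (vs ! i) = i" if "i < n" for i
    using the_inv_into_f_f[OF inj] that by (simp add: idx_def)
  define T where "T y v = (if v \<in> verts G then \<Sum>j<n. complex_of_real (p (idx v) j) * y j else 0)"
    for y :: "nat \<Rightarrow> complex" and v
  define I where "I = {i. i < n \<and> d i = c}"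
  have T_vs: "T y (vs ! i) = (\<Sum>j<n. complex_of_real (p i j) * y j)" if "i < n" for y i
    using that vs_in_verts[OF that] by (simp add: T_def idx)
  have lin: "Vector_Spaces.linear fscale fscale T"
    by (rule linear_fs_fsI)
      (auto simp: T_def fun_eq_iff fscale_apply sum.distrib sum_distrib_left algebra_simps)
  have swap: "(\<Sum>k<n. a k * (\<Sum>j<n. b k j * y j)) = (\<Sum>j<n. (\<Sum>k<n. a k * b k j) * y j)"
    for a :: "nat \<Rightarrow> complex" and b y
    unfolding sum_distrib_left sum_distrib_right
    by (subst sum.swap) (simp add: mult.assoc)
  have qT: "(\<Sum>k<n. complex_of_real (q i k) * T y (vs ! k)) = y i" if i: "i < n" for i y
  proof -
    have "(\<Sum>k<n. complex_of_real (q i k) * T y (vs ! k))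
        = (\<Sum>j<n. (\<Sum>k<n. complex_of_real (q i k) * complex_of_real (p k j)) * y j)"
      unfolding swap[symmetric] by (intro sum.cong) (auto simp: T_vs)
    also have "\<dots> = (\<Sum>j<n. (if i = j then 1 else 0) * y j)"
    proof (intro sum.cong refl)
      fix j assume "j \<in> {..<n}"
      then show "(\<Sum>k<n. complex_of_real (q i k) * complex_of_real (p k j)) * y j = (if i = j then 1 else 0) * y j"
        using arg_cong[OF qp[OF i, of j], of complex_of_real] by simp
    qed
    also have "\<dots> = y i" using i by (simp add: if_distrib[of "\<lambda>x. x * _"] cong: if_cong)
    finally show ?thesis .
  qed
  have injT: "inj_on T (funs_on I)"
  proof (rule inj_onI)
    fix y y' assume *: "y \<in> funs_on I" "y' \<in> funs_on I" "T y = T y'"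
    show "y = y'"
    proof
      fix i show "y i = y' i"
        using * qT[of i y] qT[of i y'] by (cases "i < n") (auto simp: funs_on_def I_def)
    qed
  qed
  have "T ` funs_on I = vertex_eigenspace G c"
  proof (intro equalityI subsetI)
    fix \<phi> assume "\<phi> \<in> T ` funs_on I"
    then obtain y where y: "y \<in> funs_on I" "\<phi> = T y" by auto
    have "nbr_sum G \<phi> (vs ! i) = complex_of_real c * of_nat (vdegree G (vs ! i)) * \<phi> (vs ! i)"
      if i: "i < n" for i
    proof -
      have "nbr_sum G \<phi> (vs ! i) / of_nat (vdegree G (vs ! i))
          = (\<Sum>k<n. complex_of_real (?Z $$ (i, k)) * (\<Sum>j<n. complex_of_real (p k j) * y j))"
        unfolding sum_transition_matrix[OF i, symmetric] y(2) by (intro sum.cong) (auto simp: T_vs)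
      also have "\<dots> = (\<Sum>j<n. (\<Sum>k<n. complex_of_real (?Z $$ (i, k)) * complex_of_real (p k j)) * y j)"
        by (rule swap)
      also have "\<dots> = (\<Sum>j<n. complex_of_real (p i j) * complex_of_real c * y j)"
      proof (intro sum.cong refl)
        fix j assume "j \<in> {..<n}"
        then have "(\<Sum>k<n. complex_of_real (?Z $$ (i, k)) * complex_of_real (p k j))
            = complex_of_real (p i j) * complex_of_real (d j)"
          using arg_cong[OF Zp[OF i, of j], of complex_of_real] by simp
        then show "(\<Sum>k<n. complex_of_real (?Z $$ (i, k)) * complex_of_real (p k j)) * y j
            = complex_of_real (p i j) * complex_of_real c * y j"
          using y(1) \<open>j \<in> {..<n}\<close> by (auto simp: funs_on_def I_def)
      qed
      also have "\<dots> = complex_of_real c * \<phi> (vs ! i)"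
        using i by (simp add: y T_vs sum_distrib_left mult_ac)
      finally show ?thesis using w[OF i] by (simp add: field_simps)
    qed
    moreover have "\<phi> \<in> funs_on (verts G)"
      using y(2) by (simp add: funs_on_def T_def)
    ultimately show "\<phi> \<in> vertex_eigenspace G c"
      unfolding vertex_eigenspace_def img[symmetric] by auto
  next
    fix \<phi> assume \<phi>: "\<phi> \<in> vertex_eigenspace G c"
    define y where "y i = (if i < n then \<Sum>k<n. complex_of_real (q i k) * \<phi> (vs ! k) else 0)" for i
    have "y \<in> funs_on I"
    proof -
      \<comment> \<open>Row \<open>i\<close> of \<open>q\<close> is a left eigenvector for
        \<open>d i\<close>. Applied to the eigenvalue equation of \<open>\<phi>\<close>, it shows
        that the coordinate \<open>y i\<close> vanishes unless \<open>d i = c\<close>.\<close>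
      have "complex_of_real c * y i = complex_of_real (d i) * y i" if i: "i < n" for i
      proof -
        have "complex_of_real c * y i = (\<Sum>k<n. complex_of_real (q i k) * (complex_of_real c * \<phi> (vs ! k)))"
          using i by (simp add: y_def sum_distrib_left mult_ac)
        also have "\<dots> = (\<Sum>k<n. complex_of_real (q i k) * (\<Sum>j<n. complex_of_real (?Z $$ (k, j)) * \<phi> (vs ! j)))"
        proof (intro sum.cong refl)
          fix k assume k: "k \<in> {..<n}"
          have "nbr_sum G \<phi> (vs ! k) = complex_of_real c * of_nat (vdegree G (vs ! k)) * \<phi> (vs ! k)"
            using \<phi> k vs_in_verts by (auto simp: vertex_eigenspace_def)
          then have "complex_of_real c * \<phi> (vs ! k) = nbr_sum G \<phi> (vs ! k) / of_nat (vdegree G (vs ! k))"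
            using w[of k] k by (simp add: field_simps)
          then show "complex_of_real (q i k) * (complex_of_real c * \<phi> (vs ! k))
              = complex_of_real (q i k) * (\<Sum>j<n. complex_of_real (?Z $$ (k, j)) * \<phi> (vs ! j))"
            using k by (simp only: sum_transition_matrix lessThan_iff)
        qed
        also have "\<dots> = (\<Sum>j<n. (\<Sum>k<n. complex_of_real (q i k) * complex_of_real (?Z $$ (k, j))) * \<phi> (vs ! j))"
          by (rule swap)
        also have "\<dots> = (\<Sum>j<n. complex_of_real (d i) * complex_of_real (q i j) * \<phi> (vs ! j))"
        proof (intro sum.cong refl)
          fix j assume "j \<in> {..<n}"
          then show "(\<Sum>k<n. complex_of_real (q i k) * complex_of_real (?Z $$ (k, j))) * \<phi> (vs ! j)
              = complex_of_real (d i) * complex_of_real (q i j) * \<phi> (vs ! j)"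
            using arg_cong[OF qZ[OF i, of j], of complex_of_real] by simp
        qed
        also have "\<dots> = complex_of_real (d i) * y i"
          using i by (simp add: y_def sum_distrib_left mult_ac)
        finally show ?thesis .
      qed
      then show ?thesis
        by (force simp: funs_on_def I_def y_def)
    qed
    moreover have "\<phi> = T y"
    proof
      fix v
      show "\<phi> v = T y v"
      proof (cases "v \<in> verts G")
        case False
        then show ?thesis using \<phi> by (auto simp: vertex_eigenspace_def funs_on_def T_def)
      next
        case True
        then obtain i where i: "i < n" "v = vs ! i" using img by auto
        have "T y v = (\<Sum>k<n. complex_of_real (p i k) * (\<Sum>j<n. complex_of_real (q k j) * \<phi> (vs ! j)))"
          unfolding i(2) T_vs[OF i(1)] by (intro sum.cong) (auto simp: y_def)
        also have "\<dots> = (\<Sum>j<n. (\<Sum>k<n. complex_of_real (p i k) * complex_of_real (q k j)) * \<phi> (vs ! j))"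
          by (rule swap)
        also have "\<dots> = (\<Sum>j<n. (if i = j then 1 else 0) * \<phi> (vs ! j))"
        proof (intro sum.cong refl)
          fix j assume "j \<in> {..<n}"
          then show "(\<Sum>k<n. complex_of_real (p i k) * complex_of_real (q k j)) * \<phi> (vs ! j)
              = (if i = j then 1 else 0) * \<phi> (vs ! j)"
            using arg_cong[OF pq[OF i(1), of j], of complex_of_real] by simp
        qed
        also have "\<dots> = \<phi> v"
          using i by (simp add: if_distrib[of "\<lambda>x. x * _"] cong: if_cong)
        finally show ?thesis by simp
      qed
    qed
    ultimately show "\<phi> \<in> T ` funs_on I" by blast
  qed
  then have "fs.dim (vertex_eigenspace G c) = fs.dim (funs_on I)"
    using fs_fs.dim_image_inj_on[OF lin subspace_funs_on injT] by simp
  also have "\<dots> = card I"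
    by (rule dim_funs_on) (simp add: I_def)
  finally show ?thesis by (simp add: I_def card)
qed

end

end

section \<open>Vertex conditions on edge data\<close>

lemma cmod_diff_sign_squared:
  fixes \<sigma> :: real
  assumes "\<sigma>\<^sup>2 = 1"
  shows "(cmod (a - complex_of_real \<sigma> * b))\<^sup>2 = (cmod a)\<^sup>2 + (cmod b)\<^sup>2 - \<sigma> * Re (cnj a * b) - \<sigma> * Re (cnj b * a)"
proof -
  have "(\<sigma> * Re b)\<^sup>2 + (\<sigma> * Im b)\<^sup>2 = (Re b)\<^sup>2 + (Im b)\<^sup>2"
    by (simp add: power_mult_distrib assms)
  then show ?thesis
    by (simp add: cmod_power2 power2_diff algebra_simps)
qed

text \<open>
  The data \<open>z (True, e)\<close> and \<open>z (False, e)\<close> are the value and the derivative at the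
  tail of \<open>e\<close> of a solution on \<open>e\<close> (with the two roles exchanged for the anti-standard
  conditions), and the coefficients \<open>c\<close>, \<open>s\<close>, \<open>r\<close> transport them to the head.
\<close>

definition edge_data ::
    "('v, 'e) pre_digraph \<Rightarrow> complex \<Rightarrow> complex \<Rightarrow> complex \<Rightarrow> (bool \<times> 'e \<Rightarrow> complex) set" where
  "edge_data G c s r = {z \<in> funs_on (UNIV \<times> arcs G).
     (\<exists>\<phi>. \<forall>e\<in>arcs G. z (True, e) = \<phi> (tail G e) \<and> c * z (True, e) + s * z (False, e) = \<phi> (head G e)) \<and>
     (\<forall>v\<in>verts G. (\<Sum>e\<in>outs G v. z (False, e)) + (\<Sum>e\<in>ins G v. r * z (True, e) - c * z (False, e)) = 0)}"

lemma edge_data_vertex_values: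
  assumes "z \<in> edge_data G c s r"
  obtains \<phi> where "\<And>e. e \<in> arcs G \<Longrightarrow> z (True, e) = \<phi> (tail G e)"
    "\<And>e. e \<in> arcs G \<Longrightarrow> c * z (True, e) + s * z (False, e) = \<phi> (head G e)"
  using assms unfolding edge_data_def by blast

lemma edge_dataI:
  assumes "z \<in> funs_on (UNIV \<times> arcs G)"
    and "\<forall>e\<in>arcs G. z (True, e) = \<phi> (tail G e) \<and> c * z (True, e) + s * z (False, e) = \<phi> (head G e)"
    and "\<And>v. v \<in> verts G \<Longrightarrow>
      (\<Sum>e\<in>outs G v. z (False, e)) + (\<Sum>e\<in>ins G v. r * z (True, e) - c * z (False, e)) = 0"
  shows "z \<in> edge_data G c s r"
  using assms unfolding edge_data_def by blast

lemma edge_data_flow: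
  assumes "z \<in> edge_data G c s r" "v \<in> verts G"
  shows "(\<Sum>e\<in>outs G v. z (False, e)) + (\<Sum>e\<in>ins G v. r * z (True, e) - c * z (False, e)) = 0"
  using assms unfolding edge_data_def by blast

lemma subspace_vertex_eigenspace: "fs.subspace (vertex_eigenspace G c)"
proof -
  have "nbr_sum G (fscale a \<phi>) v = a * nbr_sum G \<phi> v"
    and "nbr_sum G (\<phi> + \<psi>) v = nbr_sum G \<phi> v + nbr_sum G \<psi> v" for a \<phi> \<psi> v
    by (simp_all add: nbr_sum_def fscale_apply sum_distrib_left distrib_left sum.distrib)
  moreover have "nbr_sum G 0 v = 0" for v
    by (simp add: nbr_sum_def)
  ultimately show ?thesis
    by (auto simp: fs.subspace_def vertex_eigenspace_def funs_on_def fscale_apply algebra_simps)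
qed

context metric_graph
begin

text \<open>The left side is the quadratic form of the Laplacian for \<sigma> = 1 and of the
  signless Laplacian for \<sigma> = -1. Its cross terms add up to the pairing of \<phi> with its
  neighbour sums, where the eigenvalue equation applies. Nonnegativity of the form is what controls
  the extreme values of \<open>c\<close>.\<close>

lemma vertex_eigenspace_energy:
  fixes \<sigma> :: real
  assumes \<sigma>: "\<sigma>\<^sup>2 = 1" and \<phi>: "\<phi> \<in> vertex_eigenspace G c"
  shows "(\<Sum>e\<in>arcs G. (cmod (\<phi> (head G e) - complex_of_real \<sigma> * \<phi> (tail G e)))\<^sup>2)
    = (1 - \<sigma> * c) * (\<Sum>v\<in>verts G. real (vdegree G v) * (cmod (\<phi> v))\<^sup>2)"
proof -
  let ?D = "\<Sum>v\<in>verts G. real (vdegree G v) * (cmod (\<phi> v))\<^sup>2"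
  have "(\<Sum>e\<in>arcs G. cnj (\<phi> (tail G e)) * \<phi> (head G e) + cnj (\<phi> (head G e)) * \<phi> (tail G e))
      = (\<Sum>v\<in>verts G. cnj (\<phi> v) * nbr_sum G \<phi> v)"
  proof -
    have "(\<Sum>v\<in>verts G. cnj (\<phi> v) * nbr_sum G \<phi> v)
        = (\<Sum>v\<in>verts G. \<Sum>e\<in>outs G v. cnj (\<phi> (tail G e)) * \<phi> (head G e))
        + (\<Sum>v\<in>verts G. \<Sum>e\<in>ins G v. cnj (\<phi> (head G e)) * \<phi> (tail G e))"
      unfolding sum.distrib[symmetric] nbr_sum_def distrib_left sum_distrib_left
      by (intro sum.cong arg_cong2[where f = "(+)"]) (auto simp: outs_def ins_def sum_distrib_left)
    then show ?thesis by (simp add: sum_outs sum_ins sum.distrib)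
  qed
  also have "\<dots> = (\<Sum>v\<in>verts G. complex_of_real (c * (real (vdegree G v) * (cmod (\<phi> v))\<^sup>2)))"
  proof (intro sum.cong refl)
    fix v assume "v \<in> verts G"
    then have "nbr_sum G \<phi> v = complex_of_real c * of_nat (vdegree G v) * \<phi> v"
      using \<phi> by (simp add: vertex_eigenspace_def)
    then have "cnj (\<phi> v) * nbr_sum G \<phi> v = complex_of_real c * of_nat (vdegree G v) * (\<phi> v * cnj (\<phi> v))"
      by (simp only: mult_ac)
    then show "cnj (\<phi> v) * nbr_sum G \<phi> v = complex_of_real (c * (real (vdegree G v) * (cmod (\<phi> v))\<^sup>2))"
      by (simp add: complex_norm_square[symmetric])
  qed
  also have "\<dots> = complex_of_real (c * ?D)"
    by (simp add: sum_distrib_left)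
  finally have cross: "(\<Sum>e\<in>arcs G. Re (cnj (\<phi> (tail G e)) * \<phi> (head G e)) + Re (cnj (\<phi> (head G e)) * \<phi> (tail G e)))
      = c * ?D"
    by (metis (no_types, lifting) Re_complex_of_real Re_sum plus_complex.sel(1) sum.cong)
  have "(\<Sum>e\<in>arcs G. (cmod (\<phi> (head G e) - complex_of_real \<sigma> * \<phi> (tail G e)))\<^sup>2)
      = (\<Sum>e\<in>arcs G. (cmod (\<phi> (tail G e)))\<^sup>2 + (cmod (\<phi> (head G e)))\<^sup>2)
        - \<sigma> * (\<Sum>e\<in>arcs G. Re (cnj (\<phi> (tail G e)) * \<phi> (head G e)) + Re (cnj (\<phi> (head G e)) * \<phi> (tail G e)))"
    unfolding cmod_diff_sign_squared[OF \<sigma>] sum_distrib_left sum_subtractf[symmetric]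
    by (intro sum.cong refl) (simp add: algebra_simps)
  also have "(\<Sum>e\<in>arcs G. (cmod (\<phi> (tail G e)))\<^sup>2 + (cmod (\<phi> (head G e)))\<^sup>2) = ?D"
    using sum_degree[of "\<lambda>v. (cmod (\<phi> v))\<^sup>2"] by simp
  finally show ?thesis
    unfolding cross by (simp add: algebra_simps)
qed

text \<open>The energy identity has a nonpositive right side here, so each square on the left
  vanishes.\<close>

lemma vertex_eigenspace_edge:
  fixes \<sigma> :: real
  assumes \<sigma>: "\<sigma>\<^sup>2 = 1" and c: "\<sigma> * c \<ge> 1" and \<phi>: "\<phi> \<in> vertex_eigenspace G c" and e: "e \<in> arcs G"
  shows "\<phi> (head G e) = complex_of_real \<sigma> * \<phi> (tail G e)"
proof -
  have "(1 - \<sigma> * c) * (\<Sum>v\<in>verts G. real (vdegree G v) * (cmod (\<phi> v))\<^sup>2) \<le> 0"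
    using c by (intro mult_nonpos_nonneg sum_nonneg) auto
  then have "(\<Sum>e\<in>arcs G. (cmod (\<phi> (head G e) - complex_of_real \<sigma> * \<phi> (tail G e)))\<^sup>2) \<le> 0"
    unfolding vertex_eigenspace_energy[OF \<sigma> \<phi>] .
  moreover have "(cmod (\<phi> (head G e) - complex_of_real \<sigma> * \<phi> (tail G e)))\<^sup>2
      \<le> (\<Sum>e\<in>arcs G. (cmod (\<phi> (head G e) - complex_of_real \<sigma> * \<phi> (tail G e)))\<^sup>2)"
    using e by (intro member_le_sum) auto
  ultimately have "(cmod (\<phi> (head G e) - complex_of_real \<sigma> * \<phi> (tail G e)))\<^sup>2 \<le> 0" by linarith
  then show ?thesis by simp
qed

text \<open>A nonzero value at \<open>v\<close> would, by connectedness, make every value either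
  that number or its negative. These two level sets are disjoint and would form a
  bipartition.\<close>

lemma alternating_zero:
  fixes \<phi> :: "'v \<Rightarrow> complex"
  assumes nb: "\<not> bipartite G" and alt: "\<And>e. e \<in> arcs G \<Longrightarrow> \<phi> (head G e) = - \<phi> (tail G e)"
    and v: "v \<in> verts G"
  shows "\<phi> v = 0"
proof (rule ccontr)
  assume nz: "\<phi> v \<noteq> 0"
  define X where "X = {u \<in> verts G. \<phi> u = \<phi> v}"
  define Y where "Y = {u \<in> verts G. \<phi> u = - \<phi> v}"
  have XY: "(tail G e \<in> X \<and> head G e \<in> Y) \<or> (tail G e \<in> Y \<and> head G e \<in> X)"
    if "e \<in> arcs G" "tail G e \<in> X \<union> Y \<or> head G e \<in> X \<union> Y" for e
    using that alt[OF that(1)] by (auto simp: X_def Y_def minus_equation_iff)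
  have "u \<in> X \<union> Y" if "u \<in> verts G" for u
    using v _ _ that
  proof (rule connected_propagate)
    show "v \<in> X \<union> Y" using v by (simp add: X_def)
    show "tail G e \<in> X \<union> Y \<longleftrightarrow> head G e \<in> X \<union> Y" if "e \<in> arcs G" for e
      using XY[OF that] by blast
  qed
  then have "X \<union> Y = verts G" by (auto simp: X_def Y_def)
  moreover have "X \<inter> Y = {}" using nz by (auto simp: X_def Y_def)
  ultimately show False
    using nb XY unfolding bipartite_def by (metis tail_in_verts)
qed

lemma const_on_verts:
  assumes "\<And>e. e \<in> arcs G \<Longrightarrow> \<phi> (head G e) = \<phi> (tail G e)" "u \<in> verts G" "v \<in> verts G"
  shows "\<phi> v = \<phi> u"
  using connected_propagate[of u "\<lambda>w. \<phi> w = \<phi> u" v] assms by auto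

text \<open>For c \<le> -1 the function alternates along edges, which non-bipartiteness forbids
  unless it is zero. For c > 1 it is constant along edges, so its energy is zero while the factor 1
  - c is not, and the weighted norm vanishes.\<close>

lemma vertex_eigenspace_eq_0:
  assumes nb: "\<not> bipartite G" and c: "\<bar>c\<bar> \<ge> 1" "c \<noteq> 1" and \<phi>: "\<phi> \<in> vertex_eigenspace G c"
  shows "\<phi> = 0"
proof -
  have "\<phi> v = 0" if v: "v \<in> verts G" for v
  proof (cases "c < 0")
    case True
    then show ?thesis
      using vertex_eigenspace_edge[of "-1" c \<phi>] c \<phi> v by (intro alternating_zero[OF nb]) auto
  next
    case False
    then have "\<phi> (head G e) = 1 * \<phi> (tail G e)" if "e \<in> arcs G" for e
      using vertex_eigenspace_edge[of 1 c \<phi> e] c \<phi> that by simp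
    then have "(1 - 1 * c) * (\<Sum>v\<in>verts G. real (vdegree G v) * (cmod (\<phi> v))\<^sup>2) = 0"
      using vertex_eigenspace_energy[of 1 \<phi> c] \<phi> by simp
    then have "(\<Sum>v\<in>verts G. real (vdegree G v) * (cmod (\<phi> v))\<^sup>2) = 0"
      using c by simp
    then have "real (vdegree G v) * (cmod (\<phi> v))\<^sup>2 = 0"
      using v by (subst (asm) sum_nonneg_eq_0_iff) auto
    then show ?thesis using degree_pos[OF v] by simp
  qed
  then show ?thesis
    using \<phi> by (auto simp: vertex_eigenspace_def funs_on_def fun_eq_iff)
qed

lemma dim_vertex_eigenspace_1: "fs.dim (vertex_eigenspace G 1) = 1"
proof -
  define \<phi>1 :: "'v \<Rightarrow> complex" where "\<phi>1 v = (if v \<in> verts G then 1 else 0)" for v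
  obtain v0 where v0: "v0 \<in> verts G"
    using card_verts_pos by fastforce
  show ?thesis
  proof (rule fs.dim_unique[of "{\<phi>1}"])
    have "nbr_sum G \<phi>1 v = of_nat (vdegree G v)" if "v \<in> verts G" for v
    proof -
      have "(\<Sum>e\<in>outs G v. \<phi>1 (head G e)) = (\<Sum>e\<in>outs G v. 1)"
        and "(\<Sum>e\<in>ins G v. \<phi>1 (tail G e)) = (\<Sum>e\<in>ins G v. 1)"
        by (rule sum.cong; simp add: \<phi>1_def outs_def ins_def)+
      then show ?thesis by (simp add: nbr_sum_def degree_eq)
    qed
    then show "{\<phi>1} \<subseteq> vertex_eigenspace G 1"
      by (auto simp: vertex_eigenspace_def \<phi>1_def funs_on_def)
    have "\<phi>1 \<noteq> 0" using v0 by (auto simp: \<phi>1_def fun_eq_iff)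
    then show "fs.independent {\<phi>1}" by simp
    show "vertex_eigenspace G 1 \<subseteq> fs.span {\<phi>1}"
    proof
      fix \<phi> assume \<phi>: "\<phi> \<in> vertex_eigenspace G 1"
      then have "\<phi> (head G e) = \<phi> (tail G e)" if "e \<in> arcs G" for e
        using vertex_eigenspace_edge[of 1 1 \<phi> e] that by simp
      then have "\<phi> v = \<phi> v0" if "v \<in> verts G" for v
        using const_on_verts[of \<phi> v0 v] v0 that by blast
      then have "\<phi> = fscale (\<phi> v0) \<phi>1"
        using \<phi> by (auto simp: fun_eq_iff fscale_apply \<phi>1_def vertex_eigenspace_def funs_on_def)
      then show "\<phi> \<in> fs.span {\<phi>1}"
        by (metis fs.span_base fs.span_scale singletonI)
    qed
  qed simp
qed

text \<open>Off resonance a solution is determined by its vertex values.\<close>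

lemma dim_edge_data_nonresonant:
  assumes s: "s \<noteq> 0" and det: "(complex_of_real c)\<^sup>2 + r * s = 1"
  shows "fs.dim (edge_data G (complex_of_real c) s r) = fs.dim (vertex_eigenspace G c)"
proof -
  define T where "T \<phi> = (\<lambda>(b, e). if e \<in> arcs G then
      if b then \<phi> (tail G e) else (\<phi> (head G e) - complex_of_real c * \<phi> (tail G e)) / s else 0)"
    for \<phi> :: "'v \<Rightarrow> complex"
  have lin: "Vector_Spaces.linear fscale fscale T"
    by (rule linear_fs_fsI) (auto simp: T_def fun_eq_iff fscale_apply field_simps s)
  have T: "T \<phi> (True, e) = \<phi> (tail G e)" "complex_of_real c * T \<phi> (True, e) + s * T \<phi> (False, e) = \<phi> (head G e)"
    if "e \<in> arcs G" for e \<phi>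
    using that s by (auto simp: T_def)
  have inj: "inj_on T (vertex_eigenspace G c)"
  proof (rule inj_onI)
    fix \<phi> \<psi> assume *: "\<phi> \<in> vertex_eigenspace G c" "\<psi> \<in> vertex_eigenspace G c" "T \<phi> = T \<psi>"
    show "\<phi> = \<psi>"
    proof
      fix v show "\<phi> v = \<psi> v"
      proof (cases "v \<in> verts G")
        case True
        then obtain e where "e \<in> arcs G" "tail G e = v \<or> head G e = v"
          using incident_nonempty by blast
        then show ?thesis using T[of e \<phi>] T[of e \<psi>] *(3) by auto
      qed (use * in \<open>auto simp: vertex_eigenspace_def funs_on_def\<close>)
    qed
  qed
  \<comment> \<open>By the determinant relation the contribution of an edge at its head has the same
    form as at its tail, with the two ends exchanged. The balance at \<open>v\<close> thus becomes
    the eigenvector equation divided by \<open>s\<close>.\<close>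
  have flow: "(\<Sum>e\<in>outs G v. T \<phi> (False, e)) + (\<Sum>e\<in>ins G v. r * T \<phi> (True, e) - complex_of_real c * T \<phi> (False, e))
      = (nbr_sum G \<phi> v - complex_of_real c * of_nat (vdegree G v) * \<phi> v) / s" for \<phi> v
  proof -
    have "(\<Sum>e\<in>outs G v. T \<phi> (False, e)) = (\<Sum>e\<in>outs G v. (\<phi> (head G e) - complex_of_real c * \<phi> v) / s)"
      by (rule sum.cong) (auto simp: T_def outs_def)
    moreover have "(\<Sum>e\<in>ins G v. r * T \<phi> (True, e) - complex_of_real c * T \<phi> (False, e))
        = (\<Sum>e\<in>ins G v. (\<phi> (tail G e) - complex_of_real c * \<phi> v) / s)"
    proof (rule sum.cong)
      fix e assume e: "e \<in> ins G v"
      have "s * (r * T \<phi> (True, e) - complex_of_real c * T \<phi> (False, e))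
          = (r * s + (complex_of_real c)\<^sup>2) * \<phi> (tail G e) - complex_of_real c * \<phi> v"
        using e s by (simp add: T_def ins_def field_simps power2_eq_square)
      then show "r * T \<phi> (True, e) - complex_of_real c * T \<phi> (False, e) = (\<phi> (tail G e) - complex_of_real c * \<phi> v) / s"
        using det s by (simp add: eq_divide_eq add.commute mult.commute)
    qed simp
    ultimately show ?thesis
      by (simp only:) (simp add: sum_divide_distrib[symmetric] sum_subtractf nbr_sum_def degree_eq
          add_divide_distrib diff_divide_distrib algebra_simps)
  qed
  have "T ` vertex_eigenspace G c = edge_data G (complex_of_real c) s r"
  proof (intro equalityI subsetI)
    fix z assume "z \<in> T ` vertex_eigenspace G c"
    then obtain \<phi> where \<phi>: "\<phi> \<in> vertex_eigenspace G c" "z = T \<phi>" by auto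
    have "z \<in> funs_on (UNIV \<times> arcs G)"
      by (auto simp: \<phi> T_def funs_on_def)
    moreover have "\<forall>e\<in>arcs G. z (True, e) = \<phi> (tail G e) \<and> complex_of_real c * z (True, e) + s * z (False, e) = \<phi> (head G e)"
      using T \<phi> by auto
    ultimately show "z \<in> edge_data G (complex_of_real c) s r"
      using \<phi> flow unfolding edge_data_def vertex_eigenspace_def by fastforce
  next
    fix z assume z: "z \<in> edge_data G (complex_of_real c) s r"
    then obtain \<phi>0 where \<phi>0: "\<And>e. e \<in> arcs G \<Longrightarrow> z (True, e) = \<phi>0 (tail G e)"
      "\<And>e. e \<in> arcs G \<Longrightarrow> complex_of_real c * z (True, e) + s * z (False, e) = \<phi>0 (head G e)"
      by (rule edge_data_vertex_values) blast
    define \<phi> where "\<phi> v = (if v \<in> verts G then \<phi>0 v else 0)" for v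
    have zT: "z = T \<phi>"
    proof
      fix be :: "bool \<times> 'e"
      obtain b e where be: "be = (b, e)" by force
      show "z be = T \<phi> be"
      proof (cases "e \<in> arcs G")
        case True
        then show ?thesis
          using \<phi>0[OF True] s by (cases b) (auto simp: be T_def \<phi>_def field_simps)
      next
        case False
        then show ?thesis using z by (auto simp: be edge_data_def funs_on_def T_def)
      qed
    qed
    have "\<phi> \<in> vertex_eigenspace G c"
      using z flow s unfolding zT
      by (auto simp: edge_data_def vertex_eigenspace_def funs_on_def \<phi>_def)
    then show "z \<in> T ` vertex_eigenspace G c" using zT by blast
  qed
  then show ?thesis
    using fs_fs.dim_image_inj_on[OF lin subspace_vertex_eigenspace inj] by simp
qed

text \<open>The vertex function alternates and so is zero; what remains is an unsigned circulation
  \<open>z (False, _)\<close>. The parameter \<open>r\<close> is kept general because at the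
  eigenvalue 0 of the anti-standard operator it is the edge length, not 0.\<close>

lemma dim_edge_data_alternating:
  assumes nb: "\<not> bipartite G"
  shows "fs.dim (edge_data G (-1) 0 r) + card (verts G) = card (arcs G)"
proof -
  define T where "T q = (\<lambda>(b, e). if b then 0 else q e)" for q :: "'e \<Rightarrow> complex"
  let ?K = "{q \<in> funs_on (arcs G). divergence G 1 q = 0}"
  interpret div: Vector_Spaces.linear fscale fscale "divergence G 1"
    by (rule linear_divergence)
  have sub: "fs.subspace ?K"
    using subspace_funs_on[of "arcs G"] by (auto simp: fs.subspace_def div.add div.scale)
  have lin: "Vector_Spaces.linear fscale fscale T"
    by (rule linear_fs_fsI) (auto simp: T_def fun_eq_iff fscale_apply)
  have inj: "inj_on T ?K"
  proof (rule inj_onI, rule ext)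
    fix q q' e assume "T q = T q'"
    then have "T q (False, e) = T q' (False, e)" by simp
    then show "q e = q' e" by (simp add: T_def)
  qed
  have "T ` ?K = edge_data G (-1) 0 r"
  proof (intro equalityI subsetI)
    fix z assume "z \<in> T ` ?K"
    then obtain q where q: "q \<in> ?K" "z = T q" by auto
    have "sum q (outs G v) + sum q (ins G v) = 0" if "v \<in> verts G" for v
    proof -
      have "divergence G 1 q v = 0" using q(1) by simp
      then show ?thesis using that by (simp add: divergence_def)
    qed
    then show "z \<in> edge_data G (-1) 0 r"
      using q by (auto simp: edge_data_def T_def funs_on_def intro!: exI[of _ "\<lambda>_. 0"])
  next
    fix z assume z: "z \<in> edge_data G (-1) 0 r"
    then obtain \<phi> where \<phi>: "\<And>e. e \<in> arcs G \<Longrightarrow> z (True, e) = \<phi> (tail G e)"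
      "\<And>e. e \<in> arcs G \<Longrightarrow> -1 * z (True, e) + 0 * z (False, e) = \<phi> (head G e)"
      by (rule edge_data_vertex_values) blast
    then have "\<phi> (head G e) = - \<phi> (tail G e)" if "e \<in> arcs G" for e
      using that by force
    then have "\<phi> v = 0" if "v \<in> verts G" for v
      using that by (rule alternating_zero[OF nb])
    then have z0: "z (True, e) = 0" for e
      using \<phi>(1)[of e] z by (cases "e \<in> arcs G") (auto simp: edge_data_def funs_on_def)
    define q where "q e = z (False, e)" for e
    have "z = T q"
      using z0 by (auto simp: T_def q_def fun_eq_iff)
    moreover have "q \<in> ?K"
      using z z0 by (auto simp: q_def edge_data_def funs_on_def divergence_def fun_eq_iff)
    ultimately show "z \<in> T ` ?K" by blast
  qed
  then have "fs.dim (edge_data G (-1) 0 r) = fs.dim ?K"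
    using fs_fs.dim_image_inj_on[OF lin sub inj] by simp
  then show ?thesis
    using dim_unsigned_circulations[OF nb] by simp
qed

text \<open>The vertex function is constant by connectedness, and the other component is a signed
  circulation, which gives 1 + (N - n + 1). In the type \<open>'e option\<close> the index
  \<open>None\<close> carries the constant and \<open>Some e\<close> the circulation on
  \<open>e\<close>, so one application of rank-nullity covers both.\<close>

lemma dim_edge_data_constant:
  "fs.dim (edge_data G 1 0 0) + card (verts G) = card (arcs G) + 2"
proof -
  define W :: "('e option \<Rightarrow> complex) set" where
    "W = {p \<in> funs_on (insert None (Some ` arcs G)). divergence G (-1) (p \<circ> Some) = 0}"
  define D where "D p = divergence G (-1) (p \<circ> Some)" for p :: "'e option \<Rightarrow> complex"
  interpret div: Vector_Spaces.linear fscale fscale "divergence G (-1)"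
    by (rule linear_divergence)
  have comp: "(p + p') \<circ> Some = (p \<circ> Some) + (p' \<circ> Some)" "fscale c p \<circ> Some = fscale c (p \<circ> Some)"
    for p p' :: "'e option \<Rightarrow> complex" and c
    by (auto simp: fun_eq_iff fscale_apply)
  have linD: "Vector_Spaces.linear fscale fscale D"
    by (rule linear_fs_fsI) (simp_all add: D_def comp div.add div.scale)
  interpret D: Vector_Spaces.linear fscale fscale D by (rule linD)
  have fin: "finite (insert None (Some ` arcs G))" by simp
  have imgD: "D ` funs_on (insert None (Some ` arcs G)) = divergence G (-1) ` funs_on (arcs G)"
  proof (intro equalityI subsetI)
    fix f assume "f \<in> D ` funs_on (insert None (Some ` arcs G))"
    then show "f \<in> divergence G (-1) ` funs_on (arcs G)"
      by (auto simp: D_def funs_on_def intro!: imageI)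
  next
    fix f assume "f \<in> divergence G (-1) ` funs_on (arcs G)"
    then obtain q where q: "q \<in> funs_on (arcs G)" "f = divergence G (-1) q" by auto
    define p where "p x = (case x of None \<Rightarrow> 0 | Some e \<Rightarrow> q e)" for x
    have "p \<circ> Some = q" by (auto simp: p_def)
    moreover have "p \<in> funs_on (insert None (Some ` arcs G))"
      using q(1) by (auto simp: p_def funs_on_def split: option.splits)
    ultimately show "f \<in> D ` funs_on (insert None (Some ` arcs G))"
      using q(2) by (auto simp: D_def intro!: image_eqI[of _ _ p])
  qed
  have ne: "verts G \<noteq> {}" using card_verts_pos by auto
  have W: "W = {p \<in> funs_on (insert None (Some ` arcs G)). D p = 0}"
    by (simp add: W_def D_def)
  have "card (insert None (Some ` arcs G)) = fs.dim W + (card (verts G) - 1)"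
    using fs_fs.dim_kernel_plus_dim_image[OF linD subspace_funs_on finite_imageI[OF fin]
        funs_on_subset_span[OF fin]]
    unfolding imgD divergence_image_signed W dim_funs_on_sum_zero[OF finite_verts ne] dim_funs_on[OF fin] .
  moreover have "card (insert None (Some ` arcs G)) = card (arcs G) + 1"
    by (subst card_insert_disjoint) (auto simp: card_image)
  ultimately have dimW: "fs.dim W + card (verts G) = card (arcs G) + 2"
    using card_verts_pos by simp
  define T where "T p = (\<lambda>(b, e). if e \<in> arcs G then if b then p None else p (Some e) else 0)"
    for p :: "'e option \<Rightarrow> complex"
  have sub: "fs.subspace W"
    using subspace_funs_on[of "insert None (Some ` arcs G)"]
    by (auto simp: W_def D_def[symmetric] fs.subspace_def D.add D.scale)
  have lin: "Vector_Spaces.linear fscale fscale T"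
    by (rule linear_fs_fsI) (auto simp: T_def fun_eq_iff fscale_apply)
  have off: "p (Some e) = 0" if "p \<in> W" "e \<notin> arcs G" for p e
  proof -
    have "Some e \<notin> insert None (Some ` arcs G)" using that(2) by auto
    then show ?thesis using that(1) unfolding W_def funs_on_def by blast
  qed
  have inj: "inj_on T W"
  proof (rule inj_onI)
    fix p p' assume *: "p \<in> W" "p' \<in> W" "T p = T p'"
    obtain e0 where "e0 \<in> arcs G" using arcs_nonempty by auto
    then have "p None = p' None"
      using fun_cong[OF *(3), of "(True, e0)"] by (simp add: T_def)
    moreover have "p (Some e) = p' (Some e)" for e
      using fun_cong[OF *(3), of "(False, e)"] *(1,2)
      by (cases "e \<in> arcs G") (simp add: T_def, simp add: off)
    ultimately show "p = p'"
      by (metis ext option.exhaust)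
  qed
  have "T ` W = edge_data G 1 0 0"
  proof (intro equalityI subsetI)
    fix z assume "z \<in> T ` W"
    then obtain p where p: "p \<in> W" "z = T p" by auto
    have "(\<Sum>e\<in>outs G v. z (False, e)) + (\<Sum>e\<in>ins G v. 0 * z (True, e) - 1 * z (False, e)) = 0"
      if v: "v \<in> verts G" for v
    proof -
      have "(\<Sum>e\<in>outs G v. z (False, e)) = sum (p \<circ> Some) (outs G v)"
        "(\<Sum>e\<in>ins G v. z (False, e)) = sum (p \<circ> Some) (ins G v)"
        by (rule sum.cong; auto simp: p T_def outs_def ins_def)+
      moreover have "divergence G (-1) (p \<circ> Some) v = 0"
        using p by (simp add: W_def)
      ultimately show ?thesis using v by (simp add: divergence_def sum_negf)
    qed
    then show "z \<in> edge_data G 1 0 0"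
      by (auto simp: edge_data_def p T_def funs_on_def intro!: exI[of _ "\<lambda>_. p None"])
  next
    fix z assume z: "z \<in> edge_data G 1 0 0"
    then obtain \<phi> where \<phi>: "\<And>e. e \<in> arcs G \<Longrightarrow> z (True, e) = \<phi> (tail G e)"
      "\<And>e. e \<in> arcs G \<Longrightarrow> 1 * z (True, e) + 0 * z (False, e) = \<phi> (head G e)"
      by (rule edge_data_vertex_values) blast
    then have hc: "\<phi> (head G e) = \<phi> (tail G e)" if "e \<in> arcs G" for e
      using that by force
    obtain v0 where v0: "v0 \<in> verts G"
      using card_verts_pos by fastforce
    have "\<phi> v = \<phi> v0" if "v \<in> verts G" for v
      by (rule const_on_verts[OF hc v0 that])
    then have zt: "z (True, e) = \<phi> v0" if "e \<in> arcs G" for e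
      using \<phi>(1)[OF that] that by simp
    define p where "p x = (case x of None \<Rightarrow> \<phi> v0 | Some e \<Rightarrow> z (False, e))" for x
    have "z = T p"
    proof
      fix be :: "bool \<times> 'e"
      obtain b e where be: "be = (b, e)" by force
      show "z be = T p be"
        using zt[of e] z by (cases "e \<in> arcs G"; cases b) (auto simp: be T_def p_def edge_data_def funs_on_def)
    qed
    moreover have "p \<in> W"
    proof -
      have "p \<circ> Some = (\<lambda>e. z (False, e))" by (auto simp: p_def)
      moreover have "sum (\<lambda>e. z (False, e)) (outs G v) - sum (\<lambda>e. z (False, e)) (ins G v) = 0"
        if "v \<in> verts G" for v
        using z that by (simp add: edge_data_def sum_negf)
      ultimately have "divergence G (-1) (p \<circ> Some) = 0"
        by (simp add: divergence_def fun_eq_iff)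
      moreover have "p \<in> funs_on (insert None (Some ` arcs G))"
        using z unfolding funs_on_def edge_data_def p_def by (auto simp: image_iff split: option.split)
      ultimately show ?thesis
        by (simp add: W_def)
    qed
    ultimately show "z \<in> T ` W" by blast
  qed
  then have "fs.dim (edge_data G 1 0 0) = fs.dim W"
    using fs_fs.dim_image_inj_on[OF lin sub inj] by simp
  then show ?thesis using dimW by simp
qed

end

section \<open>Absolute continuity and the differential equation\<close>

text \<open>
  The gauge keeps the intervals tagged in the exceptional null set inside an open set of small
  measure, where absolute continuity controls the increments.
\<close>

lemma abs_continuous_zero_deriv_imp_const:
  assumes ac: "abs_continuous 0 l u"
    and ae: "AE x in lebesgue_on {0..l}. (u has_vector_derivative 0) (at x within {0..l})"
    and x: "0 \<le> x" "x \<le> l"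
  shows "u x = u 0"
proof -
  obtain N where N: "N \<in> null_sets (lebesgue_on {0..l})"
    "{t \<in> space (lebesgue_on {0..l}). \<not> (u has_vector_derivative 0) (at t within {0..l})} \<subseteq> N"
    using ae by (auto simp: eventually_ae_filter)
  have N0: "N \<in> null_sets lebesgue"
    using N(1) by (auto simp: null_sets_restrict_space)
  have deriv: "(u has_vector_derivative 0) (at t within {0..l})" if "t \<in> {0..l}" "t \<notin> N" for t
    using N(2) that by auto
  \<comment> \<open>Intervals tagged outside \<open>N\<close> contribute at most
    \<open>\<epsilon> * x\<close> since the derivative vanishes at their tags; those tagged inside
    \<open>N\<close> contribute less than \<open>\<epsilon>\<close> by absolute continuity.\<close>
  have bound: "norm (u x - u 0) \<le> \<epsilon> * (x + 1)" if \<epsilon>: "0 < \<epsilon>" for \<epsilon>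
  proof -
    obtain \<delta> where \<delta>: "0 < \<delta>" "\<And>D T. D division_of T \<Longrightarrow> T \<subseteq> {0..l} \<Longrightarrow> (\<Sum>K\<in>D. Sup K - Inf K) < \<delta> \<Longrightarrow>
        (\<Sum>K\<in>D. norm (u (Sup K) - u (Inf K))) < \<epsilon>"
      using ac \<epsilon> unfolding abs_continuous_def by meson
    obtain U where U: "open U" "N \<subseteq> U" "U - N \<in> lmeasurable" "emeasure lebesgue (U - N) < ennreal \<delta>"
      using sets_lebesgue_outer_open[OF _ \<delta>(1), of N] N0 by auto
    have Um: "U \<in> lmeasurable"
      using U(2,3) N0 by (metis Diff_partition fmeasurable.Un fmeasurableI_null_sets)
    have "emeasure lebesgue U = emeasure lebesgue (U - N)"
      using U(1) N0 by (metis emeasure_Diff_null_set borel_open sets_completionI_sets sets_lborel)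
    then have Ud: "measure lebesgue U < \<delta>"
      using U(4) Um \<delta>(1) by (metis emeasure_eq_measure2 ennreal_less_iff measure_nonneg)
    have ex: "\<exists>r>0. (t \<in> N \<longrightarrow> ball t r \<subseteq> U) \<and>
        (t \<in> {0..l} - N \<longrightarrow> (\<forall>y\<in>{0..l}. \<bar>y - t\<bar> < r \<longrightarrow> norm (u y - u t) \<le> \<epsilon> * \<bar>y - t\<bar>))" for t
    proof (cases "t \<in> N")
      case True
      then obtain r where "r > 0" "ball t r \<subseteq> U"
        using U(1,2) by (metis openE subsetD)
      then show ?thesis using True by blast
    next
      case False
      show ?thesis
      proof (cases "t \<in> {0..l}")
        case True
        then have "(u has_derivative (\<lambda>h. 0)) (at t within {0..l})"
          using deriv[OF True False] by (simp add: has_vector_derivative_def)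
        then obtain r where "r > 0" "\<forall>y\<in>{0..l}. norm (y - t) < r \<longrightarrow> norm (u y - u t - 0) \<le> \<epsilon> * norm (y - t)"
          using \<epsilon> unfolding has_derivative_within_alt by meson
        then show ?thesis using False by (auto intro!: exI[of _ r])
      next
        case False
        then show ?thesis using \<open>t \<notin> N\<close> by (auto intro: exI[of _ 1])
      qed
    qed
    then obtain r where r: "\<And>t. 0 < r t" "\<And>t. t \<in> N \<Longrightarrow> ball t (r t) \<subseteq> U"
      "\<And>t y. t \<in> {0..l} \<Longrightarrow> t \<notin> N \<Longrightarrow> y \<in> {0..l} \<Longrightarrow> \<bar>y - t\<bar> < r t \<Longrightarrow> norm (u y - u t) \<le> \<epsilon> * \<bar>y - t\<bar>"
      by (metis Diff_iff)
    have "gauge (\<lambda>t. ball t (r t))"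
      using r(1) by (simp add: gauge_def)
    then obtain p where p: "p tagged_division_of {0..x}" "(\<lambda>t. ball t (r t)) fine p"
      using fine_division_exists_real by blast
    note pD = tagged_division_ofD[OF p(1)]
    have K: "\<exists>c d. K = {c..d} \<and> 0 \<le> c \<and> c \<le> t \<and> t \<le> d \<and> d \<le> x \<and> Inf K = c \<and> Sup K = d \<and> K \<subseteq> ball t (r t)"
      if "(t, K) \<in> p" for t K
    proof -
      note tK = that
      obtain c d where cd: "K = cbox c d" using pD(4)[OF tK] by blast
      then have "K = {c..d}" "t \<in> {c..d}" "{c..d} \<subseteq> {0..x}" "K \<subseteq> ball t (r t)"
        using pD(2,3)[OF tK] p(2) tK by (auto simp: fine_def)
      then show ?thesis by (intro exI[of _ c] exI[of _ d]) auto
    qed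
    define p1 where "p1 = {tK \<in> p. fst tK \<notin> N}"
    define p2 where "p2 = {tK \<in> p. fst tK \<in> N}"
    have fin: "finite p1" "finite p2" using pD(1) by (auto simp: p1_def p2_def)
    have p12: "p = p1 \<union> p2" "p1 \<inter> p2 = {}" by (auto simp: p1_def p2_def)
    let ?inc = "\<lambda>(t, K). u (Sup K) - u (Inf K)"
    have "norm (sum ?inc p1) \<le> (\<Sum>(t, K)\<in>p1. \<epsilon> * (Sup K - Inf K))"
    proof (rule sum_norm_le, clarify)
      fix t K assume tK: "(t, K) \<in> p1"
      then have "(t, K) \<in> p" "t \<notin> N" by (auto simp: p1_def)
      then obtain c d where cd: "K = {c..d}" "0 \<le> c" "c \<le> t" "t \<le> d" "d \<le> x" "Inf K = c" "Sup K = d"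
        "K \<subseteq> ball t (r t)"
        using K by blast
      then have "c \<in> K" "d \<in> K" by auto
      then have "c \<in> ball t (r t)" "d \<in> ball t (r t)" using cd(8) by blast+
      then have "norm (u d - u t) \<le> \<epsilon> * \<bar>d - t\<bar>" "norm (u c - u t) \<le> \<epsilon> * \<bar>c - t\<bar>"
        using cd(2-5) x \<open>t \<notin> N\<close> r(3)[of t d] r(3)[of t c]
        by (simp_all add: dist_real_def abs_minus_commute)
      moreover have "norm (u d - u c) \<le> norm (u d - u t) + norm (u c - u t)"
        using norm_triangle_ineq4[of "u d - u t" "u c - u t"] by simp
      moreover have "\<epsilon> * \<bar>d - t\<bar> + \<epsilon> * \<bar>c - t\<bar> = \<epsilon> * (d - c)"
        using cd by (simp add: algebra_simps)
      ultimately show "norm (u (Sup K) - u (Inf K)) \<le> \<epsilon> * (Sup K - Inf K)"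
        unfolding cd(6,7) by linarith
    qed
    also have "\<dots> \<le> (\<Sum>(t, K)\<in>p. \<epsilon> * (Sup K - Inf K))"
    proof (rule sum_mono2)
      fix tK assume "tK \<in> p - p1"
      then obtain t K' where "tK = (t, K')" "(t, K') \<in> p" by (cases tK) auto
      then show "0 \<le> (case tK of (t, K) \<Rightarrow> \<epsilon> * (Sup K - Inf K))"
        using K[of t K'] \<epsilon> by auto
    qed (use pD(1) in \<open>auto simp: p1_def\<close>)
    also have "\<dots> = \<epsilon> * (\<Sum>(t, K)\<in>p. Sup K - Inf K)"
      by (simp add: sum_distrib_left case_prod_unfold)
    also have "\<dots> = \<epsilon> * x"
      using additive_tagged_division_1[OF x(1) p(1), of "\<lambda>t. t"] by simp
    finally have part1: "norm (sum ?inc p1) \<le> \<epsilon> * x" .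
    have "p2 tagged_partial_division_of {0..x}"
      using p(1) unfolding tagged_division_of_def
      by (auto intro: tagged_partial_division_subset simp: p2_def)
    then have tag2: "p2 tagged_division_of \<Union>(snd ` p2)" and div2: "(snd ` p2) division_of \<Union>(snd ` p2)"
      by (auto intro: tagged_partial_division_of_Union_self partial_division_of_tagged_division)
    have snd2: "\<exists>t. t \<in> N \<and> (t, K) \<in> p" if "K \<in> snd ` p2" for K
      using that by (auto simp: p2_def)
    have "(\<Sum>K\<in>snd ` p2. Sup K - Inf K) = (\<Sum>K\<in>snd ` p2. measure lebesgue K)"
    proof (rule sum.cong)
      fix K' assume "K' \<in> snd ` p2"
      then obtain t where "(t, K') \<in> p" using snd2 by blast
      then obtain c d where "K' = {c..d}" "c \<le> d" using K[of t K'] by force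
      then show "Sup K' - Inf K' = measure lebesgue K'" by simp
    qed simp
    also have "\<dots> = measure lebesgue (\<Union>(snd ` p2))"
      by (rule content_division[OF div2])
    also have "\<dots> \<le> measure lebesgue U"
    proof (rule measure_mono_fmeasurable)
      show "\<Union>(snd ` p2) \<subseteq> U"
      proof
        fix y assume "y \<in> \<Union>(snd ` p2)"
        then obtain t K' where "t \<in> N" "(t, K') \<in> p" "y \<in> K'" using snd2 by blast
        then show "y \<in> U" using K[of t K'] r(2)[of t] by blast
      qed
      show "\<Union>(snd ` p2) \<in> sets lebesgue"
        using lmeasurable_division[OF div2] by auto
    qed (fact Um)
    finally have "(\<Sum>K\<in>snd ` p2. Sup K - Inf K) < \<delta>" using Ud by simp
    moreover have "\<Union>(snd ` p2) \<subseteq> {0..l}"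
    proof
      fix y assume "y \<in> \<Union>(snd ` p2)"
      then obtain t K' where "(t, K') \<in> p" "y \<in> K'" using snd2 by blast
      then have "y \<in> {0..x}" using pD(3) by blast
      then show "y \<in> {0..l}" using x by auto
    qed
    ultimately have small: "(\<Sum>K\<in>snd ` p2. norm (u (Sup K) - u (Inf K))) < \<epsilon>"
      using \<delta>(2)[OF div2] by blast
    \<comment> \<open>\<open>Sup\<close> and \<open>Inf\<close> of the empty set carry no
      information, while passing from tagged pairs to the set of intervals requires every degenerate
      box, the empty one included, to contribute zero.\<close>
    define d where "d K = (if K = {} then 0 else norm (u (Sup K) - u (Inf K)))" for K
    have "(\<Sum>(t, K)\<in>p2. d K) = (\<Sum>K\<in>snd ` p2. d K)"
    proof (rule sum.over_tagged_division_lemma[OF tag2])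
      fix a b :: real assume "box a b = {}"
      then show "d (cbox a b) = 0"
        by (cases "a = b") (auto simp: d_def)
    qed
    also have "\<dots> = (\<Sum>K\<in>snd ` p2. norm (u (Sup K) - u (Inf K)))"
    proof (rule sum.cong)
      fix K' assume "K' \<in> snd ` p2"
      then obtain t where "(t, K') \<in> p" using snd2 by blast
      then have "K' \<noteq> {}" using pD(2) by blast
      then show "d K' = norm (u (Sup K') - u (Inf K'))" by (simp add: d_def)
    qed simp
    finally have "(\<Sum>(t, K)\<in>p2. d K) < \<epsilon>" using small by simp
    moreover have "norm (sum ?inc p2) \<le> (\<Sum>(t, K)\<in>p2. d K)"
    proof (rule sum_norm_le, clarify)
      fix t K' assume "(t, K') \<in> p2"
      then have "K' \<noteq> {}" using pD(2) by (auto simp: p2_def)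
      then show "norm (u (Sup K') - u (Inf K')) \<le> d K'" by (simp add: d_def)
    qed
    ultimately have part2: "norm (sum ?inc p2) < \<epsilon>" by linarith
    have "u x - u 0 = sum ?inc p"
      using additive_tagged_division_1[OF x(1) p(1), of u] by simp
    also have "\<dots> = sum ?inc p1 + sum ?inc p2"
      unfolding p12(1) by (rule sum.union_disjoint[OF fin p12(2)])
    finally have "norm (u x - u 0) \<le> norm (sum ?inc p1) + norm (sum ?inc p2)"
      by (simp add: norm_triangle_ineq)
    then show ?thesis using part1 part2 by (simp add: algebra_simps)
  qed
  have "norm (u x - u 0) \<le> 0"
  proof (rule field_le_epsilon)
    fix e :: real assume "0 < e"
    then show "norm (u x - u 0) \<le> 0 + e"
      using bound[of "e / (x + 1)"] x by simp
  qed
  then show ?thesis by simp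
qed

lemma division_endpoints:
  fixes K :: "real set"
  assumes "D division_of T" "T \<subseteq> {a..b}" "K \<in> D"
  shows "Inf K \<le> Sup K" "Inf K \<in> {a..b}" "Sup K \<in> {a..b}"
proof -
  obtain c d where cd: "K = cbox c d" using assms division_ofD(4) by blast
  have "K \<noteq> {}" "K \<subseteq> {a..b}" using assms division_ofD(2,3) by blast+
  then show "Inf K \<le> Sup K" "Inf K \<in> {a..b}" "Sup K \<in> {a..b}"
    using cd by auto
qed

lemma abs_continuous_diff:
  assumes "abs_continuous a b f" "abs_continuous a b g"
  shows "abs_continuous a b (\<lambda>x. f x - g x)"
  unfolding abs_continuous_def
proof (intro allI impI)
  fix \<epsilon> :: real assume "0 < \<epsilon>"
  then have e2: "0 < \<epsilon> / 2" by simp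
  obtain d1 where d1: "d1 > 0" "\<And>D T. D division_of T \<and> T \<subseteq> {a..b} \<and> (\<Sum>K\<in>D. Sup K - Inf K) < d1 \<Longrightarrow>
      (\<Sum>K\<in>D. norm (f (Sup K) - f (Inf K))) < \<epsilon> / 2"
    using assms(1) e2 unfolding abs_continuous_def by meson
  obtain d2 where d2: "d2 > 0" "\<And>D T. D division_of T \<and> T \<subseteq> {a..b} \<and> (\<Sum>K\<in>D. Sup K - Inf K) < d2 \<Longrightarrow>
      (\<Sum>K\<in>D. norm (g (Sup K) - g (Inf K))) < \<epsilon> / 2"
    using assms(2) e2 unfolding abs_continuous_def by meson
  show "\<exists>\<delta>>0. \<forall>D T. D division_of T \<and> T \<subseteq> {a..b} \<and> (\<Sum>K\<in>D. Sup K - Inf K) < \<delta> \<longrightarrow>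
      (\<Sum>K\<in>D. norm (f (Sup K) - g (Sup K) - (f (Inf K) - g (Inf K)))) < \<epsilon>"
  proof (intro exI[of _ "min d1 d2"] conjI allI impI)
    fix D T assume D: "D division_of T \<and> T \<subseteq> {a..b} \<and> (\<Sum>K\<in>D. Sup K - Inf K) < min d1 d2"
    have "(\<Sum>K\<in>D. norm (f (Sup K) - g (Sup K) - (f (Inf K) - g (Inf K))))
        \<le> (\<Sum>K\<in>D. norm (f (Sup K) - f (Inf K)) + norm (g (Sup K) - g (Inf K)))"
    proof (rule sum_mono)
      fix K
      have "f (Sup K) - g (Sup K) - (f (Inf K) - g (Inf K)) = (f (Sup K) - f (Inf K)) - (g (Sup K) - g (Inf K))"
        by simp
      then show "norm (f (Sup K) - g (Sup K) - (f (Inf K) - g (Inf K)))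
          \<le> norm (f (Sup K) - f (Inf K)) + norm (g (Sup K) - g (Inf K))"
        by (metis norm_triangle_ineq4)
    qed
    also have "\<dots> < \<epsilon> / 2 + \<epsilon> / 2"
      unfolding sum.distrib using D by (intro add_strict_mono d1(2) d2(2)) auto
    finally show "(\<Sum>K\<in>D. norm (f (Sup K) - g (Sup K) - (f (Inf K) - g (Inf K)))) < \<epsilon>" by simp
  qed (use d1 d2 in simp)
qed

text \<open>The derivative is bounded on the compact interval, so \<open>g\<close> is
  Lipschitz.\<close>

lemma abs_continuous_C1:
  assumes g: "\<And>x. x \<in> {0..l} \<Longrightarrow> (g has_vector_derivative g' x) (at x within {0..l})"
    and g': "continuous_on {0..l} g'"
  shows "abs_continuous 0 l g"
proof -
  have "bounded (g' ` {0..l})"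
    by (rule compact_imp_bounded[OF compact_continuous_image[OF g']]) simp
  then obtain L where L: "L > 0" "\<And>x. x \<in> {0..l} \<Longrightarrow> norm (g' x) \<le> L"
    unfolding bounded_pos by auto
  have lip: "norm (g y - g x) \<le> L * \<bar>y - x\<bar>" if "x \<in> {0..l}" "y \<in> {0..l}" for x y
  proof -
    have "norm (g y - g x) \<le> L * norm (y - x)"
    proof (rule differentiable_bound[where S = "{0..l}" and f' = "\<lambda>x h. h *\<^sub>R g' x"])
      show "(g has_derivative (\<lambda>h. h *\<^sub>R g' x)) (at x within {0..l})" if "x \<in> {0..l}" for x
        using g[OF that] by (simp add: has_vector_derivative_def)
      show "onorm (\<lambda>h. h *\<^sub>R g' x) \<le> L" if "x \<in> {0..l}" for x
        using L(2)[OF that] by (intro onorm_le) (auto simp: mult.commute[of L] intro: mult_left_mono)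
    qed (use that in auto)
    then show ?thesis by simp
  qed
  show ?thesis
    unfolding abs_continuous_def
  proof (intro allI impI)
    fix \<epsilon> :: real assume \<epsilon>: "0 < \<epsilon>"
    show "\<exists>\<delta>>0. \<forall>D T. D division_of T \<and> T \<subseteq> {0..l} \<and> (\<Sum>K\<in>D. Sup K - Inf K) < \<delta> \<longrightarrow>
        (\<Sum>K\<in>D. norm (g (Sup K) - g (Inf K))) < \<epsilon>"
    proof (intro exI[of _ "\<epsilon> / L"] conjI allI impI)
      fix D T assume D: "D division_of T \<and> T \<subseteq> {0..l} \<and> (\<Sum>K\<in>D. Sup K - Inf K) < \<epsilon> / L"
      have "(\<Sum>K\<in>D. norm (g (Sup K) - g (Inf K))) \<le> (\<Sum>K\<in>D. L * (Sup K - Inf K))"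
      proof (rule sum_mono)
        fix K assume "K \<in> D"
        then have "Inf K \<le> Sup K" "Inf K \<in> {0..l}" "Sup K \<in> {0..l}"
          using division_endpoints[of D T 0 l K] D by auto
        then show "norm (g (Sup K) - g (Inf K)) \<le> L * (Sup K - Inf K)"
          using lip[of "Inf K" "Sup K"] by simp
      qed
      also have "\<dots> < \<epsilon>"
        unfolding sum_distrib_left[symmetric] using D L(1) by (simp only: pos_less_divide_eq mult.commute)
      finally show "(\<Sum>K\<in>D. norm (g (Sup K) - g (Inf K))) < \<epsilon>" .
    qed (use \<epsilon> L in simp)
  qed
qed

text \<open>The difference of \<open>g\<close> and an antiderivative of \<open>h\<close> is
  absolutely continuous with derivative zero almost everywhere, hence constant. With
  \<open>g\<close> the derivative of an eigenfunction and \<open>h\<close> a multiple of that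
  function, this gives the differential equation at every point.\<close>

lemma abs_continuous_deriv_continuous:
  assumes ac: "abs_continuous 0 l g" and h: "continuous_on {0..l} h"
    and ae: "AE x in lebesgue_on {0..l}. (g has_vector_derivative h x) (at x within {0..l})"
    and t: "t \<in> {0..l}"
  shows "(g has_vector_derivative h t) (at t within {0..l})"
proof -
  obtain H where H: "\<And>x. x \<in> {0..l} \<Longrightarrow> (H has_vector_derivative h x) (at x within {0..l})"
    using antiderivative_continuous[OF h] by blast
  have acH: "abs_continuous 0 l (\<lambda>x. g x - H x)"
    by (intro abs_continuous_diff[OF ac] abs_continuous_C1[OF H h])
  have "AE x in lebesgue_on {0..l}. ((\<lambda>x. g x - H x) has_vector_derivative 0) (at x within {0..l})"
    using ae
  proof (rule AE_mp, intro AE_I2 impI)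
    fix x assume "x \<in> space (lebesgue_on {0..l})" "(g has_vector_derivative h x) (at x within {0..l})"
    then show "((\<lambda>x. g x - H x) has_vector_derivative 0) (at x within {0..l})"
      using has_vector_derivative_diff[OF _ H[of x], of g "h x"] by simp
  qed
  then have const: "g x = H x + (g 0 - H 0)" if "x \<in> {0..l}" for x
    using abs_continuous_zero_deriv_imp_const[OF acH _, of x] that by (simp add: algebra_simps)
  have "((\<lambda>x. H x + (g 0 - H 0)) has_vector_derivative h t) (at t within {0..l})"
    using has_vector_derivative_add[OF H[OF t] has_vector_derivative_const] by simp
  then show ?thesis
    by (rule has_vector_derivative_transform[OF t const, rotated]) (use const in auto)
qed

text \<open>The solutions of \<open>- y'' = x y\<close> with initial data \<open>(1, 0)\<close> and \<open>(0, 1)\<close>.\<close>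

definition csol :: "real \<Rightarrow> real \<Rightarrow> real" where
  "csol x t = (if x < 0 then cosh (sqrt (- x) * t) else cos (sqrt x * t))"

definition ssol :: "real \<Rightarrow> real \<Rightarrow> real" where
  "ssol x t = (if x = 0 then t else if x < 0 then sinh (sqrt (- x) * t) / sqrt (- x)
     else sin (sqrt x * t) / sqrt x)"

lemma csol_0 [simp]: "csol x 0 = 1" and ssol_0 [simp]: "ssol x 0 = 0"
  by (auto simp: csol_def ssol_def)

lemma csol_has_real_derivative: "(csol x has_real_derivative - x * ssol x t) (at t within S)"
proof -
  consider "x < 0" | "x = 0" | "x > 0" by linarith
  then show ?thesis
  proof cases
    case 1
    then have "sinh (sqrt (- x) * t) * sqrt (- x) = sqrt (- x) * sqrt (- x) * (sinh (sqrt (- x) * t) / sqrt (- x))"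
      by (simp del: real_sqrt_mult_self)
    also have "\<dots> = - x * ssol x t"
      using 1 by (simp add: ssol_def)
    finally have "sinh (sqrt (- x) * t) * sqrt (- x) = - x * ssol x t" .
    moreover have "csol x = (\<lambda>t. cosh (sqrt (- x) * t))"
      using 1 by (auto simp: csol_def)
    ultimately show ?thesis
      by (auto intro!: derivative_eq_intros)
  next
    case 2
    then show ?thesis by (simp add: csol_def[abs_def])
  next
    case 3
    then have "- sin (sqrt x * t) * sqrt x = - (sqrt x * sqrt x) * (sin (sqrt x * t) / sqrt x)"
      by (simp del: real_sqrt_mult_self)
    also have "\<dots> = - x * ssol x t"
      using 3 by (simp add: ssol_def)
    finally have "- sin (sqrt x * t) * sqrt x = - x * ssol x t" .
    moreover have "csol x = (\<lambda>t. cos (sqrt x * t))"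
      using 3 by (auto simp: csol_def)
    ultimately show ?thesis
      by (auto intro!: derivative_eq_intros)
  qed
qed

lemma ssol_has_real_derivative: "(ssol x has_real_derivative csol x t) (at t within S)"
proof -
  consider "x < 0" | "x = 0" | "x > 0" by linarith
  then show ?thesis
  proof cases
    case 1
    have "((\<lambda>t. sinh (sqrt (- x) * t) / sqrt (- x)) has_real_derivative cosh (sqrt (- x) * t)) (at t within S)"
      using 1 by (auto intro!: derivative_eq_intros simp: mult.assoc)
    moreover have "ssol x = (\<lambda>t. sinh (sqrt (- x) * t) / sqrt (- x))"
      using 1 by (auto simp: ssol_def)
    ultimately show ?thesis
      using 1 by (simp add: csol_def)
  next
    case 2
    then show ?thesis by (auto simp: ssol_def[abs_def] csol_def intro!: derivative_eq_intros)
  next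
    case 3
    have "((\<lambda>t. sin (sqrt x * t) / sqrt x) has_real_derivative cos (sqrt x * t)) (at t within S)"
      using 3 by (auto intro!: derivative_eq_intros simp: mult.assoc)
    moreover have "ssol x = (\<lambda>t. sin (sqrt x * t) / sqrt x)"
      using 3 by (auto simp: ssol_def)
    ultimately show ?thesis
      using 3 by (simp add: csol_def)
  qed
qed

text \<open>The left side is the Wronskian of the two solutions. It supplies the determinant
  relation for the transport along an edge.\<close>

lemma csol_ssol_pythagoras: "(csol x t)\<^sup>2 + x * (ssol x t)\<^sup>2 = 1"
proof -
  consider "x < 0" | "x = 0" | "x > 0" by linarith
  then show ?thesis
  proof cases
    case 1
    then show ?thesis
      using cosh_square_eq[of "sqrt (- x) * t"]
      by (simp add: csol_def ssol_def power_divide field_simps)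
  qed (simp_all add: csol_def ssol_def power_divide)
qed

section \<open>The initial value problem on a single edge\<close>

definition edge_solution :: "real \<Rightarrow> complex \<Rightarrow> complex \<Rightarrow> real \<Rightarrow> complex" where
  "edge_solution x A B t = csol x t *\<^sub>R A + ssol x t *\<^sub>R B"

text \<open>Differentiation acts on initial data by (A, B) to (B, -x A), so this one rule also
  yields second derivatives.\<close>

lemma edge_solution_has_vector_derivative:
  "(edge_solution x A B has_vector_derivative edge_solution x B (- complex_of_real x * A) t) (at t within S)"
proof -
  have "((\<lambda>t. csol x t *\<^sub>R A + ssol x t *\<^sub>R B) has_vector_derivative
      (csol x t *\<^sub>R 0 + (- x * ssol x t) *\<^sub>R A) + (ssol x t *\<^sub>R 0 + csol x t *\<^sub>R B)) (at t within S)"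
    by (intro has_vector_derivative_add has_vector_derivative_scaleR csol_has_real_derivative
        ssol_has_real_derivative has_vector_derivative_const)
  then show ?thesis
    by (simp add: edge_solution_def[abs_def] scaleR_conv_of_real algebra_simps)
qed

lemma edge_solution_unique:
  assumes f: "\<And>t. t \<in> {0..l} \<Longrightarrow> (f has_vector_derivative g t) (at t within {0..l})"
    and g: "\<And>t. t \<in> {0..l} \<Longrightarrow> (g has_vector_derivative - (complex_of_real x * f t)) (at t within {0..l})"
    and t: "t \<in> {0..l}"
  shows "f t = edge_solution x (f 0) (g 0) t"
proof -
  \<comment> \<open>Here \<open>a\<close> and \<open>b\<close> are the data at \<open>t\<close>
    transported back to 0 by the inverse of the transport matrix. For a solution they are constant,
    and transporting them forward again recovers \<open>f t\<close>.\<close>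
  define a where "a t = csol x t *\<^sub>R f t - ssol x t *\<^sub>R g t" for t
  define b where "b t = (x * ssol x t) *\<^sub>R f t + csol x t *\<^sub>R g t" for t
  have "(a has_vector_derivative 0) (at t within {0..l})" if t: "t \<in> {0..l}" for t
  proof -
    have "(a has_vector_derivative
        (csol x t *\<^sub>R g t + (- x * ssol x t) *\<^sub>R f t)
        - (ssol x t *\<^sub>R (- (complex_of_real x * f t)) + csol x t *\<^sub>R g t)) (at t within {0..l})"
      unfolding a_def[abs_def]
      by (intro has_vector_derivative_diff has_vector_derivative_scaleR csol_has_real_derivative
          ssol_has_real_derivative f[OF t] g[OF t])
    then show ?thesis by (simp add: scaleR_conv_of_real algebra_simps)
  qed
  then obtain ca where "\<And>t. t \<in> {0..l} \<Longrightarrow> a t = ca"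
    using has_vector_derivative_zero_constant[of "{0..l}" a] by (metis convex_real_interval(5))
  then have a: "a t = a 0" using t by simp
  have "(b has_vector_derivative 0) (at t within {0..l})" if t: "t \<in> {0..l}" for t
  proof -
    have "((\<lambda>t. x * ssol x t) has_real_derivative x * csol x t) (at t within {0..l})"
      by (intro DERIV_cmult ssol_has_real_derivative)
    then have "(b has_vector_derivative
        ((x * ssol x t) *\<^sub>R g t + (x * csol x t) *\<^sub>R f t)
        + (csol x t *\<^sub>R (- (complex_of_real x * f t)) + (- x * ssol x t) *\<^sub>R g t)) (at t within {0..l})"
      unfolding b_def[abs_def]
      by (intro has_vector_derivative_add has_vector_derivative_scaleR csol_has_real_derivative
          f[OF t] g[OF t])
    then show ?thesis by (simp add: scaleR_conv_of_real algebra_simps)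
  qed
  then obtain cb where "\<And>t. t \<in> {0..l} \<Longrightarrow> b t = cb"
    using has_vector_derivative_zero_constant[of "{0..l}" b] by (metis convex_real_interval(5))
  then have b: "b t = b 0" using t by simp
  have "f t = ((csol x t)\<^sup>2 + x * (ssol x t)\<^sup>2) *\<^sub>R f t"
    by (simp add: csol_ssol_pythagoras)
  also have "\<dots> = csol x t *\<^sub>R a t + ssol x t *\<^sub>R b t"
    by (simp add: a_def b_def scaleR_conv_of_real algebra_simps power2_eq_square)
  also have "\<dots> = edge_solution x (f 0) (g 0) t"
    unfolding a b by (simp add: a_def b_def edge_solution_def)
  finally show ?thesis .
qed

lemma edge_deriv_cong:
  assumes "0 < l" "t \<in> {0..l}" "\<And>t. t \<in> {0..l} \<Longrightarrow> f t = g t"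
    and "(g has_vector_derivative g') (at t within {0..l})"
  shows "(f has_vector_derivative g') (at t within {0..l})" "edge_deriv l f t = g'"
proof -
  show *: "(f has_vector_derivative g') (at t within {0..l})"
    by (rule has_vector_derivative_transform[OF assms(2) _ assms(4)]) (use assms(3) in auto)
  show "edge_deriv l f t = g'"
    unfolding edge_deriv_def
    by (rule vector_derivative_within_closed_interval[OF assms(1,2) *])
qed

lemma square_integrable_continuous:
  assumes "continuous_on {0..l} g"
  shows "square_integrable l g"
proof -
  have "g \<in> borel_measurable (lebesgue_on {0..l})"
    by (rule continuous_imp_measurable_on_sets_lebesgue[OF assms]) simp
  moreover have "continuous_on {0..l} (\<lambda>t. (norm (g t))\<^sup>2)"
    by (intro continuous_intros assms)
  then have "integrable (lebesgue_on {0..l}) (\<lambda>t. (norm (g t))\<^sup>2)"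
    by (rule continuous_imp_integrable_real)
  ultimately show ?thesis by (simp add: square_integrable_def)
qed

text \<open>The extension by zero matches the normalization in \<open>max_domain\<close>, so
  eigenfunctions are equal to functions of this form and not merely equal on the edges.\<close>

definition graph_solution ::
    "('v, 'e) pre_digraph \<Rightarrow> real \<Rightarrow> real \<Rightarrow> ('e \<Rightarrow> complex) \<Rightarrow> ('e \<Rightarrow> complex) \<Rightarrow> 'e \<Rightarrow> real \<Rightarrow> complex" where
  "graph_solution G l x A B = (\<lambda>e t. if e \<in> arcs G \<and> t \<in> {0..l} then edge_solution x (A e) (B e) t else 0)"

section \<open>Eigenfunctions on an equilateral graph and their edge data\<close>

context metric_graph
begin

context
  fixes l
  assumes len_eq: "\<forall>e\<in>arcs G. len e = l"
begin

lemma len_eqD: "e \<in> arcs G \<Longrightarrow> len e = l"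
  using len_eq by blast

lemma l_pos: "0 < l"
  using arcs_nonempty len_pos len_eqD by force

lemma graph_solution_deriv:
  assumes "e \<in> arcs G" "t \<in> {0..l}"
  shows "(graph_solution G l x A B e has_vector_derivative edge_solution x (B e) (- complex_of_real x * A e) t) (at t within {0..l})"
    "edge_deriv l (graph_solution G l x A B e) t = edge_solution x (B e) (- complex_of_real x * A e) t"
  by (rule edge_deriv_cong[OF l_pos assms(2) _ edge_solution_has_vector_derivative];
      simp add: graph_solution_def assms(1))+

lemma edge_deriv_graph_solution_deriv:
  assumes "e \<in> arcs G" "t \<in> {0..l}"
  shows "(edge_deriv l (graph_solution G l x A B e) has_vector_derivative
      - (complex_of_real x * graph_solution G l x A B e t)) (at t within {0..l})"
proof -
  have "(edge_deriv l (graph_solution G l x A B e) has_vector_derivative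
      edge_solution x (- complex_of_real x * A e) (- complex_of_real x * B e) t) (at t within {0..l})"
    by (rule edge_deriv_cong(1)[OF l_pos assms(2) graph_solution_deriv(2)[OF assms(1)]
          edge_solution_has_vector_derivative])
  moreover have "edge_solution x (- complex_of_real x * A e) (- complex_of_real x * B e) t
      = - (complex_of_real x * graph_solution G l x A B e t)"
    using assms by (simp add: graph_solution_def edge_solution_def scaleR_conv_of_real algebra_simps)
  ultimately show ?thesis by simp
qed

lemma continuous_edge_solution: "continuous_on S (edge_solution x a b)"
  by (rule differentiable_imp_continuous_on)
    (auto simp: differentiable_on_def intro!: differentiableI_vector[OF edge_solution_has_vector_derivative])

lemma graph_solution_in_max_domain: "graph_solution G l x A B \<in> max_domain G len"
proof -
  let ?F = "graph_solution G l x A B"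
  have "square_integrable l (?F e) \<and> abs_continuous 0 l (?F e) \<and>
      (\<forall>t\<in>{0..l}. ?F e differentiable (at t within {0..l})) \<and>
      abs_continuous 0 l (edge_deriv l (?F e)) \<and>
      (\<exists>h. has_second_deriv l (?F e) h \<and> square_integrable l h)" if e: "e \<in> arcs G" for e
  proof (intro conjI)
    note d = graph_solution_deriv[OF e, of _ x A B]
    have cF: "continuous_on {0..l} (?F e)"
      by (rule continuous_on_eq[OF continuous_edge_solution]) (simp add: graph_solution_def e)
    show "square_integrable l (?F e)"
      by (rule square_integrable_continuous[OF cF])
    show "abs_continuous 0 l (?F e)"
      by (rule abs_continuous_C1[OF d(1) continuous_edge_solution])
    show "\<forall>t\<in>{0..l}. ?F e differentiable (at t within {0..l})"
      using d(1) differentiableI_vector by blast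
    have ch: "continuous_on {0..l} (\<lambda>t. - (complex_of_real x * ?F e t))"
      by (intro continuous_intros cF)
    show "abs_continuous 0 l (edge_deriv l (?F e))"
      by (rule abs_continuous_C1[OF edge_deriv_graph_solution_deriv[OF e] ch])
    show "\<exists>h. has_second_deriv l (?F e) h \<and> square_integrable l h"
      using edge_deriv_graph_solution_deriv[OF e, of _ x A B] square_integrable_continuous[OF ch]
      by (auto simp: has_second_deriv_def intro!: AE_I2 exI[of _ "\<lambda>t. - (complex_of_real x * ?F e t)"])
  qed
  then show ?thesis
    unfolding max_domain_def by (auto simp: len_eqD graph_solution_def)
qed

text \<open>On each edge the right side of the eigenvalue equation is continuous, so the equation
  holds everywhere and the initial data determine the function. The vertex conditions enter only
  through \<open>D\<close>, which makes the result common to both operators.\<close>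

lemma eigenspace_laplace_on:
  assumes D: "D \<subseteq> max_domain G len"
  shows "eigenspace (laplace_on G len D) x = D \<inter> {graph_solution G l x A B | A B. True}"
proof (intro equalityI subsetI)
  fix f assume "f \<in> eigenspace (laplace_on G len D) x"
  then have fD: "f \<in> D" and sd: "\<And>e. e \<in> arcs G \<Longrightarrow> has_second_deriv l (f e) (\<lambda>t. - (complex_of_real x * f e t))"
    by (auto simp: eigenspace_def laplace_on_def scale_fun_def len_eqD)
  then have fm: "f \<in> max_domain G len" using D by auto
  define B where "B e = edge_deriv l (f e) 0" for e
  have sol: "f e t = edge_solution x (f e 0) (B e) t" if e: "e \<in> arcs G" and t: "t \<in> {0..l}" for e t
  proof -
    have diff: "\<And>t. t \<in> {0..l} \<Longrightarrow> f e differentiable (at t within {0..l})"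
      and ac: "abs_continuous 0 l (edge_deriv l (f e))"
      using fm e len_eqD[OF e] unfolding max_domain_def by auto
    have f': "(f e has_vector_derivative edge_deriv l (f e) t) (at t within {0..l})" if "t \<in> {0..l}" for t
      using diff[OF that] unfolding edge_deriv_def vector_derivative_works .
    have cf: "continuous_on {0..l} (\<lambda>t. - (complex_of_real x * f e t))"
      by (intro continuous_intros differentiable_imp_continuous_on)
        (use diff in \<open>auto simp: differentiable_on_def\<close>)
    have g': "(edge_deriv l (f e) has_vector_derivative - (complex_of_real x * f e t)) (at t within {0..l})"
      if "t \<in> {0..l}" for t
      by (rule abs_continuous_deriv_continuous[OF ac cf _ that])
        (use sd[OF e] in \<open>simp add: has_second_deriv_def\<close>)
    show ?thesis
      unfolding B_def by (rule edge_solution_unique[OF f' g' t])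
  qed
  have zero: "f e t = 0" if "e \<notin> arcs G \<or> t \<notin> {0..l}" for e t
    using fm that len_eqD unfolding max_domain_def by blast
  have "f = graph_solution G l x (\<lambda>e. f e 0) B"
  proof (intro ext)
    fix e t
    show "f e t = graph_solution G l x (\<lambda>e. f e 0) B e t"
    proof (cases "e \<in> arcs G \<and> t \<in> {0..l}")
      case True
      show ?thesis unfolding graph_solution_def if_P[OF True] by (rule sol) (use True in blast)+
    next
      case False
      show ?thesis unfolding graph_solution_def if_not_P[OF False] by (rule zero) (use False in blast)
    qed
  qed
  then show "f \<in> D \<inter> {graph_solution G l x A B | A B. True}" using fD by blast
next
  fix f assume "f \<in> D \<inter> {graph_solution G l x A B | A B. True}"
  then obtain A B where "f \<in> D" and f: "f = graph_solution G l x A B" by auto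
  moreover have "has_second_deriv (len e) (f e) (\<lambda>t. - (complex_of_real x * f e t))" if "e \<in> arcs G" for e
    using edge_deriv_graph_solution_deriv[OF that, of _ x A B]
    by (auto simp: has_second_deriv_def len_eqD[OF that] f intro!: AE_I2)
  ultimately show "f \<in> eigenspace (laplace_on G len D) x"
    by (auto simp: eigenspace_def laplace_on_def scale_fun_def)
qed

lemma graph_solution_vertex:
  fixes A B :: "'e \<Rightarrow> complex"
  assumes e: "e \<in> arcs G"
  shows "vertex_value G len (graph_solution G l x A B) (tail G e) e = A e"
    "vertex_value G len (graph_solution G l x A B) (head G e) e = csol x l * A e + ssol x l * B e"
    "outgoing_deriv G len (graph_solution G l x A B) (tail G e) e = B e"
    "outgoing_deriv G len (graph_solution G l x A B) (head G e) e = x * ssol x l * A e - csol x l * B e"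
proof -
  \<comment> \<open>\<open>vertex_value\<close> and \<open>outgoing_deriv\<close> compare with the
    tail first; their other branch is the head only because it differs from the tail.\<close>
  have [simp]: "(head G e = tail G e) = False" using loopfree[OF e] by auto
  have ep: "0 \<in> {0..l}" "l \<in> {0..l}" using l_pos by auto
  show "vertex_value G len (graph_solution G l x A B) (tail G e) e = A e"
    "vertex_value G len (graph_solution G l x A B) (head G e) e = csol x l * A e + ssol x l * B e"
    using e ep by (simp_all add: vertex_value_def graph_solution_def edge_solution_def len_eqD scaleR_conv_of_real)
  show "outgoing_deriv G len (graph_solution G l x A B) (tail G e) e = B e"
    "outgoing_deriv G len (graph_solution G l x A B) (head G e) e = x * ssol x l * A e - csol x l * B e"
    using e by (simp_all add: outgoing_deriv_def len_eqD graph_solution_deriv(2)[OF e ep(1)]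
        graph_solution_deriv(2)[OF e ep(2)] edge_solution_def scaleR_conv_of_real)
qed

text \<open>Pairwise agreement at a vertex becomes the existence of a vertex function, which is the
  form used in \<open>edge_data\<close>.\<close>

lemma coincide_iff:
  fixes val :: "'v \<Rightarrow> 'e \<Rightarrow> complex"
  shows "(\<forall>v\<in>verts G. \<forall>e\<in>incident G v. \<forall>e'\<in>incident G v. val v e = val v e') \<longleftrightarrow>
    (\<exists>\<phi>. \<forall>e\<in>arcs G. val (tail G e) e = \<phi> (tail G e) \<and> val (head G e) e = \<phi> (head G e))"
    (is "?L \<longleftrightarrow> ?R")
proof
  assume L: ?L
  define \<phi> where "\<phi> v = val v (SOME e. e \<in> incident G v)" for v
  have "val v e = \<phi> v" if "v \<in> verts G" "e \<in> incident G v" for v e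
    unfolding \<phi>_def using L that someI[of "\<lambda>e. e \<in> incident G v" e] by blast
  then show ?R
    by (intro exI[of _ \<phi>]) (auto simp: incident_def)
next
  assume ?R
  then obtain \<phi> where \<phi>: "\<And>e. e \<in> arcs G \<Longrightarrow> val (tail G e) e = \<phi> (tail G e)"
    "\<And>e. e \<in> arcs G \<Longrightarrow> val (head G e) e = \<phi> (head G e)" by blast
  then have "val v e = \<phi> v" if "e \<in> incident G v" for v e
    using that by (auto simp: incident_def)
  then show ?L by simp
qed

lemma graph_solution_cong:
  "(\<And>e. e \<in> arcs G \<Longrightarrow> A e = A' e) \<Longrightarrow> (\<And>e. e \<in> arcs G \<Longrightarrow> B e = B' e) \<Longrightarrow>
     graph_solution G l x A B = graph_solution G l x A' B'"
  by (auto simp: graph_solution_def fun_eq_iff)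

lemma graph_solution_inject:
  assumes "graph_solution G l x A B = graph_solution G l x A' B'" "e \<in> arcs G"
  shows "A e = A' e" "B e = B' e"
  using graph_solution_vertex(1,3)[OF assms(2), of x A B] graph_solution_vertex(1,3)[OF assms(2), of x A' B']
    assms(1) by simp_all

lemma linear_graph_solution:
  "Vector_Spaces.linear fscale scale_fun (\<lambda>z. graph_solution G l x (\<lambda>e. z (b, e)) (\<lambda>e. z (b', e)))"
  by (rule linear_fs_gsI)
    (auto simp: graph_solution_def edge_solution_def fun_eq_iff fscale_apply scale_fun_def algebra_simps)

text \<open>
  The component \<open>z (True, _)\<close> is the value at the tail if \<open>b\<close> holds (standard conditions) and the
  derivative at the tail otherwise (anti-standard conditions).
\<close>

lemma dim_eigenspace_via_edge_data:
  assumes dom: "\<And>z. z \<in> funs_on (UNIV \<times> arcs G) \<Longrightarrow>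
      graph_solution G l x (\<lambda>e. z (b, e)) (\<lambda>e. z (\<not> b, e)) \<in> D \<longleftrightarrow> z \<in> edge_data G c s r"
    and D: "D \<subseteq> max_domain G len"
  shows "eigenvalue_multiplicity (laplace_on G len D) x = fs.dim (edge_data G c s r)"
proof -
  define T where "T z = graph_solution G l x (\<lambda>e. z (b, e)) (\<lambda>e. z (\<not> b, e))" for z :: "bool \<times> 'e \<Rightarrow> complex"
  have lin: "Vector_Spaces.linear fscale scale_fun T"
    unfolding T_def[abs_def] by (rule linear_graph_solution)
  interpret T: Vector_Spaces.linear fscale scale_fun T by (rule lin)
  have sub: "fs.subspace (edge_data G c s r)"
    unfolding fs.subspace_def
  proof (intro conjI ballI allI)
    show "0 \<in> edge_data G c s r"
      by (auto simp: edge_data_def funs_on_def intro!: exI[of _ "\<lambda>_. 0"])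
  next
    fix z z' assume zz: "z \<in> edge_data G c s r" "z' \<in> edge_data G c s r"
    obtain \<phi> where \<phi>: "\<And>e. e \<in> arcs G \<Longrightarrow> z (True, e) = \<phi> (tail G e)"
      "\<And>e. e \<in> arcs G \<Longrightarrow> c * z (True, e) + s * z (False, e) = \<phi> (head G e)"
      by (rule edge_data_vertex_values[OF zz(1)]) blast
    obtain \<phi>' where \<phi>': "\<And>e. e \<in> arcs G \<Longrightarrow> z' (True, e) = \<phi>' (tail G e)"
      "\<And>e. e \<in> arcs G \<Longrightarrow> c * z' (True, e) + s * z' (False, e) = \<phi>' (head G e)"
      by (rule edge_data_vertex_values[OF zz(2)]) blast
    have "\<forall>e\<in>arcs G. (z + z') (True, e) = (\<phi> + \<phi>') (tail G e) \<and>
        c * (z + z') (True, e) + s * (z + z') (False, e) = (\<phi> + \<phi>') (head G e)"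
      using \<phi>(1) \<phi>'(1) by (simp add: \<phi>(2)[symmetric] \<phi>'(2)[symmetric] algebra_simps)
    moreover have "(\<Sum>e\<in>outs G v. (z + z') (False, e)) + (\<Sum>e\<in>ins G v. r * (z + z') (True, e) - c * (z + z') (False, e))
       = ((\<Sum>e\<in>outs G v. z (False, e)) + (\<Sum>e\<in>ins G v. r * z (True, e) - c * z (False, e)))
       + ((\<Sum>e\<in>outs G v. z' (False, e)) + (\<Sum>e\<in>ins G v. r * z' (True, e) - c * z' (False, e)))" for v
      by (simp add: sum.distrib sum_subtractf algebra_simps)
    moreover have "z + z' \<in> funs_on (UNIV \<times> arcs G)"
      using zz by (auto simp: edge_data_def funs_on_def)
    ultimately show "z + z' \<in> edge_data G c s r"
      using edge_data_flow[OF zz(1)] edge_data_flow[OF zz(2)]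
      by (intro edge_dataI) (simp_all only: add_0)
  next
    fix k z assume z: "z \<in> edge_data G c s r"
    obtain \<phi> where \<phi>: "\<And>e. e \<in> arcs G \<Longrightarrow> z (True, e) = \<phi> (tail G e)"
      "\<And>e. e \<in> arcs G \<Longrightarrow> c * z (True, e) + s * z (False, e) = \<phi> (head G e)"
      by (rule edge_data_vertex_values[OF z]) blast
    have "\<forall>e\<in>arcs G. fscale k z (True, e) = fscale k \<phi> (tail G e) \<and>
        c * fscale k z (True, e) + s * fscale k z (False, e) = fscale k \<phi> (head G e)"
      using \<phi>(1) by (simp add: \<phi>(2)[symmetric] fscale_apply algebra_simps)
    moreover have "(\<Sum>e\<in>outs G v. fscale k z (False, e)) + (\<Sum>e\<in>ins G v. r * fscale k z (True, e) - c * fscale k z (False, e))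
       = k * ((\<Sum>e\<in>outs G v. z (False, e)) + (\<Sum>e\<in>ins G v. r * z (True, e) - c * z (False, e)))" for v
      by (simp add: fscale_apply sum_distrib_left distrib_left right_diff_distrib mult.left_commute)
    moreover have "fscale k z \<in> funs_on (UNIV \<times> arcs G)"
      using z by (auto simp: edge_data_def funs_on_def fscale_apply)
    ultimately show "fscale k z \<in> edge_data G c s r"
      using edge_data_flow[OF z] by (intro edge_dataI) (simp_all only: mult_zero_right)
  qed
  have inj: "inj_on T (edge_data G c s r)"
  proof (rule inj_onI, rule ext)
    fix z z' and be :: "bool \<times> 'e"
    assume *: "z \<in> edge_data G c s r" "z' \<in> edge_data G c s r" "T z = T z'"
    obtain b' e where be: "be = (b', e)" by force
    show "z be = z' be"
    proof (cases "e \<in> arcs G")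
      case True
      show ?thesis
        using graph_solution_inject[OF *(3)[unfolded T_def] True] unfolding be
        by (cases "b' = b") auto
    next
      case False
      then show ?thesis using * by (auto simp: be edge_data_def funs_on_def)
    qed
  qed
  have "T ` edge_data G c s r = eigenspace (laplace_on G len D) x"
    unfolding eigenspace_laplace_on[OF D]
  proof (intro equalityI subsetI)
    fix f assume "f \<in> T ` edge_data G c s r"
    then obtain z where z: "z \<in> edge_data G c s r" "f = T z" by blast
    then show "f \<in> D \<inter> {graph_solution G l x A B |A B. True}"
      using dom[of z] unfolding T_def edge_data_def by blast
  next
    fix f assume "f \<in> D \<inter> {graph_solution G l x A B |A B. True}"
    then obtain A B where f: "f \<in> D" "f = graph_solution G l x A B" by blast
    define z where "z = (\<lambda>(b', e). if e \<in> arcs G then if b' = b then A e else B e else 0)"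
    have z: "z \<in> funs_on (UNIV \<times> arcs G)" by (auto simp: z_def funs_on_def)
    have "f = T z"
      unfolding f(2) T_def by (rule graph_solution_cong) (auto simp: z_def)
    then show "f \<in> T ` edge_data G c s r"
      using dom[OF z] f(1) unfolding T_def by blast
  qed
  then show ?thesis
    unfolding eigenvalue_multiplicity_def
    using fs_gs.dim_image_inj_on[OF lin sub inj] by simp
qed

lemma multiplicity_standard:
  "eigenvalue_multiplicity (standard_laplace G len) x
    = fs.dim (edge_data G (csol x l) (ssol x l) (x * ssol x l))"
  unfolding standard_laplace_def
proof (rule dim_eigenspace_via_edge_data[where b = True])
  show "standard_domain G len \<subseteq> max_domain G len" by (auto simp: standard_domain_def)
  fix z :: "bool \<times> 'e \<Rightarrow> complex" assume z: "z \<in> funs_on (UNIV \<times> arcs G)"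
  let ?F = "graph_solution G l x (\<lambda>e. z (True, e)) (\<lambda>e. z (\<not> True, e))"
  have "(\<Sum>e\<in>incident G v. outgoing_deriv G len ?F v e)
      = (\<Sum>e\<in>outs G v. z (False, e)) + (\<Sum>e\<in>ins G v. x * ssol x l * z (True, e) - csol x l * z (False, e))" for v
    unfolding sum_incident
    by (intro arg_cong2[where f = "(+)"] sum.cong refl) (auto simp: outs_def ins_def graph_solution_vertex)
  then show "?F \<in> standard_domain G len \<longleftrightarrow> z \<in> edge_data G (csol x l) (ssol x l) (x * ssol x l)"
    using z graph_solution_in_max_domain[of x]
    unfolding standard_domain_def edge_data_def ball_conj_distrib coincide_iff
    by (simp add: graph_solution_vertex)
qed

text \<open>With values and outgoing derivatives exchanged, the outgoing derivative at the head
  reads \<open>- csol x l\<close> times the one at the tail plus \<open>x * ssol x l\<close> times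
  the value there. Compared with the standard operator, the first coefficient changes sign and the
  other two swap; the sign change is the origin of the eigenvalues \<open>- \<mu> j\<close>.\<close>

lemma multiplicity_anti_standard:
  "eigenvalue_multiplicity (anti_standard_laplace G len) x
    = fs.dim (edge_data G (- csol x l) (x * ssol x l) (ssol x l))"
  unfolding anti_standard_laplace_def
proof (rule dim_eigenspace_via_edge_data[where b = False])
  show "anti_standard_domain G len \<subseteq> max_domain G len" by (auto simp: anti_standard_domain_def)
  fix z :: "bool \<times> 'e \<Rightarrow> complex" assume z: "z \<in> funs_on (UNIV \<times> arcs G)"
  let ?F = "graph_solution G l x (\<lambda>e. z (False, e)) (\<lambda>e. z (\<not> False, e))"
  have "(\<Sum>e\<in>incident G v. vertex_value G len ?F v e)
      = (\<Sum>e\<in>outs G v. z (False, e)) + (\<Sum>e\<in>ins G v. ssol x l * z (True, e) - - csol x l * z (False, e))" for v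
    unfolding sum_incident
    by (intro arg_cong2[where f = "(+)"] sum.cong refl) (auto simp: outs_def ins_def graph_solution_vertex)
  then show "?F \<in> anti_standard_domain G len \<longleftrightarrow> z \<in> edge_data G (- csol x l) (x * ssol x l) (ssol x l)"
    using z graph_solution_in_max_domain[of x]
    unfolding anti_standard_domain_def edge_data_def ball_conj_distrib coincide_iff
    by (simp add: graph_solution_vertex algebra_simps)
qed

end

end

section \<open>Sequences of eigenvalues\<close>

text \<open>At a first disagreement \<open>g i < h i\<close>, monotonicity puts every index where
  \<open>h\<close> takes the value \<open>g i\<close> before \<open>i\<close>, where
  \<open>g\<close> and \<open>h\<close> agree. The index \<open>i\<close> is then an additional
  occurrence for \<open>g\<close>, although both must occur equally often.\<close>

lemma eigenvalue_sequence_unique: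
  assumes lam: "eigenvalue_sequence L lam" and lam': "eigenvalue_sequence L lam'" and k: "1 \<le> k"
  shows "lam k = lam' k"
  using k
proof (induction k rule: less_induct)
  case (less i)
  have no: "\<not> g i < h i" if g: "eigenvalue_sequence L g" and h: "eigenvalue_sequence L h"
    and IH: "\<And>k. k < i \<Longrightarrow> 1 \<le> k \<Longrightarrow> g k = h k" for g h
  proof
    assume gh: "g i < h i"
    have "{k. 1 \<le> k \<and> h k = g i} \<subset> {k. 1 \<le> k \<and> g k = g i}"
    proof (rule psubsetI)
      show "{k. 1 \<le> k \<and> h k = g i} \<subseteq> {k. 1 \<le> k \<and> g k = g i}"
      proof (rule subsetI)
        fix k assume "k \<in> {k. 1 \<le> k \<and> h k = g i}"
        then have k: "1 \<le> k" "h k = g i" by auto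
        then have "k < i"
          using h gh less.prems unfolding eigenvalue_sequence_def by (metis leD leI)
        then show "k \<in> {k. 1 \<le> k \<and> g k = g i}" using IH k by simp
      qed
      show "{k. 1 \<le> k \<and> h k = g i} \<noteq> {k. 1 \<le> k \<and> g k = g i}"
      proof -
        have "i \<in> {k. 1 \<le> k \<and> g k = g i}" "i \<notin> {k. 1 \<le> k \<and> h k = g i}"
          using gh less.prems by simp_all
        then show ?thesis by blast
      qed
    qed
    then have "card {k. 1 \<le> k \<and> h k = g i} < card {k. 1 \<le> k \<and> g k = g i}"
      using g unfolding eigenvalue_sequence_def by (intro psubset_card_mono) blast+
    then show False
      using g h unfolding eigenvalue_sequence_def by simp
  qed
  show ?case
    using no[OF lam lam'] no[OF lam' lam] less.IH by fastforce
qed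

lemma kth_eigenvalue_eq:
  assumes "eigenvalue_sequence L lam" "1 \<le> k"
  shows "kth_eigenvalue L k = lam k"
  unfolding kth_eigenvalue_def
proof (rule the_equality)
  show "\<exists>lam'. eigenvalue_sequence L lam' \<and> lam' k = lam k" using assms(1) by blast
  fix x assume "\<exists>lam'. eigenvalue_sequence L lam' \<and> lam' k = x"
  then show "x = lam k" using eigenvalue_sequence_unique[OF _ assms] by blast
qed

text \<open>The intended eigenvalues are \<open>(periodic_angle M P \<theta> k / l)\<^sup>2\<close>,
  with \<open>M\<close> the multiplicity of 0 and \<open>P\<close> the number of angles per period.
  Indices start at 1, hence the offsets by 1 around \<open>mod\<close>.\<close>

definition periodic_angle :: "nat \<Rightarrow> nat \<Rightarrow> (nat \<Rightarrow> real) \<Rightarrow> nat \<Rightarrow> real" where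
  "periodic_angle M P \<theta> k = (if k \<le> M then 0
     else \<theta> ((k - M - 1) mod P + 1) + 2 * pi * real ((k - M - 1) div P))"

lemma angle_unique:
  fixes t t' :: real and q q' :: nat
  assumes "t + 2 * pi * real q = t' + 2 * pi * real q'" "0 < t" "t \<le> 2 * pi" "0 < t'" "t' \<le> 2 * pi"
  shows "q = q' \<and> t = t'"
proof -
  have lt: "\<not> a < b" if "s + 2 * pi * real a = s' + 2 * pi * real b" "s \<le> 2 * pi" "0 < s'" for s s' :: real and a b
  proof
    assume "a < b"
    then have "2 * pi * (real a + 1) \<le> 2 * pi * real b"
      by (intro mult_left_mono) auto
    then show False using that by (simp add: algebra_simps)
  qed
  have "q = q'" using lt[OF assms(1)] lt[OF assms(1)[symmetric]] assms by force
  then show ?thesis using assms(1) by simp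
qed

text \<open>The fundamental interval is (0, 2 pi] and not [0, 2 pi): for the standard operator the
  angle 0 may have another multiplicity than the positive multiples of 2 pi, so it is kept out of
  the period.\<close>

lemma angle_exists:
  assumes "0 < (\<alpha>::real)"
  obtains t q where "\<alpha> = t + 2 * pi * real q" "0 < t" "t \<le> 2 * pi"
proof -
  \<comment> \<open>The ceiling minus 1, instead of the floor, leaves the interval open at 0 and
    closed at 2 pi.\<close>
  define q where "q = nat (\<lceil>\<alpha> / (2 * pi)\<rceil> - 1)"
  have "0 < \<lceil>\<alpha> / (2 * pi)\<rceil>" using assms by simp
  then have "real q = real_of_int \<lceil>\<alpha> / (2 * pi)\<rceil> - 1"
    by (simp add: q_def)
  then have "real q < \<alpha> / (2 * pi)" "\<alpha> / (2 * pi) \<le> real q + 1"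
    using ceiling_correct[of "\<alpha> / (2 * pi)"] by linarith+
  then have "0 < \<alpha> - 2 * pi * real q" "\<alpha> - 2 * pi * real q \<le> 2 * pi"
    by (simp_all add: field_simps)
  then show ?thesis using that[of "\<alpha> - 2 * pi * real q" q] by simp
qed

context
  fixes M P :: nat and \<theta> :: "nat \<Rightarrow> real"
  assumes P: "0 < P"
    and mono: "\<And>i j. 1 \<le> i \<Longrightarrow> i \<le> j \<Longrightarrow> j \<le> P \<Longrightarrow> \<theta> i \<le> \<theta> j"
    and range: "\<And>i. 1 \<le> i \<Longrightarrow> i \<le> P \<Longrightarrow> 0 < \<theta> i \<and> \<theta> i \<le> 2 * pi"
begin

lemma mod_range: "0 < \<theta> (m mod P + 1)" "\<theta> (m mod P + 1) \<le> 2 * pi"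
  using range[of "m mod P + 1"] P by (simp_all add: Suc_leI)

lemma periodic_angle_pos: "M < k \<Longrightarrow> 0 < periodic_angle M P \<theta> k"
  using mod_range(1)[of "k - M - 1"] by (simp add: periodic_angle_def add_pos_nonneg)

lemma periodic_angle_nonneg: "0 \<le> periodic_angle M P \<theta> k"
  using periodic_angle_pos[of k] by (cases "k \<le> M") (auto simp: periodic_angle_def)

lemma periodic_angle_mono:
  assumes "i \<le> j"
  shows "periodic_angle M P \<theta> i \<le> periodic_angle M P \<theta> j"
proof (cases "i \<le> M")
  case True
  then show ?thesis using periodic_angle_nonneg[of j] by (simp add: periodic_angle_def)
next
  case False
  define a where "a = i - M - 1"
  define b where "b = j - M - 1"
  have ab: "a \<le> b" using assms by (simp add: a_def b_def)
  have "\<theta> (a mod P + 1) + 2 * pi * real (a div P) \<le> \<theta> (b mod P + 1) + 2 * pi * real (b div P)"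
  proof (cases "a div P = b div P")
    case True
    then have "a mod P \<le> b mod P"
      using ab by (metis div_mult_mod_eq add_le_cancel_left)
    then have "\<theta> (a mod P + 1) \<le> \<theta> (b mod P + 1)"
      using P by (intro mono) (auto simp: Suc_leI)
    then show ?thesis using True by simp
  next
    case False
    then have "a div P + 1 \<le> b div P" using ab div_le_mono[of a b P] by simp
    then have "2 * pi * (real (a div P) + 1) \<le> 2 * pi * real (b div P)"
      by (intro mult_left_mono) auto
    then show ?thesis
      using mod_range(2)[of a] mod_range(1)[of b] by (simp add: algebra_simps)
  qed
  then show ?thesis
    using False assms by (simp add: periodic_angle_def a_def b_def)
qed

lemma periodic_angle_level_set:
  assumes t: "0 < t" "t \<le> 2 * pi"
  shows "{k. 1 \<le> k \<and> periodic_angle M P \<theta> k = t + 2 * pi * real q}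
    = (\<lambda>i. M + q * P + i) ` {i \<in> {1..P}. \<theta> i = t}"
proof (intro equalityI subsetI)
  fix k assume "k \<in> {k. 1 \<le> k \<and> periodic_angle M P \<theta> k = t + 2 * pi * real q}"
  then have eq: "periodic_angle M P \<theta> k = t + 2 * pi * real q" by simp
  have "0 < t + 2 * pi * real q" using t by (simp add: add_pos_nonneg)
  then have kM: "M < k" using eq by (simp add: periodic_angle_def split: if_splits)
  define m where "m = k - M - 1"
  have "\<theta> (m mod P + 1) + 2 * pi * real (m div P) = t + 2 * pi * real q"
    using eq kM by (simp add: periodic_angle_def m_def)
  then have "m div P = q" "\<theta> (m mod P + 1) = t"
    using angle_unique[OF _ mod_range t] by blast+
  moreover have "k = M + m div P * P + (m mod P + 1)"
    using kM by (simp add: m_def)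
  moreover have "m mod P + 1 \<in> {1..P}" using P by (simp add: Suc_leI)
  ultimately show "k \<in> (\<lambda>i. M + q * P + i) ` {i \<in> {1..P}. \<theta> i = t}" by blast
next
  fix k assume "k \<in> (\<lambda>i. M + q * P + i) ` {i \<in> {1..P}. \<theta> i = t}"
  then obtain i where i: "1 \<le> i" "i \<le> P" "\<theta> i = t" "k = M + q * P + i" by auto
  then obtain m where m: "i = Suc m" "m < P" by (cases i) auto
  have "k - M - 1 = m + q * P" using i(4) m(1) by simp
  then have "(k - M - 1) mod P + 1 = i" "(k - M - 1) div P = q"
    using m by simp_all
  then show "k \<in> {k. 1 \<le> k \<and> periodic_angle M P \<theta> k = t + 2 * pi * real q}"
    using i unfolding periodic_angle_def by simp
qed

text \<open>A positive \<open>x\<close> has the unique angle \<open>l * sqrt x\<close>, which lies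
  in exactly one period. Its level set is then a translate of a level set of \<theta>, and
  translation preserves the count.\<close>

lemma eigenvalue_sequence_periodic:
  assumes l: "0 < l"
    and neg: "\<And>x. x < 0 \<Longrightarrow> eigenvalue_multiplicity L x = 0"
    and zero: "eigenvalue_multiplicity L 0 = M"
    and pos: "\<And>t q. 0 < t \<Longrightarrow> t \<le> 2 * pi \<Longrightarrow>
      eigenvalue_multiplicity L (((t + 2 * pi * real q) / l)\<^sup>2) = card {i \<in> {1..P}. \<theta> i = t}"
  shows "eigenvalue_sequence L (\<lambda>k. (periodic_angle M P \<theta> k / l)\<^sup>2)"
  unfolding eigenvalue_sequence_def
proof (intro conjI allI impI)
  fix i j :: nat assume "1 \<le> i \<and> i \<le> j"
  then show "(periodic_angle M P \<theta> i / l)\<^sup>2 \<le> (periodic_angle M P \<theta> j / l)\<^sup>2"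
    using l periodic_angle_nonneg[of i] periodic_angle_mono[of i j]
    by (intro power_mono divide_right_mono) auto
next
  fix x :: real
  let ?S = "{k. 1 \<le> k \<and> (periodic_angle M P \<theta> k / l)\<^sup>2 = x}"
  have "finite ?S \<and> card ?S = eigenvalue_multiplicity L x"
  proof -
    consider "x < 0" | "x = 0" | "x > 0" by linarith
    then show ?thesis
    proof cases
      case 1
      then have S: "?S = {}" by (smt (verit) Collect_empty_eq zero_le_power2)
      show ?thesis unfolding S using neg[OF 1] by simp
    next
      case 2
      have "(periodic_angle M P \<theta> k / l)\<^sup>2 = x \<longleftrightarrow> k \<le> M" for k
      proof (cases "k \<le> M")
        case True
        then show ?thesis by (simp add: 2 periodic_angle_def)
      next
        case False
        then show ?thesis using periodic_angle_pos[of k] l by (simp add: 2)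
      qed
      then have S: "?S = {1..M}"
        by (simp only: set_eq_iff mem_Collect_eq atLeastAtMost_iff simp_thms)
      show ?thesis unfolding S using 2 zero by simp
    next
      case 3
      then have "0 < l * sqrt x" using l by simp
      then obtain t q where tq: "l * sqrt x = t + 2 * pi * real q" "0 < t" "t \<le> 2 * pi"
        by (rule angle_exists)
      have "(a / l)\<^sup>2 = x \<longleftrightarrow> a = l * sqrt x" if "0 \<le> a" for a
      proof -
        have "(a / l)\<^sup>2 = x \<longleftrightarrow> (a / l)\<^sup>2 = (sqrt x)\<^sup>2" using 3 by simp
        also have "\<dots> \<longleftrightarrow> a / l = sqrt x"
          using that l 3 by (subst power2_eq_iff_nonneg) auto
        also have "\<dots> \<longleftrightarrow> a = l * sqrt x" using l by (auto simp: field_simps)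
        finally show ?thesis .
      qed
      then have S: "?S = (\<lambda>i. M + q * P + i) ` {i \<in> {1..P}. \<theta> i = t}"
        using periodic_angle_nonneg tq(1) by (subst periodic_angle_level_set[OF tq(2,3), symmetric]) auto
      have "eigenvalue_multiplicity L x = card {i \<in> {1..P}. \<theta> i = t}"
        using pos[OF tq(2,3), of q] l 3 unfolding tq(1)[symmetric] by simp
      then show ?thesis
        unfolding S by (simp add: card_image)
    qed
  qed
  then show "finite ?S" "card ?S = eigenvalue_multiplicity L x" by blast+
qed

end

text \<open>
  The angles \<open>sqrt \<lambda> * l\<close> in the first period: those that are not multiples of \<open>pi\<close>
  are the solutions of \<open>cos t = \<mu> j\<close>, respectively \<open>cos t = - \<mu> j\<close>, for \<open>j \<ge> 2\<close>.
\<close>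

definition standard_angle :: "nat \<Rightarrow> nat \<Rightarrow> (nat \<Rightarrow> real) \<Rightarrow> nat \<Rightarrow> real" where
  "standard_angle n N \<mu> k =
     (if k \<le> n - 1 then arccos (\<mu> (k + 1))
      else if k \<le> N - 1 then pi
      else if k \<le> N + n - 2 then 2 * pi - arccos (\<mu> (N + n - k))
      else 2 * pi)"

text \<open>The four blocks have lengths n - 1, N - n + 2, n - 1, N - n, against n - 1, N - n, n -
  1, N - n + 2 for \<open>standard_angle\<close>; both add up to 2 N. As arccos is decreasing, the
  direction in which \<mu> is traversed in each block keeps the angles nondecreasing.\<close>

definition anti_standard_angle :: "nat \<Rightarrow> nat \<Rightarrow> (nat \<Rightarrow> real) \<Rightarrow> nat \<Rightarrow> real" where
  "anti_standard_angle n N \<mu> k =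
     (if k \<le> n - 1 then arccos (- \<mu> (n + 1 - k))
      else if k \<le> N + 1 then pi
      else if k \<le> N + n then 2 * pi - arccos (- \<mu> (k - N))
      else 2 * pi)"

section \<open>The first period of the two angle sequences: order, comparison, counting\<close>

context
  fixes n N :: nat and \<mu> :: "nat \<Rightarrow> real"
  assumes n: "1 \<le> n" "n \<le> N"
    and mu_antimono: "\<forall>i j. 1 \<le> i \<and> i \<le> j \<and> j \<le> n \<longrightarrow> \<mu> j \<le> \<mu> i"
    and mu_1: "\<mu> 1 = 1"
    and mu_abs_less: "\<forall>j. 2 \<le> j \<and> j \<le> n \<longrightarrow> \<bar>\<mu> j\<bar> < 1"
begin

lemma mu_antimonoD: "1 \<le> i \<Longrightarrow> i \<le> j \<Longrightarrow> j \<le> n \<Longrightarrow> \<mu> j \<le> \<mu> i"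
  using mu_antimono by blast

lemma mu_abs_lessD: "2 \<le> j \<Longrightarrow> j \<le> n \<Longrightarrow> \<bar>\<mu> j\<bar> < 1"
  using mu_abs_less by blast

lemma arccos_mu:
  assumes "2 \<le> j" "j \<le> n"
  shows "0 < arccos (\<mu> j)" "arccos (\<mu> j) < pi" "0 < arccos (- \<mu> j)" "arccos (- \<mu> j) < pi"
  using mu_abs_lessD[OF assms] by (auto intro: arccos_lt_bounded[THEN conjunct1] arccos_lt_bounded[THEN conjunct2])

lemma standard_angle_eqs:
  "i \<le> n - 1 \<Longrightarrow> standard_angle n N \<mu> i = arccos (\<mu> (i + 1))"
  "n - 1 < i \<Longrightarrow> i \<le> N - 1 \<Longrightarrow> standard_angle n N \<mu> i = pi"
  "N - 1 < i \<Longrightarrow> i \<le> N + n - 2 \<Longrightarrow> standard_angle n N \<mu> i = 2 * pi - arccos (\<mu> (N + n - i))"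
  "N - 1 < i \<Longrightarrow> N + n - 2 < i \<Longrightarrow> standard_angle n N \<mu> i = 2 * pi"
proof -
  show "standard_angle n N \<mu> i = arccos (\<mu> (i + 1))" if "i \<le> n - 1"
    using that by (simp only: standard_angle_def if_True)
  show "standard_angle n N \<mu> i = pi" if "n - 1 < i" "i \<le> N - 1"
    using that unfolding standard_angle_def not_le[symmetric] by (simp only: if_False if_True)
  show "standard_angle n N \<mu> i = 2 * pi - arccos (\<mu> (N + n - i))" if "N - 1 < i" "i \<le> N + n - 2"
  proof -
    have "\<not> i \<le> n - 1" "\<not> i \<le> N - 1" using that(1) n by linarith+
    then show ?thesis using that(2) by (simp only: standard_angle_def if_False if_True)
  qed
  show "standard_angle n N \<mu> i = 2 * pi" if "N - 1 < i" "N + n - 2 < i"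
  proof -
    have "\<not> i \<le> n - 1" "\<not> i \<le> N - 1" "\<not> i \<le> N + n - 2" using that n by linarith+
    then show ?thesis by (simp only: standard_angle_def if_False)
  qed
qed

lemma anti_standard_angle_eqs:
  "i \<le> n - 1 \<Longrightarrow> anti_standard_angle n N \<mu> i = arccos (- \<mu> (n + 1 - i))"
  "n - 1 < i \<Longrightarrow> i \<le> N + 1 \<Longrightarrow> anti_standard_angle n N \<mu> i = pi"
  "N + 1 < i \<Longrightarrow> i \<le> N + n \<Longrightarrow> anti_standard_angle n N \<mu> i = 2 * pi - arccos (- \<mu> (i - N))"
  "N + 1 < i \<Longrightarrow> N + n < i \<Longrightarrow> anti_standard_angle n N \<mu> i = 2 * pi"
proof -
  show "anti_standard_angle n N \<mu> i = arccos (- \<mu> (n + 1 - i))" if "i \<le> n - 1"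
    using that by (simp only: anti_standard_angle_def if_True)
  show "anti_standard_angle n N \<mu> i = pi" if "n - 1 < i" "i \<le> N + 1"
    using that unfolding anti_standard_angle_def not_le[symmetric] by (simp only: if_False if_True)
  show "anti_standard_angle n N \<mu> i = 2 * pi - arccos (- \<mu> (i - N))" if "N + 1 < i" "i \<le> N + n"
  proof -
    have "\<not> i \<le> n - 1" "\<not> i \<le> N + 1" using that(1) n by linarith+
    then show ?thesis using that(2) by (simp only: anti_standard_angle_def if_False if_True)
  qed
  show "anti_standard_angle n N \<mu> i = 2 * pi" if "N + 1 < i" "N + n < i"
  proof -
    have "\<not> i \<le> n - 1" "\<not> i \<le> N + 1" "\<not> i \<le> N + n" using that n by linarith+
    then show ?thesis by (simp only: anti_standard_angle_def if_False)
  qed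
qed

lemma standard_angle_bounds:
  assumes "1 \<le> i"
  shows "0 < standard_angle n N \<mu> i" "standard_angle n N \<mu> i \<le> 2 * pi"
    "i \<le> N - 1 \<Longrightarrow> standard_angle n N \<mu> i \<le> pi" "n - 1 < i \<Longrightarrow> pi \<le> standard_angle n N \<mu> i"
proof -
  consider "i \<le> n - 1" | "n - 1 < i" "i \<le> N - 1" | "N - 1 < i" "i \<le> N + n - 2"
    | "N - 1 < i" "N + n - 2 < i" by linarith
  then have "0 < standard_angle n N \<mu> i \<and> standard_angle n N \<mu> i \<le> 2 * pi
    \<and> (i \<le> N - 1 \<longrightarrow> standard_angle n N \<mu> i \<le> pi) \<and> (n - 1 < i \<longrightarrow> pi \<le> standard_angle n N \<mu> i)"
  proof cases
    case 1
    then have "2 \<le> i + 1" "i + 1 \<le> n" using assms by auto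
    from arccos_mu[OF this] show ?thesis unfolding standard_angle_eqs(1)[OF 1] using 1 by auto
  next
    case 2
    then show ?thesis unfolding standard_angle_eqs(2)[OF 2] by simp
  next
    case 3
    then have "2 \<le> N + n - i" "N + n - i \<le> n" "\<not> i \<le> n - 1" using n by auto
    from arccos_mu[OF this(1,2)] show ?thesis unfolding standard_angle_eqs(3)[OF 3] using 3 by auto
  next
    case 4
    then show ?thesis unfolding standard_angle_eqs(4)[OF 4] by auto
  qed
  then show "0 < standard_angle n N \<mu> i" "standard_angle n N \<mu> i \<le> 2 * pi"
    "i \<le> N - 1 \<Longrightarrow> standard_angle n N \<mu> i \<le> pi" "n - 1 < i \<Longrightarrow> pi \<le> standard_angle n N \<mu> i"
    by blast+
qed

lemma anti_standard_angle_bounds: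
  assumes "1 \<le> i"
  shows "0 < anti_standard_angle n N \<mu> i" "anti_standard_angle n N \<mu> i \<le> 2 * pi"
    "i \<le> N + 1 \<Longrightarrow> anti_standard_angle n N \<mu> i \<le> pi"
    "n - 1 < i \<Longrightarrow> pi \<le> anti_standard_angle n N \<mu> i"
proof -
  consider "i \<le> n - 1" | "n - 1 < i" "i \<le> N + 1" | "N + 1 < i" "i \<le> N + n"
    | "N + 1 < i" "N + n < i" by linarith
  then have "0 < anti_standard_angle n N \<mu> i \<and> anti_standard_angle n N \<mu> i \<le> 2 * pi
    \<and> (i \<le> N + 1 \<longrightarrow> anti_standard_angle n N \<mu> i \<le> pi) \<and> (n - 1 < i \<longrightarrow> pi \<le> anti_standard_angle n N \<mu> i)"
  proof cases
    case 1
    then have "2 \<le> n + 1 - i" "n + 1 - i \<le> n" using assms by auto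
    from arccos_mu[OF this] show ?thesis unfolding anti_standard_angle_eqs(1)[OF 1] using 1 by auto
  next
    case 2
    then show ?thesis unfolding anti_standard_angle_eqs(2)[OF 2] by simp
  next
    case 3
    then have "2 \<le> i - N" "i - N \<le> n" "\<not> i \<le> n - 1" using n by auto
    from arccos_mu[OF this(1,2)] show ?thesis unfolding anti_standard_angle_eqs(3)[OF 3] using 3 by auto
  next
    case 4
    then show ?thesis unfolding anti_standard_angle_eqs(4)[OF 4] by auto
  qed
  then show "0 < anti_standard_angle n N \<mu> i" "anti_standard_angle n N \<mu> i \<le> 2 * pi"
    "i \<le> N + 1 \<Longrightarrow> anti_standard_angle n N \<mu> i \<le> pi"
    "n - 1 < i \<Longrightarrow> pi \<le> anti_standard_angle n N \<mu> i"
    by blast+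
qed

lemma arccos_mu_le:
  assumes "2 \<le> i" "i \<le> n" "2 \<le> j" "j \<le> n"
  shows "arccos (\<mu> i) \<le> arccos (\<mu> j) \<longleftrightarrow> \<mu> j \<le> \<mu> i"
    "arccos (- \<mu> i) \<le> arccos (\<mu> j) \<longleftrightarrow> \<mu> j \<le> - \<mu> i"
    "arccos (\<mu> i) \<le> arccos (- \<mu> j) \<longleftrightarrow> - \<mu> j \<le> \<mu> i"
    "arccos (- \<mu> i) \<le> arccos (- \<mu> j) \<longleftrightarrow> \<mu> i \<le> \<mu> j"
  using mu_abs_lessD[OF assms(1,2)] mu_abs_lessD[OF assms(3,4)] by (simp_all add: arccos_le_mono)

lemma standard_angle_mono:
  assumes "1 \<le> i" "i \<le> j" "j \<le> 2 * N"
  shows "standard_angle n N \<mu> i \<le> standard_angle n N \<mu> j"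
proof -
  consider "j \<le> n - 1" | "i \<le> n - 1" "n - 1 < j" | "n - 1 < i" "i \<le> N - 1"
    | "N - 1 < i" "j \<le> N + n - 2" | "N - 1 < i" "N + n - 2 < j" by linarith
  then show ?thesis
  proof cases
    case 1
    then have "standard_angle n N \<mu> i = arccos (\<mu> (i + 1))" "standard_angle n N \<mu> j = arccos (\<mu> (j + 1))"
      using assms standard_angle_eqs(1) by auto
    then show ?thesis
      using 1 assms arccos_mu_le(1)[of "i + 1" "j + 1"] mu_antimonoD[of "i + 1" "j + 1"] by auto
  next
    case 2
    have "standard_angle n N \<mu> i \<le> pi" "pi \<le> standard_angle n N \<mu> j"
      using standard_angle_bounds(3)[of i] standard_angle_bounds(4)[of j] 2 assms n by auto
    then show ?thesis by simp
  next
    case 3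
    then have "standard_angle n N \<mu> i \<le> pi" "pi \<le> standard_angle n N \<mu> j"
      using standard_angle_bounds(3)[of i] standard_angle_bounds(4)[of j] assms by auto
    then show ?thesis by simp
  next
    case 4
    have "standard_angle n N \<mu> i = 2 * pi - arccos (\<mu> (N + n - i))"
      "standard_angle n N \<mu> j = 2 * pi - arccos (\<mu> (N + n - j))"
      using 4 assms by (auto intro!: standard_angle_eqs(3))
    then show ?thesis
      using 4 assms n arccos_mu_le(1)[of "N + n - j" "N + n - i"] mu_antimonoD[of "N + n - j" "N + n - i"] by auto
  next
    case 5
    then have "standard_angle n N \<mu> j = 2 * pi"
      using assms by (auto intro!: standard_angle_eqs(4))
    then show ?thesis using standard_angle_bounds(2)[of i] assms by simp
  qed
qed

lemma anti_standard_angle_mono: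
  assumes "1 \<le> i" "i \<le> j" "j \<le> 2 * N"
  shows "anti_standard_angle n N \<mu> i \<le> anti_standard_angle n N \<mu> j"
proof -
  consider "j \<le> n - 1" | "i \<le> n - 1" "n - 1 < j" | "n - 1 < i" "i \<le> N + 1"
    | "N + 1 < i" "j \<le> N + n" | "N + 1 < i" "N + n < j" by linarith
  then show ?thesis
  proof cases
    case 1
    then have "anti_standard_angle n N \<mu> i = arccos (- \<mu> (n + 1 - i))"
      "anti_standard_angle n N \<mu> j = arccos (- \<mu> (n + 1 - j))"
      using assms anti_standard_angle_eqs(1) by auto
    then show ?thesis
      using 1 assms arccos_mu_le(4)[of "n + 1 - i" "n + 1 - j"] mu_antimonoD[of "n + 1 - j" "n + 1 - i"] by auto
  next
    case 2
    have "anti_standard_angle n N \<mu> i \<le> pi" "pi \<le> anti_standard_angle n N \<mu> j"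
      using anti_standard_angle_bounds(3)[of i] anti_standard_angle_bounds(4)[of j] 2 assms n by auto
    then show ?thesis by simp
  next
    case 3
    then have "anti_standard_angle n N \<mu> i \<le> pi" "pi \<le> anti_standard_angle n N \<mu> j"
      using anti_standard_angle_bounds(3)[of i] anti_standard_angle_bounds(4)[of j] assms by auto
    then show ?thesis by simp
  next
    case 4
    have "anti_standard_angle n N \<mu> i = 2 * pi - arccos (- \<mu> (i - N))"
      "anti_standard_angle n N \<mu> j = 2 * pi - arccos (- \<mu> (j - N))"
      using 4 assms by (auto intro!: anti_standard_angle_eqs(3))
    then show ?thesis
      using 4 assms n arccos_mu_le(4)[of "j - N" "i - N"] mu_antimonoD[of "i - N" "j - N"] by auto
  next
    case 5
    then have "anti_standard_angle n N \<mu> j = 2 * pi"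
      using assms by (auto intro!: anti_standard_angle_eqs(4))
    then show ?thesis using anti_standard_angle_bounds(2)[of i] assms by simp
  qed
qed

text \<open>For n \<le> i \<le> N + 1 the anti-standard angle is at most pi and the standard one at
  least pi; for i > N + n - 2 the standard angle is 2 pi. Only two ranges carry a condition: i \<le>
  n - 1 gives the first family with j = i + 1, and N + 2 \<le> i \<le> N + n - 2 gives the second
  with j = i - N.\<close>

lemma angle_comparison:
  "(\<forall>i. 1 \<le> i \<and> i \<le> 2 * N \<longrightarrow> anti_standard_angle n N \<mu> i \<le> standard_angle n N \<mu> i) \<longleftrightarrow>
     (\<forall>j. 2 \<le> j \<and> j \<le> n \<longrightarrow> \<mu> j \<le> - \<mu> (n + 2 - j)) \<and>
     (\<forall>j. 2 \<le> j \<and> j \<le> n - 2 \<longrightarrow> \<mu> j \<ge> - \<mu> (n - j))"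
    (is "?L \<longleftrightarrow> ?R1 \<and> ?R2")
proof
  assume L: ?L
  have "\<mu> j \<le> - \<mu> (n + 2 - j)" if j: "2 \<le> j" "j \<le> n" for j
  proof -
    have i: "j - 1 \<le> n - 1" "n + 1 - (j - 1) = n + 2 - j" "j - 1 + 1 = j" using j by auto
    have "anti_standard_angle n N \<mu> (j - 1) \<le> standard_angle n N \<mu> (j - 1)"
      using j n by (intro L[rule_format]) auto
    then have "arccos (- \<mu> (n + 2 - j)) \<le> arccos (\<mu> j)"
      unfolding anti_standard_angle_eqs(1)[OF i(1)] standard_angle_eqs(1)[OF i(1)] i(2,3) .
    then show ?thesis
      using j arccos_mu_le(2)[of "n + 2 - j" j] by auto
  qed
  moreover have "\<mu> j \<ge> - \<mu> (n - j)" if j: "2 \<le> j" "j \<le> n - 2" for j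
  proof -
    have i: "N + 1 < N + j" "N + j \<le> N + n" "N - 1 < N + j" "N + j \<le> N + n - 2"
      "N + j - N = j" "N + n - (N + j) = n - j" using j n by auto
    have "anti_standard_angle n N \<mu> (N + j) \<le> standard_angle n N \<mu> (N + j)"
      using j n by (intro L[rule_format]) auto
    then have "arccos (\<mu> (n - j)) \<le> arccos (- \<mu> j)"
      unfolding anti_standard_angle_eqs(3)[OF i(1,2)] standard_angle_eqs(3)[OF i(3,4)] i(5,6) by simp
    then show ?thesis
      using j arccos_mu_le(3)[of "n - j" j] by auto
  qed
  ultimately show "?R1 \<and> ?R2" by blast
next
  assume R: "?R1 \<and> ?R2"
  show ?L
  proof (intro allI impI)
    fix i assume i: "1 \<le> i \<and> i \<le> 2 * N"
    consider "i \<le> n - 1" | "n - 1 < i" "i \<le> N + 1"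
      | "N + 1 < i" "i \<le> N + n - 2" | "N + 1 < i" "N + n - 2 < i" by linarith
    then show "anti_standard_angle n N \<mu> i \<le> standard_angle n N \<mu> i"
    proof cases
      case 1
      have e: "n + 2 - (i + 1) = n + 1 - i" by simp
      have "\<mu> (i + 1) \<le> - \<mu> (n + 2 - (i + 1))"
        by (rule R[THEN conjunct1, rule_format]) (use 1 i in auto)
      then show ?thesis
        unfolding anti_standard_angle_eqs(1)[OF 1] standard_angle_eqs(1)[OF 1] e
        using 1 i by (subst arccos_mu_le(2)) auto
    next
      case 2
      then show ?thesis
        using anti_standard_angle_bounds(3)[of i] standard_angle_bounds(4)[of i] i by simp
    next
      case 3
      have j: "2 \<le> i - N" "i - N \<le> n - 2" "n - (i - N) = N + n - i" "N - 1 < i" "i \<le> N + n"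
        using 3 by auto
      then have "\<mu> (i - N) \<ge> - \<mu> (N + n - i)" using R by metis
      then have "arccos (\<mu> (N + n - i)) \<le> arccos (- \<mu> (i - N))"
        using 3 j by (subst arccos_mu_le(3)) linarith+
      then show ?thesis
        unfolding anti_standard_angle_eqs(3)[OF 3(1) j(5)] standard_angle_eqs(3)[OF j(4) 3(2)] by simp
    next
      case 4
      then have "standard_angle n N \<mu> i = 2 * pi" by (intro standard_angle_eqs(4)) auto
      then show ?thesis using anti_standard_angle_bounds(2)[of i] i by simp
    qed
  qed
qed

lemma standard_angle_strict:
  assumes "1 \<le> i"
  shows "i \<le> n - 1 \<Longrightarrow> standard_angle n N \<mu> i < pi" "N - 1 < i \<Longrightarrow> pi < standard_angle n N \<mu> i"
    "i \<le> N + n - 2 \<Longrightarrow> standard_angle n N \<mu> i < 2 * pi"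
proof -
  show 1: "standard_angle n N \<mu> i < pi" if i: "i \<le> n - 1"
  proof -
    have "2 \<le> i + 1" "i + 1 \<le> n" using assms i by auto
    from arccos_mu[OF this] show ?thesis unfolding standard_angle_eqs(1)[OF i] by simp
  qed
  have 3: "pi < standard_angle n N \<mu> i \<and> standard_angle n N \<mu> i < 2 * pi" if i: "N - 1 < i" "i \<le> N + n - 2"
  proof -
    have "2 \<le> N + n - i" "N + n - i \<le> n" using i n by auto
    from arccos_mu[OF this] show ?thesis unfolding standard_angle_eqs(3)[OF i] by simp
  qed
  show "pi < standard_angle n N \<mu> i" if i: "N - 1 < i"
  proof (cases "i \<le> N + n - 2")
    case False
    then have "N + n - 2 < i" by simp
    then show ?thesis unfolding standard_angle_eqs(4)[OF i \<open>N + n - 2 < i\<close>] by simp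
  qed (use 3 i in blast)
  show "standard_angle n N \<mu> i < 2 * pi" if "i \<le> N + n - 2"
  proof (cases "i \<le> N - 1")
    case True
    have "standard_angle n N \<mu> i \<le> pi" by (rule standard_angle_bounds(3)[OF assms True])
    then show ?thesis using pi_gt_zero by linarith
  next
    case False
    then show ?thesis using 3 that by simp
  qed
qed

lemma anti_standard_angle_strict:
  assumes "1 \<le> i"
  shows "i \<le> n - 1 \<Longrightarrow> anti_standard_angle n N \<mu> i < pi" "N + 1 < i \<Longrightarrow> pi < anti_standard_angle n N \<mu> i"
    "i \<le> N + n \<Longrightarrow> anti_standard_angle n N \<mu> i < 2 * pi"
proof -
  show 1: "anti_standard_angle n N \<mu> i < pi" if i: "i \<le> n - 1"
  proof -
    have "2 \<le> n + 1 - i" "n + 1 - i \<le> n" using assms i by auto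
    from arccos_mu[OF this] show ?thesis unfolding anti_standard_angle_eqs(1)[OF i] by simp
  qed
  have 3: "pi < anti_standard_angle n N \<mu> i \<and> anti_standard_angle n N \<mu> i < 2 * pi" if i: "N + 1 < i" "i \<le> N + n"
  proof -
    have "2 \<le> i - N" "i - N \<le> n" using i n by auto
    from arccos_mu[OF this] show ?thesis unfolding anti_standard_angle_eqs(3)[OF i] by simp
  qed
  show "pi < anti_standard_angle n N \<mu> i" if i: "N + 1 < i"
  proof (cases "i \<le> N + n")
    case False
    then have "N + n < i" by simp
    then show ?thesis unfolding anti_standard_angle_eqs(4)[OF i \<open>N + n < i\<close>] by simp
  qed (use 3 i in blast)
  show "anti_standard_angle n N \<mu> i < 2 * pi" if "i \<le> N + n"
  proof (cases "i \<le> N + 1")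
    case True
    have "anti_standard_angle n N \<mu> i \<le> pi" by (rule anti_standard_angle_bounds(3)[OF assms True])
    then show ?thesis using pi_gt_zero by linarith
  next
    case False
    then show ?thesis using 3 that by simp
  qed
qed

lemma arccos_mu_eq:
  assumes "2 \<le> j" "j \<le> n"
  shows "0 < t \<Longrightarrow> t < pi \<Longrightarrow> arccos (\<mu> j) = t \<longleftrightarrow> \<mu> j = cos t"
    "0 < t \<Longrightarrow> t < pi \<Longrightarrow> arccos (- \<mu> j) = t \<longleftrightarrow> \<mu> j = - cos t"
    "pi < t \<Longrightarrow> t < 2 * pi \<Longrightarrow> 2 * pi - arccos (\<mu> j) = t \<longleftrightarrow> \<mu> j = cos t"
    "pi < t \<Longrightarrow> t < 2 * pi \<Longrightarrow> 2 * pi - arccos (- \<mu> j) = t \<longleftrightarrow> \<mu> j = - cos t"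
proof -
  have *: "arccos y = s \<longleftrightarrow> y = cos s" if "\<bar>y\<bar> < 1" "0 < s" "s < pi" for y s
    using that arccos_cos[of s] cos_arccos[of y] by auto
  note mu = mu_abs_lessD[OF assms]
  show 1: "arccos (\<mu> j) = t \<longleftrightarrow> \<mu> j = cos t" if "0 < t" "t < pi" for t
    using *[of "\<mu> j"] mu that by simp
  show 2: "arccos (- \<mu> j) = t \<longleftrightarrow> \<mu> j = - cos t" if "0 < t" "t < pi" for t
  proof -
    have "arccos (- \<mu> j) = t \<longleftrightarrow> - \<mu> j = cos t"
      using mu that by (intro *) auto
    then show ?thesis using minus_equation_iff[of "\<mu> j" "cos t"] by metis
  qed
  have c: "cos (2 * pi - t) = cos t" by (simp add: cos_diff)
  show "2 * pi - arccos (\<mu> j) = t \<longleftrightarrow> \<mu> j = cos t" if "pi < t" "t < 2 * pi"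
  proof -
    have "2 * pi - arccos (\<mu> j) = t \<longleftrightarrow> arccos (\<mu> j) = 2 * pi - t" by auto
    then show ?thesis using 1[of "2 * pi - t"] that unfolding c by simp
  qed
  show "2 * pi - arccos (- \<mu> j) = t \<longleftrightarrow> \<mu> j = - cos t" if "pi < t" "t < 2 * pi"
  proof -
    have "2 * pi - arccos (- \<mu> j) = t \<longleftrightarrow> arccos (- \<mu> j) = 2 * pi - t" by auto
    then show ?thesis using 2[of "2 * pi - t"] that unfolding c by simp
  qed
qed

text \<open>Below pi the index \<open>j\<close> sits at position j - 1, above pi at position N + n -
  j, so in each half an explicit bijection matches the counts. The index 1 has no position, but
  \<open>\<mu> 1 = 1\<close> would require cos t = 1, which is impossible inside the period.\<close>

lemma standard_angle_count:
  assumes t: "0 < t" "t < 2 * pi" "t \<noteq> pi"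
  shows "card {i \<in> {1..2 * N}. standard_angle n N \<mu> i = t} = card {j \<in> {1..n}. \<mu> j = cos t}"
proof -
  have two: "2 \<le> j" if "j \<in> {j \<in> {1..n}. \<mu> j = cos t}" for j
  proof (rule ccontr)
    assume "\<not> 2 \<le> j"
    then have "j = 1" using that by auto
    then have "cos t = cos 0" using that mu_1 by simp
    moreover have "cos t < 1"
    proof -
      have "cos t \<noteq> 1"
      proof
        assume "cos t = 1"
        then obtain k :: int where "t = real_of_int k * 2 * pi" using cos_one_2pi_int by blast
        then have "0 < k" "k < 1" using t(1,2) by (simp_all add: zero_less_mult_iff)
        then show False by simp
      qed
      then show ?thesis using cos_le_one[of t] by linarith
    qed
    ultimately show False by simp
  qed
  show ?thesis
  proof (cases "t < pi")
    case True
    have 1: "i \<le> n - 1 \<and> \<mu> (i + 1) = cos t" if "1 \<le> i" "standard_angle n N \<mu> i = t" for i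
    proof -
      have i: "i \<le> n - 1" using standard_angle_bounds(4)[OF that(1)] that(2) True by force
      then have "2 \<le> i + 1" "i + 1 \<le> n" using that(1) by auto
      from arccos_mu_eq(1)[OF this t(1) True] show ?thesis
        using that(2) i unfolding standard_angle_eqs(1)[OF i] by simp
    qed
    have 2: "standard_angle n N \<mu> (j - 1) = t" if j: "2 \<le> j" "j \<le> n" "\<mu> j = cos t" for j
    proof -
      have e: "j - 1 \<le> n - 1" "j - 1 + 1 = j" using j by auto
      show ?thesis unfolding standard_angle_eqs(1)[OF e(1)] e(2) arccos_mu_eq(1)[OF j(1,2) t(1) True] by (rule j)
    qed
    show ?thesis
    proof (rule bij_betw_same_card[OF bij_betw_byWitness[where f = "\<lambda>i. i + 1" and f' = "\<lambda>j. j - 1"]])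
      show "(\<lambda>i. i + 1) ` {i \<in> {1..2 * N}. standard_angle n N \<mu> i = t} \<subseteq> {j \<in> {1..n}. \<mu> j = cos t}"
        using 1 by fastforce
      show "(\<lambda>j. j - 1) ` {j \<in> {1..n}. \<mu> j = cos t} \<subseteq> {i \<in> {1..2 * N}. standard_angle n N \<mu> i = t}"
      proof (rule image_subsetI)
        fix j assume j: "j \<in> {j \<in> {1..n}. \<mu> j = cos t}"
        then show "j - 1 \<in> {i \<in> {1..2 * N}. standard_angle n N \<mu> i = t}"
          using two[OF j] 2[of j] n by auto
      qed
    qed auto
  next
    case False
    then have tp: "pi < t" using t(3) by simp
    have 1: "N - 1 < i \<and> i \<le> N + n - 2 \<and> \<mu> (N + n - i) = cos t" if "1 \<le> i" "standard_angle n N \<mu> i = t" for i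
    proof -
      have i: "N - 1 < i" using standard_angle_bounds(3)[OF that(1)] that(2) tp by force
      have i': "i \<le> N + n - 2" using standard_angle_eqs(4)[OF i] that(2) t(2) by force
      have "2 \<le> N + n - i" "N + n - i \<le> n" using i i' n by auto
      from arccos_mu_eq(3)[OF this tp t(2)] show ?thesis
        using that(2) i i' unfolding standard_angle_eqs(3)[OF i i'] by simp
    qed
    have 2: "standard_angle n N \<mu> (N + n - j) = t" if j: "2 \<le> j" "j \<le> n" "\<mu> j = cos t" for j
    proof -
      have e: "N - 1 < N + n - j" "N + n - j \<le> N + n - 2" "N + n - (N + n - j) = j" using j n by auto
      show ?thesis unfolding standard_angle_eqs(3)[OF e(1,2)] e(3) arccos_mu_eq(3)[OF j(1,2) tp t(2)] by (rule j)
    qed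
    show ?thesis
    proof (rule bij_betw_same_card[OF bij_betw_byWitness[where f = "\<lambda>i. N + n - i" and f' = "\<lambda>j. N + n - j"]])
      show "\<forall>i\<in>{i \<in> {1..2 * N}. standard_angle n N \<mu> i = t}. N + n - (N + n - i) = i"
        using 1 by fastforce
      show "(\<lambda>i. N + n - i) ` {i \<in> {1..2 * N}. standard_angle n N \<mu> i = t} \<subseteq> {j \<in> {1..n}. \<mu> j = cos t}"
      proof (rule image_subsetI)
        fix i assume "i \<in> {i \<in> {1..2 * N}. standard_angle n N \<mu> i = t}"
        then show "N + n - i \<in> {j \<in> {1..n}. \<mu> j = cos t}" using 1[of i] n by auto
      qed
      show "(\<lambda>j. N + n - j) ` {j \<in> {1..n}. \<mu> j = cos t} \<subseteq> {i \<in> {1..2 * N}. standard_angle n N \<mu> i = t}"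
      proof (rule image_subsetI)
        fix j assume j: "j \<in> {j \<in> {1..n}. \<mu> j = cos t}"
        then show "N + n - j \<in> {i \<in> {1..2 * N}. standard_angle n N \<mu> i = t}"
          using two[OF j] 2[of j] n by auto
      qed
    qed auto
  qed
qed

lemma anti_standard_angle_count:
  assumes t: "0 < t" "t < 2 * pi" "t \<noteq> pi"
  shows "card {i \<in> {1..2 * N}. anti_standard_angle n N \<mu> i = t} = card {j \<in> {1..n}. \<mu> j = - cos t}"
proof -
  \<comment> \<open>Here the index 1 would force cos t = -1, that is t = pi, the angle excluded by
    assumption.\<close>
  have two: "2 \<le> j" if "j \<in> {j \<in> {1..n}. \<mu> j = - cos t}" for j
  proof (rule ccontr)
    assume "\<not> 2 \<le> j"
    then have "j = 1" using that by auto
    then have "cos t = - 1" using that mu_1 by simp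
    then have "cos (t - pi) = 1" by (simp add: cos_diff)
    then obtain k :: int where "t - pi = real_of_int k * 2 * pi" using cos_one_2pi_int by blast
    moreover from this have "2 * real_of_int k * pi < 1 * pi" "- 1 * pi < 2 * real_of_int k * pi"
      using t by (simp_all add: algebra_simps)
    then have "2 * real_of_int k < 1" "- 1 < 2 * real_of_int k"
      using pi_gt_zero mult_less_cancel_right_pos by blast+
    then have "k = 0" by linarith
    ultimately show False using t(3) by simp
  qed
  show ?thesis
  proof (cases "t < pi")
    case True
    have 1: "i \<le> n - 1 \<and> \<mu> (n + 1 - i) = - cos t" if "1 \<le> i" "anti_standard_angle n N \<mu> i = t" for i
    proof -
      have i: "i \<le> n - 1" using anti_standard_angle_bounds(4)[OF that(1)] that(2) True by force
      then have "2 \<le> n + 1 - i" "n + 1 - i \<le> n" using that(1) by auto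
      from arccos_mu_eq(2)[OF this t(1) True] show ?thesis
        using that(2) i unfolding anti_standard_angle_eqs(1)[OF i] by simp
    qed
    have 2: "anti_standard_angle n N \<mu> (n + 1 - j) = t" if j: "2 \<le> j" "j \<le> n" "\<mu> j = - cos t" for j
    proof -
      have e: "n + 1 - j \<le> n - 1" "n + 1 - (n + 1 - j) = j" using j by auto
      show ?thesis unfolding anti_standard_angle_eqs(1)[OF e(1)] e(2) arccos_mu_eq(2)[OF j(1,2) t(1) True] by (rule j)
    qed
    show ?thesis
    proof (rule bij_betw_same_card[OF bij_betw_byWitness[where f = "\<lambda>i. n + 1 - i" and f' = "\<lambda>j. n + 1 - j"]])
      show "\<forall>i\<in>{i \<in> {1..2 * N}. anti_standard_angle n N \<mu> i = t}. n + 1 - (n + 1 - i) = i"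
        using 1 by fastforce
      show "(\<lambda>i. n + 1 - i) ` {i \<in> {1..2 * N}. anti_standard_angle n N \<mu> i = t} \<subseteq> {j \<in> {1..n}. \<mu> j = - cos t}"
      proof (rule image_subsetI)
        fix i assume "i \<in> {i \<in> {1..2 * N}. anti_standard_angle n N \<mu> i = t}"
        then show "n + 1 - i \<in> {j \<in> {1..n}. \<mu> j = - cos t}" using 1[of i] n by auto
      qed
      show "(\<lambda>j. n + 1 - j) ` {j \<in> {1..n}. \<mu> j = - cos t} \<subseteq> {i \<in> {1..2 * N}. anti_standard_angle n N \<mu> i = t}"
      proof (rule image_subsetI)
        fix j assume j: "j \<in> {j \<in> {1..n}. \<mu> j = - cos t}"
        then show "n + 1 - j \<in> {i \<in> {1..2 * N}. anti_standard_angle n N \<mu> i = t}"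
          using two[OF j] 2[of j] n by auto
      qed
    qed auto
  next
    case False
    then have tp: "pi < t" using t(3) by simp
    have 1: "N + 1 < i \<and> i \<le> N + n \<and> \<mu> (i - N) = - cos t" if "1 \<le> i" "anti_standard_angle n N \<mu> i = t" for i
    proof -
      have i: "N + 1 < i" using anti_standard_angle_bounds(3)[OF that(1)] that(2) tp by force
      have i': "i \<le> N + n" using anti_standard_angle_eqs(4)[OF i] that(2) t(2) by force
      have "2 \<le> i - N" "i - N \<le> n" using i i' n by auto
      from arccos_mu_eq(4)[OF this tp t(2)] show ?thesis
        using that(2) i i' unfolding anti_standard_angle_eqs(3)[OF i i'] by simp
    qed
    have 2: "anti_standard_angle n N \<mu> (j + N) = t" if j: "2 \<le> j" "j \<le> n" "\<mu> j = - cos t" for j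
    proof -
      have e: "N + 1 < j + N" "j + N \<le> N + n" "j + N - N = j" using j n by auto
      show ?thesis unfolding anti_standard_angle_eqs(3)[OF e(1,2)] e(3) arccos_mu_eq(4)[OF j(1,2) tp t(2)] by (rule j)
    qed
    show ?thesis
    proof (rule bij_betw_same_card[OF bij_betw_byWitness[where f = "\<lambda>i. i - N" and f' = "\<lambda>j. j + N"]])
      show "\<forall>i\<in>{i \<in> {1..2 * N}. anti_standard_angle n N \<mu> i = t}. i - N + N = i"
        using 1 by fastforce
      show "(\<lambda>i. i - N) ` {i \<in> {1..2 * N}. anti_standard_angle n N \<mu> i = t} \<subseteq> {j \<in> {1..n}. \<mu> j = - cos t}"
      proof (rule image_subsetI)
        fix i assume "i \<in> {i \<in> {1..2 * N}. anti_standard_angle n N \<mu> i = t}"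
        then show "i - N \<in> {j \<in> {1..n}. \<mu> j = - cos t}" using 1[of i] n by auto
      qed
      show "(\<lambda>j. j + N) ` {j \<in> {1..n}. \<mu> j = - cos t} \<subseteq> {i \<in> {1..2 * N}. anti_standard_angle n N \<mu> i = t}"
      proof (rule image_subsetI)
        fix j assume j: "j \<in> {j \<in> {1..n}. \<mu> j = - cos t}"
        then show "j + N \<in> {i \<in> {1..2 * N}. anti_standard_angle n N \<mu> i = t}"
          using two[OF j] 2[of j] n by auto
      qed
    qed auto
  qed
qed

lemma standard_angle_count_resonant:
  "card {i \<in> {1..2 * N}. standard_angle n N \<mu> i = pi} = N - n"
  "card {i \<in> {1..2 * N}. standard_angle n N \<mu> i = 2 * pi} = N + 2 - n"
proof -
  have "standard_angle n N \<mu> i = pi \<longleftrightarrow> n - 1 < i \<and> i \<le> N - 1" if "1 \<le> i" for i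
    using standard_angle_strict(1,2)[OF that] standard_angle_eqs(2)[of i] by force
  then have "{i \<in> {1..2 * N}. standard_angle n N \<mu> i = pi} = {i \<in> {1..2 * N}. n - 1 < i \<and> i \<le> N - 1}"
    by auto
  also have "\<dots> = {n..N - 1}" using n by auto
  finally have "{i \<in> {1..2 * N}. standard_angle n N \<mu> i = pi} = {n..N - 1}" .
  then show "card {i \<in> {1..2 * N}. standard_angle n N \<mu> i = pi} = N - n" using n by simp
  have "standard_angle n N \<mu> i = 2 * pi \<longleftrightarrow> N + n - 2 < i" if i: "1 \<le> i" for i
  proof (cases "N + n - 2 < i")
    case True
    then have "N - 1 < i" using i n by linarith
    then show ?thesis using standard_angle_eqs(4)[OF _ True] True by simp
  next
    case False
    then show ?thesis using standard_angle_strict(3)[OF i] by simp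
  qed
  then have "{i \<in> {1..2 * N}. standard_angle n N \<mu> i = 2 * pi} = {i \<in> {1..2 * N}. N + n - 2 < i}"
    by auto
  also have "\<dots> = {N + n - 1..2 * N}" using n by auto
  finally have "{i \<in> {1..2 * N}. standard_angle n N \<mu> i = 2 * pi} = {N + n - 1..2 * N}" .
  then show "card {i \<in> {1..2 * N}. standard_angle n N \<mu> i = 2 * pi} = N + 2 - n" using n by simp
qed

lemma anti_standard_angle_count_resonant:
  "card {i \<in> {1..2 * N}. anti_standard_angle n N \<mu> i = pi} = N + 2 - n"
  "card {i \<in> {1..2 * N}. anti_standard_angle n N \<mu> i = 2 * pi} = N - n"
proof -
  have "anti_standard_angle n N \<mu> i = pi \<longleftrightarrow> n - 1 < i \<and> i \<le> N + 1" if "1 \<le> i" for i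
    using anti_standard_angle_strict(1,2)[OF that] anti_standard_angle_eqs(2)[of i] by force
  then have "{i \<in> {1..2 * N}. anti_standard_angle n N \<mu> i = pi} = {i \<in> {1..2 * N}. n - 1 < i \<and> i \<le> N + 1}"
    by auto
  also have "\<dots> = {n..N + 1}" using n by auto
  finally have "{i \<in> {1..2 * N}. anti_standard_angle n N \<mu> i = pi} = {n..N + 1}" .
  then show "card {i \<in> {1..2 * N}. anti_standard_angle n N \<mu> i = pi} = N + 2 - n" using n by simp
  have "anti_standard_angle n N \<mu> i = 2 * pi \<longleftrightarrow> N + n < i" if "1 \<le> i" for i
    using anti_standard_angle_strict(3)[OF that(1)] anti_standard_angle_eqs(4)[of i] n by force
  then have "{i \<in> {1..2 * N}. anti_standard_angle n N \<mu> i = 2 * pi} = {i \<in> {1..2 * N}. N + n < i}"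
    by auto
  also have "\<dots> = {N + n + 1..2 * N}" by auto
  finally have "{i \<in> {1..2 * N}. anti_standard_angle n N \<mu> i = 2 * pi} = {N + n + 1..2 * N}" .
  then show "card {i \<in> {1..2 * N}. anti_standard_angle n N \<mu> i = 2 * pi} = N - n" using n by simp
qed

end

section \<open>Comparison of the two operators\<close>

lemma cos_sin_shift:
  "cos (t + 2 * pi * real q) = cos t" "sin (t + 2 * pi * real q) = sin t"
proof -
  have q: "2 * pi * real q = 2 * real q * pi" by simp
  show "cos (t + 2 * pi * real q) = cos t" "sin (t + 2 * pi * real q) = sin t"
    unfolding q cos_add sin_add cos_2npi sin_2npi by simp_all
qed

lemma csol_ssol_pos:
  assumes "0 < l" "0 < \<alpha>"
  shows "csol ((\<alpha> / l)\<^sup>2) l = cos \<alpha>" "ssol ((\<alpha> / l)\<^sup>2) l = sin \<alpha> * l / \<alpha>"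
  using assms by (simp_all add: csol_def ssol_def not_less)

text \<open>Negative \<open>x\<close> are never resonant, and the corresponding vertex eigenvalue
  lies outside [-1, 1]. This is how negative eigenvalues are excluded for both operators.\<close>

lemma csol_ssol_neg:
  assumes "0 < l" "x < 0"
  shows "1 < csol x l" "ssol x l \<noteq> 0"
proof -
  have "0 < sqrt (- x) * l" using assms by simp
  then have "1 < cosh (sqrt (- x) * l)" "sinh (sqrt (- x) * l) \<noteq> 0"
    using cosh_real_strict_mono[of 0 "sqrt (- x) * l"] by auto
  then show "1 < csol x l" "ssol x l \<noteq> 0"
    using assms by (auto simp: csol_def ssol_def)
qed

context metric_graph
begin

lemma dim_vertex_eigenspace_eq_0:
  assumes "\<not> bipartite G" "\<bar>c\<bar> \<ge> 1" "c \<noteq> 1"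
  shows "fs.dim (vertex_eigenspace G c) = 0"
proof -
  have eq: "vertex_eigenspace G c = {0}"
  proof (intro equalityI subsetI)
    fix \<phi> assume "\<phi> \<in> vertex_eigenspace G c"
    then have "\<phi> = 0" by (rule vertex_eigenspace_eq_0[OF assms])
    then show "\<phi> \<in> {0}" by simp
  qed (use fs.subspace_0[OF subspace_vertex_eigenspace] in simp)
  show ?thesis
    unfolding eq by (rule fs.dim_unique[of "{}"]) (simp_all add: fs.independent_empty)
qed

lemma card_verts_le_card_arcs: "\<not> bipartite G \<Longrightarrow> card (verts G) \<le> card (arcs G)"
  using dim_unsigned_circulations by force

context
  fixes l
  assumes len_eq: "\<forall>e\<in>arcs G. len e = l" and nb: "\<not> bipartite G"
begin

lemma multiplicity_standard_nonresonant:
  assumes "ssol x l \<noteq> 0"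
  shows "eigenvalue_multiplicity (standard_laplace G len) x = fs.dim (vertex_eigenspace G (csol x l))"
  unfolding multiplicity_standard[OF len_eq]
proof (rule dim_edge_data_nonresonant)
  show "(complex_of_real (csol x l))\<^sup>2 + complex_of_real (x * ssol x l) * complex_of_real (ssol x l) = 1"
    using arg_cong[OF csol_ssol_pythagoras[of x l], of complex_of_real]
    by (simp add: power2_eq_square mult.assoc)
qed (use assms in simp)

lemma multiplicity_standard_resonant:
  assumes "ssol x l = 0"
  shows "csol x l = 1 \<Longrightarrow>
      eigenvalue_multiplicity (standard_laplace G len) x = card (arcs G) + 2 - card (verts G)"
    "csol x l = - 1 \<Longrightarrow>
      eigenvalue_multiplicity (standard_laplace G len) x = card (arcs G) - card (verts G)"
  unfolding multiplicity_standard[OF len_eq]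
  using assms dim_edge_data_constant dim_edge_data_alternating[OF nb, of 0] by simp_all

lemma multiplicity_anti_standard_nonresonant:
  assumes "x * ssol x l \<noteq> 0"
  shows "eigenvalue_multiplicity (anti_standard_laplace G len) x = fs.dim (vertex_eigenspace G (- csol x l))"
proof -
  have "fs.dim (edge_data G (complex_of_real (- csol x l)) (complex_of_real (x * ssol x l)) (complex_of_real (ssol x l)))
      = fs.dim (vertex_eigenspace G (- csol x l))"
  proof (rule dim_edge_data_nonresonant)
    show "(complex_of_real (- csol x l))\<^sup>2 + complex_of_real (ssol x l) * complex_of_real (x * ssol x l) = 1"
      using arg_cong[OF csol_ssol_pythagoras[of x l], of complex_of_real]
      by (simp add: power2_eq_square mult.left_commute)
  qed (use assms in simp)
  then show ?thesis
    unfolding multiplicity_anti_standard[OF len_eq] by simp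
qed

text \<open>The product \<open>x * ssol x l\<close> also vanishes at \<open>x = 0\<close>, where
  \<open>ssol x l\<close> is the edge length; the first case therefore covers the eigenvalue 0. In
  the second case the count of constant data requires the third coefficient to vanish, hence the
  condition on \<open>ssol x l\<close>.\<close>

lemma multiplicity_anti_standard_resonant:
  assumes "x * ssol x l = 0"
  shows "csol x l = 1 \<Longrightarrow>
      eigenvalue_multiplicity (anti_standard_laplace G len) x = card (arcs G) - card (verts G)"
    "csol x l = - 1 \<Longrightarrow> ssol x l = 0 \<Longrightarrow>
      eigenvalue_multiplicity (anti_standard_laplace G len) x = card (arcs G) + 2 - card (verts G)"
proof -
  show "eigenvalue_multiplicity (anti_standard_laplace G len) x = card (arcs G) - card (verts G)"
    if "csol x l = 1"
    unfolding multiplicity_anti_standard[OF len_eq]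
    using assms that dim_edge_data_alternating[OF nb, of "ssol x l"] by (cases "x = 0") simp_all
  show "eigenvalue_multiplicity (anti_standard_laplace G len) x = card (arcs G) + 2 - card (verts G)"
    if "csol x l = - 1" "ssol x l = 0"
    unfolding multiplicity_anti_standard[OF len_eq]
    using that dim_edge_data_constant by simp
qed

lemma angle_cases:
  assumes "0 < t" "t \<le> 2 * pi"
  obtains "t = pi" | "t = 2 * pi" | "t < 2 * pi" "t \<noteq> pi" "sin t \<noteq> 0"
proof -
  have "sin t \<noteq> 0" if "t < 2 * pi" "t \<noteq> pi"
    using sin_gt_zero[OF assms(1)] sin_lt_zero[of t] that by (cases "t < pi") auto
  then show ?thesis using that assms by fastforce
qed

section \<open>The ordered spectra in terms of the eigenvalues of the transition matrix\<close>

context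
  fixes n N :: nat and \<mu> :: "nat \<Rightarrow> real"
  assumes n: "n = card (verts G)" and N: "N = card (arcs G)"
    and dimVE: "\<And>c. fs.dim (vertex_eigenspace G c) = card {j \<in> {1..n}. \<mu> j = c}"
    and mu_antimono: "\<forall>i j. 1 \<le> i \<and> i \<le> j \<and> j \<le> n \<longrightarrow> \<mu> j \<le> \<mu> i"
begin

text \<open>Each \<open>\<mu> j\<close> occurs in its own count, so its eigenspace is nonzero,
  whereas the eigenspaces outside (-1, 1] are trivial.\<close>

lemma transition_eigenvalue_bound:
  assumes "1 \<le> j" "j \<le> n"
  shows "\<bar>\<mu> j\<bar> < 1 \<or> \<mu> j = 1"
proof (rule ccontr)
  assume "\<not> (\<bar>\<mu> j\<bar> < 1 \<or> \<mu> j = 1)"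
  then have "card {i \<in> {1..n}. \<mu> i = \<mu> j} = 0"
    unfolding dimVE[symmetric] by (intro dim_vertex_eigenspace_eq_0[OF nb]) auto
  then show False using assms by (auto simp: card_eq_0_iff)
qed

text \<open>The eigenvalue 1 has multiplicity one, because only constants belong to it, and no
  eigenvalue exceeds it. It therefore takes index 1 in the ordered list and no other index.\<close>

lemma transition_eigenvalue_1: "\<mu> 1 = 1"
  and transition_eigenvalue_less: "\<forall>j. 2 \<le> j \<and> j \<le> n \<longrightarrow> \<bar>\<mu> j\<bar> < 1"
proof -
  have "card {j \<in> {1..n}. \<mu> j = 1} = 1"
    using dim_vertex_eigenspace_1 unfolding dimVE .
  then obtain i where i: "{j \<in> {1..n}. \<mu> j = 1} = {i}"
    by (rule card_1_singletonE)
  have "i \<in> {j \<in> {1..n}. \<mu> j = 1}" unfolding i by simp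
  then have i1: "1 \<le> i" "i \<le> n" "\<mu> i = 1" by simp_all
  have "\<mu> i \<le> \<mu> 1" using mu_antimono i1(1,2) by blast
  then show mu1: "\<mu> 1 = 1"
    using transition_eigenvalue_bound[of 1] i1 by linarith
  show "\<forall>j. 2 \<le> j \<and> j \<le> n \<longrightarrow> \<bar>\<mu> j\<bar> < 1"
  proof (intro allI impI)
    fix j assume j: "2 \<le> j \<and> j \<le> n"
    show "\<bar>\<mu> j\<bar> < 1"
    proof (rule ccontr)
      assume "\<not> \<bar>\<mu> j\<bar> < 1"
      then have "\<mu> j = 1" using transition_eigenvalue_bound[of j] j by auto
      then have "j \<in> {i}" "1 \<in> {i}" unfolding i[symmetric] using mu1 j by auto
      then show False using j by simp
    qed
  qed
qed

lemma n_bounds: "1 \<le> n" "n \<le> N"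
  using card_verts_pos card_verts_le_card_arcs[OF nb] by (simp_all add: n N)

lemmas angle_facts = n_bounds mu_antimono transition_eigenvalue_1 transition_eigenvalue_less

lemma eigenvalue_sequence_standard:
  "eigenvalue_sequence (standard_laplace G len)
     (\<lambda>k. (periodic_angle 1 (2 * N) (standard_angle n N \<mu>) k / l)\<^sup>2)"
proof (rule eigenvalue_sequence_periodic)
  note l = l_pos[OF len_eq]
  show "0 < l" by (rule l)
  show "0 < 2 * N" using n_bounds by simp
  show "standard_angle n N \<mu> i \<le> standard_angle n N \<mu> j" if "1 \<le> i" "i \<le> j" "j \<le> 2 * N" for i j
    by (rule standard_angle_mono[OF angle_facts that])
  show "0 < standard_angle n N \<mu> i \<and> standard_angle n N \<mu> i \<le> 2 * pi" if "1 \<le> i" for i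
    using standard_angle_bounds(1,2)[OF angle_facts that] by blast
  show "eigenvalue_multiplicity (standard_laplace G len) x = 0" if "x < 0" for x
    using csol_ssol_neg[OF l that] multiplicity_standard_nonresonant[of x]
      dim_vertex_eigenspace_eq_0[OF nb, of "csol x l"] by simp
  \<comment> \<open>At 0 the value \<open>ssol 0 l = l\<close> is nonzero, so this is the
    nonresonant case with vertex eigenvalue 1, unlike the positive multiples of 2 pi.\<close>
  show "eigenvalue_multiplicity (standard_laplace G len) 0 = 1"
    using multiplicity_standard_nonresonant[of 0] dim_vertex_eigenspace_1 l
    by (simp add: csol_def ssol_def)
  fix t :: real and q :: nat assume t: "0 < t" "t \<le> 2 * pi"
  let ?x = "((t + 2 * pi * real q) / l)\<^sup>2"
  have pos: "0 < t + 2 * pi * real q" using t(1) by (simp add: add_pos_nonneg)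
  have c: "csol ?x l = cos t" and s: "ssol ?x l = 0 \<longleftrightarrow> sin t = 0"
    using csol_ssol_pos[OF l pos] l pos by (simp_all only: cos_sin_shift divide_eq_0_iff mult_eq_0_iff, auto)
  show "eigenvalue_multiplicity (standard_laplace G len) ?x = card {i \<in> {1..2 * N}. standard_angle n N \<mu> i = t}"
    using t
  proof (cases rule: angle_cases)
    case 1
    then show ?thesis
      using multiplicity_standard_resonant(2)[of ?x] standard_angle_count_resonant(1)[OF angle_facts] c s
      by (simp add: n N)
  next
    case 2
    then show ?thesis
      using multiplicity_standard_resonant(1)[of ?x] standard_angle_count_resonant(2)[OF angle_facts] c s
      by (simp add: n N)
  next
    case 3
    then show ?thesis
      using multiplicity_standard_nonresonant[of ?x] standard_angle_count[OF angle_facts t(1) 3(1,2)] c s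
      by (simp add: dimVE)
  qed
qed

lemma eigenvalue_sequence_anti_standard:
  "eigenvalue_sequence (anti_standard_laplace G len)
     (\<lambda>k. (periodic_angle (N - n) (2 * N) (anti_standard_angle n N \<mu>) k / l)\<^sup>2)"
proof (rule eigenvalue_sequence_periodic)
  note l = l_pos[OF len_eq]
  show "0 < l" by (rule l)
  show "0 < 2 * N" using n_bounds by simp
  show "anti_standard_angle n N \<mu> i \<le> anti_standard_angle n N \<mu> j" if "1 \<le> i" "i \<le> j" "j \<le> 2 * N" for i j
    by (rule anti_standard_angle_mono[OF angle_facts that])
  show "0 < anti_standard_angle n N \<mu> i \<and> anti_standard_angle n N \<mu> i \<le> 2 * pi" if "1 \<le> i" for i
    using anti_standard_angle_bounds(1,2)[OF angle_facts that] by blast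
  show "eigenvalue_multiplicity (anti_standard_laplace G len) x = 0" if "x < 0" for x
    using csol_ssol_neg[OF l that] multiplicity_anti_standard_nonresonant[of x] that
      dim_vertex_eigenspace_eq_0[OF nb, of "- csol x l"] by simp
  show "eigenvalue_multiplicity (anti_standard_laplace G len) 0 = N - n"
    using multiplicity_anti_standard_resonant(1)[of 0] by (simp add: csol_def n N)
  fix t :: real and q :: nat assume t: "0 < t" "t \<le> 2 * pi"
  let ?x = "((t + 2 * pi * real q) / l)\<^sup>2"
  have pos: "0 < t + 2 * pi * real q" using t(1) by (simp add: add_pos_nonneg)
  have c: "csol ?x l = cos t" and s: "ssol ?x l = 0 \<longleftrightarrow> sin t = 0"
    using csol_ssol_pos[OF l pos] l pos by (simp_all only: cos_sin_shift divide_eq_0_iff mult_eq_0_iff, auto)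
  show "eigenvalue_multiplicity (anti_standard_laplace G len) ?x = card {i \<in> {1..2 * N}. anti_standard_angle n N \<mu> i = t}"
    using t
  proof (cases rule: angle_cases)
    case 1
    then show ?thesis
      using multiplicity_anti_standard_resonant(2)[of ?x] anti_standard_angle_count_resonant(1)[OF angle_facts] c s
      by (simp add: n N)
  next
    case 2
    then show ?thesis
      using multiplicity_anti_standard_resonant(1)[of ?x] anti_standard_angle_count_resonant(2)[OF angle_facts] c s
      by (simp add: n N)
  next
    case 3
    have "?x \<noteq> 0" using pos l by simp
    then have "?x * ssol ?x l \<noteq> 0" using s 3(3) by simp
    then show ?thesis
      using multiplicity_anti_standard_nonresonant[of ?x] anti_standard_angle_count[OF angle_facts t(1) 3(1,2)] c
      by (simp add: dimVE)
  qed
qed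

text \<open>
  Dropping the eigenvalue \<open>0\<close> on both sides leaves two families of angles with the common
  period \<open>2 pi\<close>, which are compared term by term.
\<close>

lemma eigenvalue_comparison:
  "(\<forall>k\<ge>1. kth_eigenvalue (standard_laplace G len) (k + 1)
      \<ge> kth_eigenvalue (anti_standard_laplace G len) (k + N - n))
   \<longleftrightarrow> (\<forall>j. 2 \<le> j \<and> j \<le> n \<longrightarrow> \<mu> j \<le> - \<mu> (n + 2 - j)) \<and>
       (\<forall>j. 2 \<le> j \<and> j \<le> n - 2 \<longrightarrow> \<mu> j \<ge> - \<mu> (n - j))"
proof -
  note l = l_pos[OF len_eq]
  let ?\<theta> = "standard_angle n N \<mu>" and ?\<psi> = "anti_standard_angle n N \<mu>"
  have step: "kth_eigenvalue (standard_laplace G len) (k + 1)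
      \<ge> kth_eigenvalue (anti_standard_laplace G len) (k + N - n)
      \<longleftrightarrow> ?\<psi> ((k - 1) mod (2 * N) + 1) \<le> ?\<theta> ((k - 1) mod (2 * N) + 1)" if k: "1 \<le> k" for k
  proof -
    define d where "d = 2 * pi * real ((k - 1) div (2 * N))"
    define i where "i = (k - 1) mod (2 * N) + 1"
    have i: "1 \<le> i" by (simp add: i_def)
    have d: "0 \<le> d" by (simp add: d_def)
    \<comment> \<open>Since n \<le> N, no truncation of the natural number subtraction occurs. The
      shifts 1 and N - n skip exactly the zero eigenvalues of the two sequences, and the same
      position \<open>i\<close> and offset \<open>d\<close> serve both.\<close>
    have kN: "k + N - n = k + (N - n)" using n_bounds by simp
    have "kth_eigenvalue (standard_laplace G len) (k + 1) = ((?\<theta> i + d) / l)\<^sup>2"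
      using k by (subst kth_eigenvalue_eq[OF eigenvalue_sequence_standard])
        (simp_all add: periodic_angle_def i_def d_def)
    moreover have "kth_eigenvalue (anti_standard_laplace G len) (k + N - n) = ((?\<psi> i + d) / l)\<^sup>2"
      using k unfolding kN by (subst kth_eigenvalue_eq[OF eigenvalue_sequence_anti_standard])
        (simp_all add: periodic_angle_def i_def d_def)
    moreover have "((?\<psi> i + d) / l)\<^sup>2 \<le> ((?\<theta> i + d) / l)\<^sup>2 \<longleftrightarrow> (?\<psi> i + d) / l \<le> (?\<theta> i + d) / l"
      using standard_angle_bounds(1)[OF angle_facts i] anti_standard_angle_bounds(1)[OF angle_facts i] d l
      by (intro power_mono_iff) auto
    ultimately show ?thesis
      using l by (simp add: divide_le_cancel i_def)
  qed
  have "(\<forall>k\<ge>1. ?\<psi> ((k - 1) mod (2 * N) + 1) \<le> ?\<theta> ((k - 1) mod (2 * N) + 1))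
      \<longleftrightarrow> (\<forall>i. 1 \<le> i \<and> i \<le> 2 * N \<longrightarrow> ?\<psi> i \<le> ?\<theta> i)" (is "?L \<longleftrightarrow> ?R")
  proof
    assume L: ?L
    show ?R
    proof (intro allI impI)
      fix i assume i: "1 \<le> i \<and> i \<le> 2 * N"
      then have "i - 1 < 2 * N" by linarith
      then have "(i - 1) mod (2 * N) + 1 = i"
        using i by (simp only: mod_less) linarith
      then show "?\<psi> i \<le> ?\<theta> i" using L i by metis
    qed
  next
    assume R: ?R
    have "(k - 1) mod (2 * N) + 1 \<le> 2 * N" for k
      using n_bounds mod_less_divisor[of "2 * N" "k - 1"] by linarith
    then show ?L using R by simp
  qed
  then show ?thesis
    unfolding angle_comparison[OF angle_facts, symmetric] using step by blast
qed

end

end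

end

theorem theorem4p1:
  fixes G :: "('v, 'e) pre_digraph" and len :: "'e \<Rightarrow> real"
    and vs :: "'v list" and n N :: nat and \<mu> :: "nat \<Rightarrow> real"
  assumes "metric_graph G len"
    and "equilateral G len"
    and "\<not> bipartite G"
    and "distinct vs" and "set vs = verts G"
    and "n = card (verts G)" and "N = card (arcs G)"
    and "\<And>i j. 1 \<le> i \<Longrightarrow> i \<le> j \<Longrightarrow> j \<le> n \<Longrightarrow> \<mu> i \<ge> \<mu> j"
    and "char_poly (transition_matrix G vs) = (\<Prod>j=1..n. [:- \<mu> j, 1:])"
  shows "(\<forall>k\<ge>1. kth_eigenvalue (standard_laplace G len) (k + 1)
                \<ge> kth_eigenvalue (anti_standard_laplace G len) (k + N - n))
     \<longleftrightarrow> (\<forall>j. 2 \<le> j \<and> j \<le> n \<longrightarrow> \<mu> j \<le> - \<mu> (n + 2 - j)) \<and>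
         (\<forall>j. 2 \<le> j \<and> j \<le> n - 2 \<longrightarrow> \<mu> j \<ge> - \<mu> (n - j))"
proof -
  interpret metric_graph G len by fact
  obtain l where l: "\<forall>e\<in>arcs G. len e = l"
    using assms(2) by (auto simp: equilateral_def)
  have anti: "\<forall>i j. 1 \<le> i \<and> i \<le> j \<and> j \<le> n \<longrightarrow> \<mu> j \<le> \<mu> i"
    using assms(8) by blast
  show ?thesis
    by (rule eigenvalue_comparison[OF l assms(3,6,7) dim_vertex_eigenspace[OF assms(4,5,6,9)] anti])
qed

end
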